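(* Let $I\subseteq R=\Bbbk[x_1,\dots,x_n]$ be a nonzero $\mathfrak S_n$-invariant monomial ideal. Then $$\{(i,\lambda)\in[n]\times P_n\mid(i,\lambda)\text{ is an extremal pair in the Betti table of }R/I\}$$ $$=\{(n-\ell(\rho),\widetilde\rho)\mid\rho\in\Lambda^*(I)\text{ is a maximal dual generator of }I\}.$$ Moreover, if $(i,\lambda)$ is the extremal pair associated to the maximal dual generator $\rho=(\infty^{p_0},d_1^{p_1},\dots,d_s^{p_s})$ (with $\infty>d_1>\cdots>d_s\ge0$, $p_0\ge0$, $p_1,\dots,p_s>0$), then the corresponding extremal Betti number is $$\beta_{i,\lambda}=\dim_\Bbbk\mathrm{Tor}_i(R/I,\Bbbk)_{\boldsymbol\lambda}=\binom{p_0+p_1-1}{p_0}.$$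
   Context: $\Bbbk$ is a field; $\mathfrak S_n$ acts on $R$ by permuting variables; $[n]=\{1,\dots,n\}$. $P_n=\{(\lambda_1,\dots,\lambda_n)\in\mathbb Z^n\mid\lambda_1\ge\cdots\ge\lambda_n\ge0\}$, ordered componentwise; $|\mathbf a|=a_1+\cdots+a_n$. For a $\mathbb Z^n$-graded module $M$ and $\lambda\in P_n$, $M_{\langle\lambda\rangle}$ is the direct sum of the components $M_{\mathbf a}$ over all $\mathbf a\in\mathbb Z^n$ that are rearrangements of $\lambda$, and $M_{\boldsymbol\lambda}$ is the single component in degree $(\lambda_1,\dots,\lambda_n)$. $(a^p,b^q,\dots)$ means $a$ repeated $p$ times, then $b$ repeated $q$ times, etc. Extremal pairs: $(i,\lambda)\in[n]\times P_n$ is extremal in the Betti table of $R/I$ if (a) $\mathrm{Tor}_i(R/I,\Bbbk)_{\langle\lambda\rangle}\ne0$, and (b) $\mathrm{Tor}_j(R/I,\Bbbk)_{\langle\mu\rangle}=0$ for all $j\ge i$ and all $\mu\in P_n$ with $\mu\ge\lambda$, $\mu\neq\lambda$ and $|\mu|-j\ge|\lambda|-i$. The extremal Betti number is then $\beta_{i,\lambda}=\dim_\Bbbk\mathrm{Tor}_i(R/I,\Bbbk)_{\boldsymbol\lambda}$. Dual generators: $P_n^\infty=\{(\lambda_1,\dots,\lambda_n)\in(\mathbb Z_{\ge0}\cup\{\infty\})^n\mid\lambda_1\ge\cdots\ge\lambda_n\ge0\}$, where $\infty\ge a$ for all $a$. For $\mu=(\infty,\dots,\infty,\mu_k,\dots,\mu_n)\in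 P_n^\infty$ with $\mu_k<\infty$ (the first $k-1$ entries being $\infty$, $1\le k\le n$), let $Q_\mu=\bigcap_{\sigma\in\mathfrak S_n}\sigma\big((x_k^{\mu_k+1},\dots,x_n^{\mu_n+1})\big)$. There is a unique finite set $\{\mu^1,\dots,\mu^t\}$ of such elements with $I=Q_{\mu^1}\cap\cdots\cap Q_{\mu^t}$ and such that no $Q_{\mu^k}$ can be omitted; this set is $\Lambda^*(I)$, the set of dual generators of $I$. For $\rho=(\infty^{p_0},d_1^{p_1},\dots,d_s^{p_s})$ with $\infty>d_1>\cdots>d_s\ge0$, put $\ell(\rho)=p_0$ and $\widetilde\rho=((d_1+1)^{p_0+p_1},(d_2+1)^{p_2},\dots,(d_s+1)^{p_s})\in P_n$. Define a partial order on $\Lambda^*(I)$ by $\mu\preccurlyeq\rho$ iff $\widetilde\mu\le\widetilde\rho$ and $\ell(\mu)-\ell(\rho)\le|\widetilde\rho|-|\widetilde\mu|$. A maximal dual generator is a maximal element of $\Lambda^*(I)$ with respect to $\preccurlyeq$. *)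

theory Defs
  imports
    "HOL-Library.Poly_Mapping"
    "HOL-Library.Function_Algebras"
    "HOL-Library.Extended_Nat"
    "HOL-Library.Cardinality"
begin

text \<open>
  The index set \<open>[n]\<close> is a nonempty finite linearly ordered type \<open>'n\<close>, so that \<open>n = CARD('n)\<close>.
  The ring \<open>R = k[x_1, \<dots>, x_n]\<close> is the type of finitely supported functions from exponent vectors
  to \<open>'k\<close>, with the convolution product of \<^theory>\<open>HOL-Library.Poly_Mapping\<close>.
\<close>

type_synonym ('n, 'k) mpoly = "('n \<Rightarrow>\<^sub>0 nat) \<Rightarrow>\<^sub>0 'k"


section \<open>Symmetric monomial ideals\<close>

abbreviation ideal :: "'r::comm_ring_1 set \<Rightarrow> bool"
  where "ideal \<equiv> module.subspace (*)"

abbreviation ideal_gen :: "'r::comm_ring_1 set \<Rightarrow> 'r set"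
  where "ideal_gen \<equiv> module.span (*)"

definition monomial :: "('n \<Rightarrow>\<^sub>0 nat) \<Rightarrow> ('n, 'k::field) mpoly"
  where "monomial m = Poly_Mapping.single m 1"

definition monomial_ideal :: "('n, 'k::field) mpoly set \<Rightarrow> bool"
  where "monomial_ideal I \<longleftrightarrow> (\<exists>M. I = ideal_gen (monomial ` M))"

text \<open>
  The action of \<open>\<sigma>\<close> sends \<open>x_j\<close> to \<open>x_(\<sigma> j)\<close>. Since \<^const>\<open>Poly_Mapping.map_key\<close> is
  contravariant, this moves exponent vectors along \<open>inv \<sigma>\<close>.
\<close>

definition permute_vars :: "('n \<Rightarrow> 'n) \<Rightarrow> ('n, 'k::field) mpoly \<Rightarrow> ('n, 'k) mpoly"
  where "permute_vars \<sigma> f =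
    (\<Sum>m\<in>Poly_Mapping.keys f.
      Poly_Mapping.single (Poly_Mapping.map_key (inv \<sigma>) m) (Poly_Mapping.lookup f m))"

definition perm_invariant :: "('n, 'k::field) mpoly set \<Rightarrow> bool"
  where "perm_invariant I \<longleftrightarrow> (\<forall>\<sigma>. bij \<sigma> \<longrightarrow> (\<forall>f\<in>I. permute_vars \<sigma> f \<in> I))"


section \<open>Multigraded free resolutions and Tor\<close>

definition homogeneous :: "('n \<Rightarrow> int) \<Rightarrow> ('n, 'k::field) mpoly \<Rightarrow> bool"
  where "homogeneous a f \<longleftrightarrow>
    (\<forall>m\<in>Poly_Mapping.keys f. \<forall>j. int (Poly_Mapping.lookup m j) = a j)"

text \<open>
  Data of an augmented complex \<open>\<dots> \<rightarrow> F_2 \<rightarrow> F_1 \<rightarrow> F_0 \<rightarrow> R/I\<close> of finitely generated graded free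
  modules. The module \<open>F_i\<close> is \<open>R^(frank i)\<close>; its \<open>b\<close>-th basis vector has multidegree
  \<open>fdeg i b\<close>. Row \<open>b\<close> of the matrix \<open>fdiff i\<close> holds the coordinates of the image in \<open>F_i\<close> of the
  \<open>b\<close>-th basis vector of \<open>F_(i+1)\<close>, and \<open>faug b\<close> represents modulo \<open>I\<close> the image in \<open>R/I\<close> of the
  \<open>b\<close>-th basis vector of \<open>F_0\<close>.
\<close>

record (overloaded) ('n, 'k) free_complex =
  frank :: "nat \<Rightarrow> nat"
  fdeg :: "nat \<Rightarrow> nat \<Rightarrow> 'n \<Rightarrow> int"
  fdiff :: "nat \<Rightarrow> nat \<Rightarrow> nat \<Rightarrow> ('n, 'k) mpoly"
  faug :: "nat \<Rightarrow> ('n, 'k) mpoly"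

definition free_mod :: "('n, 'k::field) free_complex \<Rightarrow> nat \<Rightarrow> (nat \<Rightarrow> ('n, 'k) mpoly) set"
  where "free_mod F i = {f. \<forall>b\<ge>frank F i. f b = 0}"

definition diff_map ::
  "('n, 'k::field) free_complex \<Rightarrow> nat \<Rightarrow> (nat \<Rightarrow> ('n, 'k) mpoly) \<Rightarrow> nat \<Rightarrow> ('n, 'k) mpoly"
  where "diff_map F i f =
    (\<lambda>c. if c < frank F i then \<Sum>b<frank F (Suc i). f b * fdiff F i b c else 0)"

definition aug_map :: "('n, 'k::field) free_complex \<Rightarrow> (nat \<Rightarrow> ('n, 'k) mpoly) \<Rightarrow> ('n, 'k) mpoly"
  where "aug_map F f = (\<Sum>b<frank F 0. f b * faug F b)"

definition graded_free_resolution ::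
  "('n, 'k::field) mpoly set \<Rightarrow> ('n, 'k) free_complex \<Rightarrow> bool"
  where "graded_free_resolution I F \<longleftrightarrow>
    (\<forall>b<frank F 0. homogeneous (fdeg F 0 b) (faug F b)) \<and>
    (\<forall>i. \<forall>b<frank F (Suc i). \<forall>c<frank F i.
       homogeneous (\<lambda>j. fdeg F (Suc i) b j - fdeg F i c j) (fdiff F i b c)) \<and>
    (\<forall>g. \<exists>f\<in>free_mod F 0. aug_map F f - g \<in> I) \<and>
    {f \<in> free_mod F 0. aug_map F f \<in> I} = diff_map F 0 ` free_mod F 1 \<and>
    (\<forall>i. {f \<in> free_mod F (Suc i). diff_map F i f = 0} = diff_map F (Suc i) ` free_mod F (Suc (Suc i)))"

text \<open>
  The complex \<open>F \<otimes>\<^sub>R k\<close>, where \<open>k = R/(x_1, \<dots>, x_n)\<close>: here \<open>F_i \<otimes> k\<close> is the vector space on the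
  basis of \<open>F_i\<close>, its component in multidegree \<open>a\<close> is spanned by the basis vectors of degree \<open>a\<close>,
  and the differential is given by the constant terms of the matrix entries.
\<close>

definition tensor_comp ::
  "('n, 'k::field) free_complex \<Rightarrow> nat \<Rightarrow> ('n \<Rightarrow> int) \<Rightarrow> (nat \<Rightarrow> 'k) set"
  where "tensor_comp F i a = {v. \<forall>b. v b \<noteq> 0 \<longrightarrow> b < frank F i \<and> fdeg F i b = a}"

definition tensor_diff ::
  "('n, 'k::field) free_complex \<Rightarrow> nat \<Rightarrow> (nat \<Rightarrow> 'k) \<Rightarrow> nat \<Rightarrow> 'k"
  where "tensor_diff F i v =
    (\<lambda>c. if c < frank F i
         then \<Sum>b<frank F (Suc i). v b * Poly_Mapping.lookup (fdiff F i b c) 0 else 0)"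

definition tensor_cycles ::
  "('n, 'k::field) free_complex \<Rightarrow> nat \<Rightarrow> ('n \<Rightarrow> int) \<Rightarrow> (nat \<Rightarrow> 'k) set"
  where "tensor_cycles F i a =
    {v \<in> tensor_comp F i a. \<forall>i'. i = Suc i' \<longrightarrow> tensor_diff F i' v = 0}"

definition tensor_boundaries ::
  "('n, 'k::field) free_complex \<Rightarrow> nat \<Rightarrow> ('n \<Rightarrow> int) \<Rightarrow> (nat \<Rightarrow> 'k) set"
  where "tensor_boundaries F i a = tensor_diff F i ` tensor_comp F (Suc i) a"

text \<open>
  \<open>Tor_i(R/I, k)_a\<close> is the quotient of \<open>tor_cycles I i a\<close> by its subspace \<open>tor_boundaries I i a\<close>.
  A resolution exists by Hilbert's basis theorem, and the homology does not depend on its choice.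
  All vector spaces involved are finite-dimensional, so the dimension of the quotient is a
  difference of dimensions.
\<close>

definition chosen_resolution :: "('n, 'k::field) mpoly set \<Rightarrow> ('n, 'k) free_complex"
  where "chosen_resolution I = (SOME F. graded_free_resolution I F)"

definition tor_cycles ::
  "('n, 'k::field) mpoly set \<Rightarrow> nat \<Rightarrow> ('n \<Rightarrow> int) \<Rightarrow> (nat \<Rightarrow> 'k) set"
  where "tor_cycles I = tensor_cycles (chosen_resolution I)"

definition tor_boundaries ::
  "('n, 'k::field) mpoly set \<Rightarrow> nat \<Rightarrow> ('n \<Rightarrow> int) \<Rightarrow> (nat \<Rightarrow> 'k) set"
  where "tor_boundaries I = tensor_boundaries (chosen_resolution I)"

definition tor_zero :: "('n, 'k::field) mpoly set \<Rightarrow> nat \<Rightarrow> ('n \<Rightarrow> int) \<Rightarrow> bool"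
  where "tor_zero I i a \<longleftrightarrow> tor_cycles I i a = tor_boundaries I i a"

abbreviation vdim :: "(nat \<Rightarrow> 'k::field) set \<Rightarrow> nat"
  where "vdim \<equiv> vector_space.dim (\<lambda>c v b. c * v b)"

definition tor_dim :: "('n, 'k::field) mpoly set \<Rightarrow> nat \<Rightarrow> ('n \<Rightarrow> int) \<Rightarrow> nat"
  where "tor_dim I i a = vdim (tor_cycles I i a) - vdim (tor_boundaries I i a)"


section \<open>Extremal pairs\<close>

definition partitions :: "('n::linorder \<Rightarrow> int) set"
  where "partitions = {l. antimono l \<and> (\<forall>j. l j \<ge> 0)}"

definition weight :: "('n::finite \<Rightarrow> int) \<Rightarrow> int"
  where "weight a = (\<Sum>j\<in>UNIV. a j)"

text \<open>Vanishing of the direct sum of the components over all rearrangements of \<open>l\<close>.\<close>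

definition tor_orbit_zero :: "('n, 'k::field) mpoly set \<Rightarrow> nat \<Rightarrow> ('n \<Rightarrow> int) \<Rightarrow> bool"
  where "tor_orbit_zero I i l \<longleftrightarrow> (\<forall>\<sigma>. bij \<sigma> \<longrightarrow> tor_zero I i (l \<circ> \<sigma>))"

definition extremal_pair ::
  "('n::{finite,linorder}, 'k::field) mpoly set \<Rightarrow> nat \<Rightarrow> ('n \<Rightarrow> int) \<Rightarrow> bool"
  where "extremal_pair I i l \<longleftrightarrow>
    i \<in> {1..CARD('n)} \<and> l \<in> partitions \<and>
    \<not> tor_orbit_zero I i l \<and>
    (\<forall>j\<ge>i. \<forall>m\<in>partitions.
       m \<ge> l \<and> m \<noteq> l \<and> weight m - int j \<ge> weight l - int i \<longrightarrow> tor_orbit_zero I j m)"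


section \<open>Dual generators\<close>

text \<open>
  The elements of \<open>P_n^\<infinity>\<close> with at least one finite entry; by monotonicity the infinite entries
  come first.
\<close>

definition dual_partitions :: "('n::linorder \<Rightarrow> enat) set"
  where "dual_partitions = {\<mu>. antimono \<mu> \<and> (\<exists>j. \<mu> j \<noteq> \<infinity>)}"

definition Q_ideal :: "('n \<Rightarrow> enat) \<Rightarrow> ('n, 'k::field) mpoly set"
  where "Q_ideal \<mu> =
    (\<Inter>\<sigma>\<in>{\<sigma>. bij \<sigma>}. permute_vars \<sigma> `
       ideal_gen {monomial (Poly_Mapping.single j (the_enat (\<mu> j) + 1)) | j. \<mu> j \<noteq> \<infinity>})"

text \<open>For \<open>I = R\<close> the decomposition is the empty one.\<close>

definition dual_generators :: "('n::linorder, 'k::field) mpoly set \<Rightarrow> ('n \<Rightarrow> enat) set"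
  where "dual_generators I =
    (THE L. finite L \<and> L \<subseteq> dual_partitions \<and> I = (\<Inter>\<mu>\<in>L. Q_ideal \<mu>) \<and>
       (\<forall>\<mu>\<in>L. I \<noteq> (\<Inter>\<nu>\<in>L - {\<mu>}. Q_ideal \<nu>)))"

text \<open>
  For \<open>\<rho> = (\<infinity>^p0, d1^p1, \<dots>, ds^ps)\<close> the following are \<open>p0\<close>, \<open>d1\<close>, \<open>p1\<close> and \<open>\<rho>\<close> with a tilde.
\<close>

definition dual_len :: "('n \<Rightarrow> enat) \<Rightarrow> nat"
  where "dual_len \<rho> = card {j. \<rho> j = \<infinity>}"

definition top_part :: "('n \<Rightarrow> enat) \<Rightarrow> nat"
  where "top_part \<rho> = Max {d. \<exists>j. \<rho> j = enat d}"

definition top_mult :: "('n \<Rightarrow> enat) \<Rightarrow> nat"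
  where "top_mult \<rho> = card {j. \<rho> j = enat (top_part \<rho>)}"

definition dual_tilde :: "('n \<Rightarrow> enat) \<Rightarrow> 'n \<Rightarrow> int"
  where "dual_tilde \<rho> j = (case \<rho> j of \<infinity> \<Rightarrow> int (top_part \<rho>) + 1 | enat d \<Rightarrow> int d + 1)"

definition dual_le :: "('n::finite \<Rightarrow> enat) \<Rightarrow> ('n \<Rightarrow> enat) \<Rightarrow> bool"
  where "dual_le \<mu> \<rho> \<longleftrightarrow> dual_tilde \<mu> \<le> dual_tilde \<rho> \<and>
    int (dual_len \<mu>) - int (dual_len \<rho>) \<le> weight (dual_tilde \<rho>) - weight (dual_tilde \<mu>)"

definition maximal_dual_generators ::
  "('n::{finite,linorder}, 'k::field) mpoly set \<Rightarrow> ('n \<Rightarrow> enat) set"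
  where "maximal_dual_generators I =
    {\<rho> \<in> dual_generators I. \<forall>\<mu>\<in>dual_generators I. dual_le \<rho> \<mu> \<longrightarrow> \<mu> = \<rho>}"

end

theory Submission
  imports Defs
begin

text \<open>
  Resolving the residue field by the Koszul complex instead of resolving \<open>R/I\<close> turns
  \<open>Tor_i(R/I, k)_a\<close> into the homology of a small complex: it has one basis vector for every
  \<open>i\<close>-element set \<open>S\<close> of variables such that \<open>x^(a - e_S)\<close> is a monomial outside \<open>I\<close>, and its
  differential removes elements from \<open>S\<close> (theorem \<open>tensor_koszul_hom_rel\<close>). On the other hand, a
  monomial lies outside \<open>I\<close> exactly if its exponent vector is bounded by a permutation of some dual
  generator (\<open>intersection_iff_covers\<close>). So everything is decided by comparing \<open>a - e_S\<close> with
  permuted dual generators, and two facts about these complexes suffice.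

  The first is a cone criterion (\<open>koszul_exact_cone\<close>): if \<open>a_v > 0\<close> and \<open>v\<close> can be removed from
  every basis set \<open>S\<close> of size \<open>i\<close> that contains it, then the homology in position \<open>i\<close> vanishes.
  Suppose that \<open>Tor_i\<close> does not vanish in a degree \<open>a\<close> that rearranges the partition \<open>l\<close>, and let
  \<open>v\<close> be a position where \<open>a\<close> is largest. The criterion must fail for some \<open>S\<close>, and the dual
  generator \<open>\<mu>\<close> that bounds \<open>a - e_S\<close> then satisfies
  \<open>l \<le> \<mu>~\<close>, \<open>\<ell>(\<mu>) \<le> n - i\<close> and \<open>|\<mu>~| + \<ell>(\<mu>) \<ge> |l| + n - i\<close>
  (\<open>tor_nonzero_dominated\<close>). In words: the pair \<open>(n - \<ell>(\<mu>), \<mu>~)\<close> is one of those that must have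
  vanishing \<open>Tor\<close>, or coincide with \<open>(i, l)\<close>, if \<open>(i, l)\<close> is extremal.

  The second is the computation for a skeleton (\<open>tor_dim_skeleton\<close>). At a maximal dual generator
  \<open>\<rho>\<close>, the sets that matter in position \<open>n - \<ell>(\<rho>)\<close> are the complements of the \<open>p0\<close>-element subsets
  of the block of \<open>p0 + p1\<close> positions where \<open>\<rho>~\<close> is largest, so the homology is the top cohomology
  of the \<open>(p0-1)\<close>-skeleton of a simplex with \<open>p0 + p1\<close> vertices. Its dimension is the binomial
  coefficient of the theorem, and it is positive (\<open>tor_dim_maximal\<close>).

  Both halves of the theorem follow. If \<open>\<rho>\<close> is maximal and \<open>Tor_j\<close> were nonzero at some \<open>m\<close> that
  contradicts extremality of \<open>(n - \<ell>(\<rho>), \<rho>~)\<close>, the dual generator \<open>\<mu>\<close> dominating \<open>(j, m)\<close> would lie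
  above \<open>\<rho>\<close>, hence equal \<open>\<rho>\<close>, and this forces \<open>m = \<rho>~\<close>. Conversely, let \<open>(i, l)\<close> be extremal
  and choose, among the dual generators dominating it, one with the fewest infinite entries. It is
  maximal, because passing to a strictly larger dual generator always lowers the number of infinite
  entries: otherwise the two would be comparable componentwise (\<open>le_of_dual_tilde_le\<close>), which
  irredundancy excludes. Its \<open>Tor\<close> is nonzero, so extremality of \<open>(i, l)\<close> identifies the two pairs.

  Three foundations are needed. Resolutions are studied one degree at a time: a graded free
  resolution is the same as a matrix of scalars whose restriction to the basis vectors of degree at
  most \<open>a\<close> is exact for every \<open>a\<close> (\<open>graded_free_resolution_iff\<close>). A resolution exists, namely the
  Taylor complex of a finite set of monomial generators (\<open>graded_free_resolution_exists\<close>). And the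
  irredundant set of dual generators exists and is unique (\<open>dual_generators_irredundant_cover\<close>).
\<close>

section \<open>Alternating sums over a simplex\<close>

text \<open>
  The incidence sign of \<open>T \<union> {j}\<close> over \<open>T\<close>: the parity of the position of \<open>j\<close> among the elements.
\<close>

definition sg :: "'a::linorder \<Rightarrow> 'a set \<Rightarrow> 'k::comm_ring_1"
  where "sg j T = (-1) ^ card {i \<in> T. i < j}"

text \<open>
  The boundary map of the full simplex on \<open>N\<close>, written on coefficient functions: the coefficient
  of \<open>T\<close> in the boundary of \<open>z\<close> collects those of all sets from which one removal leads to \<open>T\<close>.
  The Koszul complex and the Taylor complex are both cut out of it.
\<close>

definition drop_sum :: "'a::linorder set \<Rightarrow> ('a set \<Rightarrow> 'k::comm_ring_1) \<Rightarrow> 'a set \<Rightarrow> 'k"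
  where "drop_sum N z T = (\<Sum>j\<in>N - T. sg j T * z (insert j T))"

text \<open>
  Coning with apex \<open>v\<close>, the standard contraction of a simplex: the basis vector of \<open>T\<close> is sent,
  up to sign, to that of \<open>T \<union> {v}\<close>, or to zero if \<open>v \<in> T\<close>.
\<close>

definition cone_map :: "'a::linorder \<Rightarrow> ('a set \<Rightarrow> 'k::comm_ring_1) \<Rightarrow> 'a set \<Rightarrow> 'k"
  where "cone_map v z T = (if v \<in> T then sg v T * z (T - {v}) else 0)"

lemma sg_square [simp]: "sg j T * sg j T = 1"
  by (simp add: sg_def power_mult_distrib[symmetric])

lemma sg_insert_self [simp]: "sg j (insert j T) = sg j T"
  by (simp add: sg_def) (metis (no_types, lifting) insert_iff less_irrefl)

lemma sg_remove_self [simp]: "sg j (T - {j}) = sg j T"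
  by (simp add: sg_def) (metis (no_types, lifting) insert_iff less_irrefl)

lemma sg_insert:
  assumes "finite T" "k \<notin> T"
  shows "sg j (insert k T) = (if k < j then - sg j T else sg j T)"
proof -
  have "{i \<in> insert k T. i < j} = (if k < j then insert k {i \<in> T. i < j} else {i \<in> T. i < j})"
    by auto
  then show ?thesis using assms by (simp add: sg_def)
qed

lemma sg_swap:
  assumes "finite T" "j \<notin> T" "k \<notin> T" "j \<noteq> k"
  shows "(sg j T * sg k (insert j T) :: 'k::comm_ring_1) = - (sg k T * sg j (insert k T))"
  using assms by (cases "j < k") (auto simp: sg_insert mult.commute)

text \<open>
  Pairing \<open>(j, k)\<close> with \<open>(k, j)\<close> shows only that twice the sum vanishes, which says nothing in
  characteristic two. Splitting into \<open>j < k\<close> and \<open>k < j\<close> works over every ring.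
\<close>

lemma antisymmetric_double_sum:
  fixes f :: "'a::linorder \<Rightarrow> 'a \<Rightarrow> 'k::comm_ring_1"
  assumes "finite A" and "\<And>j k. j \<in> A \<Longrightarrow> k \<in> A \<Longrightarrow> j \<noteq> k \<Longrightarrow> f j k = - f k j"
  shows "(\<Sum>j\<in>A. \<Sum>k\<in>A - {j}. f j k) = 0"
proof -
  have split: "(\<Sum>k\<in>A - {j}. f j k) = (\<Sum>k\<in>{k\<in>A. k < j}. f j k) + (\<Sum>k\<in>{k\<in>A. j < k}. f j k)" for j
  proof -
    have "A - {j} = {k\<in>A. k < j} \<union> {k\<in>A. j < k}" by auto
    moreover have "{k\<in>A. k < j} \<inter> {k\<in>A. j < k} = {}" by auto
    ultimately show ?thesis using assms(1) by (metis (no_types, lifting) finite_Un finite_Diff sum.union_disjoint)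
  qed
  have "(\<Sum>j\<in>A. \<Sum>k\<in>{k\<in>A. k < j}. f j k) = (\<Sum>k\<in>A. \<Sum>j\<in>{j\<in>A. k < j}. f j k)"
    using assms(1) by (rule sum.swap_restrict) (rule assms(1))
  also have "\<dots> = (\<Sum>k\<in>A. \<Sum>j\<in>{j\<in>A. k < j}. - f k j)"
    using assms(2) by (intro sum.cong refl) auto
  finally show ?thesis
    by (simp add: split sum.distrib sum_negf)
qed

lemma drop_sum_drop_sum:
  fixes z :: "'a::linorder set \<Rightarrow> 'k::comm_ring_1"
  assumes "finite N" "T \<subseteq> N"
  shows "drop_sum N (drop_sum N z) T = 0"
proof -
  have fT: "finite T" using assms finite_subset by blast
  have "drop_sum N (drop_sum N z) T =
      (\<Sum>j\<in>N - T. \<Sum>k\<in>(N - T) - {j}. sg j T * sg k (insert j T) * z (insert k (insert j T)))"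
    unfolding drop_sum_def
    by (intro sum.cong refl) (auto simp: sum_distrib_left mult.assoc intro!: sum.cong)
  also have "\<dots> = 0"
  proof (rule antisymmetric_double_sum)
    fix j k assume "j \<in> N - T" "k \<in> N - T" "j \<noteq> k"
    then show "sg j T * sg k (insert j T) * z (insert k (insert j T)) =
        - (sg k T * sg j (insert k T) * z (insert j (insert k T)))"
      by (simp add: insert_commute sg_swap[OF fT, of j k])
  qed (use assms in auto)
  finally show ?thesis .
qed

text \<open>
  Every complex below is exact for the same reason: it is stable under coning from a suitable
  vertex, and this identity then writes each cycle as a boundary.
\<close>

lemma cone_homotopy:
  fixes z :: "'a::linorder set \<Rightarrow> 'k::comm_ring_1"
  assumes "finite N" "T \<subseteq> N" "v \<in> N"
  shows "drop_sum N (cone_map v z) T + cone_map v (drop_sum N z) T = z T"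
proof (cases "v \<in> T")
  case False
  then have *: "v \<in> insert j T \<longleftrightarrow> j = v" for j by auto
  have "drop_sum N (cone_map v z) T = (\<Sum>j\<in>N - T. if j = v then z T else 0)"
    unfolding drop_sum_def cone_map_def * using False
    by (intro sum.cong refl) (auto simp: mult.assoc[symmetric])
  also have "\<dots> = z T" using assms False by (simp add: sum.delta)
  finally show ?thesis using False by (simp add: cone_map_def)
next
  case True
  define T0 where "T0 = T - {v}"
  have T: "T = insert v T0" "v \<notin> T0" and fT0: "finite T0"
    using True assms by (auto simp: T0_def intro: finite_subset)
  have sw: "sg j T * (sg v (insert j T) * z (insert j T - {v})) = - (sg v T0 * (sg j T0 * z (insert j T0)))"
    if "j \<in> N - T" for j
  proof -
    have "j \<notin> T0" "j \<noteq> v" using that T by auto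
    then have "insert j T - {v} = insert j T0" using T by auto
    moreover have "sg v (insert j T) = (sg v (insert j T0) :: 'k)"
      unfolding T(1) by (subst insert_commute) simp
    moreover have "sg v T0 * sg j T = - (sg j T0 * (sg v (insert j T0) :: 'k))"
      unfolding T(1) using sg_swap[OF fT0, of v j] \<open>j \<notin> T0\<close> \<open>j \<noteq> v\<close> T by auto
    then have "sg j T * sg v (insert j T0) = - (sg v T0 * (sg j T0 :: 'k))"
    proof -
      assume a: "sg v T0 * sg j T = - (sg j T0 * (sg v (insert j T0) :: 'k))"
      have "sg j T * sg v (insert j T0) = sg v T0 * (sg v T0 * sg j T) * (sg v (insert j T0) :: 'k)"
        by (simp add: mult.assoc[symmetric])
      also have "\<dots> = - (sg v T0 * sg j T0 * (sg v (insert j T0) * sg v (insert j T0)))"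
        unfolding a by (simp only: mult_minus_left mult_minus_right mult.assoc)
      finally show ?thesis by simp
    qed
    ultimately show ?thesis by (simp add: mult.assoc[symmetric])
  qed
  have 1: "drop_sum N (cone_map v z) T = - (sg v T0 * (\<Sum>j\<in>N - T. sg j T0 * z (insert j T0)))"
    unfolding drop_sum_def cone_map_def sum_distrib_left sum_negf[symmetric]
    using True sw by (intro sum.cong refl) auto
  have NT: "N - T0 = insert v (N - T)" using T assms by auto
  have "drop_sum N z T0 = sg v T0 * z (insert v T0) + (\<Sum>j\<in>N - T. sg j T0 * z (insert j T0))"
    unfolding drop_sum_def NT using assms(1) True by simp
  then have 2: "drop_sum N z T0 = sg v T0 * z T + (\<Sum>j\<in>N - T. sg j T0 * z (insert j T0))"
    using T(1) by metis
  have "cone_map v (drop_sum N z) T = sg v T0 * drop_sum N z T0"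
    using True by (simp add: cone_map_def T0_def)
  then show ?thesis
    unfolding 1 2 by (simp add: distrib_left mult.assoc[symmetric])
qed

section \<open>Zigzags through a double complex\<close>

text \<open>
  A linear correspondence between \<open>Z/B\<close> and \<open>Z'/B'\<close> that is an isomorphism. A zigzag through a
  double complex involves choices at each step, so it naturally gives such a relation and not a map.
  The notion is symmetric, and vanishing and dimension can be transported along it.
\<close>

definition hom_rel ::
  "('k \<Rightarrow> 'u \<Rightarrow> 'u) \<Rightarrow> ('k \<Rightarrow> 'v \<Rightarrow> 'v) \<Rightarrow> 'u::ab_group_add set \<Rightarrow> 'u set \<Rightarrow> 'v::ab_group_add set \<Rightarrow> 'v set \<Rightarrow> ('u \<times> 'v) set \<Rightarrow> bool"
  where "hom_rel s t Z B Z' B' R \<longleftrightarrow>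
    R \<subseteq> Z \<times> Z' \<and> (\<forall>z\<in>Z. \<exists>z'. (z, z') \<in> R) \<and> (\<forall>z'\<in>Z'. \<exists>z. (z, z') \<in> R) \<and>
    (\<forall>(z, z')\<in>R. z \<in> B \<longleftrightarrow> z' \<in> B') \<and>
    (\<forall>(x, x')\<in>R. \<forall>(y, y')\<in>R. (x + y, x' + y') \<in> R) \<and>
    (\<forall>c. \<forall>(x, x')\<in>R. (s c x, t c x') \<in> R)"

lemma hom_relD:
  assumes "hom_rel s t Z B Z' B' R"
  shows "(x, x') \<in> R \<Longrightarrow> x \<in> Z" "(x, x') \<in> R \<Longrightarrow> x' \<in> Z'"
    and "x \<in> Z \<Longrightarrow> \<exists>x'. (x, x') \<in> R" "x' \<in> Z' \<Longrightarrow> \<exists>x. (x, x') \<in> R"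
    and "(x, x') \<in> R \<Longrightarrow> x \<in> B \<longleftrightarrow> x' \<in> B'"
    and "(x, x') \<in> R \<Longrightarrow> (y, y') \<in> R \<Longrightarrow> (x + y, x' + y') \<in> R"
    and "(x, x') \<in> R \<Longrightarrow> (s c x, t c x') \<in> R"
  using assms unfolding hom_rel_def by auto

lemma hom_rel_comp:
  assumes "hom_rel s t Z B Z' B' R" "hom_rel t u Z' B' Z'' B'' R'"
  shows "hom_rel s u Z B Z'' B'' (R O R')"
  unfolding hom_rel_def
proof (intro conjI)
  note R = hom_relD[OF assms(1)] and R' = hom_relD[OF assms(2)]
  show "\<forall>(x, x')\<in>R O R'. \<forall>(y, y')\<in>R O R'. (x + y, x' + y') \<in> R O R'"
    using R(6) R'(6) by blast
  show "\<forall>c. \<forall>(x, x')\<in>R O R'. (s c x, u c x') \<in> R O R'"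
    using R(7) R'(7) by blast
  show "\<forall>(z, z')\<in>R O R'. z \<in> B \<longleftrightarrow> z' \<in> B''"
    using R(5) R'(5) by blast
  show "\<forall>z\<in>Z. \<exists>z'. (z, z') \<in> R O R'"
    using R(2,3) R'(3) by blast
  show "\<forall>z\<in>Z''. \<exists>z'. (z', z) \<in> R O R'"
    using R(4) R'(1,4) by blast
  show "R O R' \<subseteq> Z \<times> Z''"
    using R(1) R'(2) by blast
qed

text \<open>
  An augmented first-quadrant double complex with exact rows and columns, except that row \<open>0\<close> and
  column \<open>0\<close>, which hold the augmentations, may have homology.
\<close>

locale double_complex =
  fixes sc :: "'k \<Rightarrow> 'v::ab_group_add \<Rightarrow> 'v"
    and A :: "nat \<Rightarrow> nat \<Rightarrow> 'v set"
    and dh dv :: "nat \<Rightarrow> nat \<Rightarrow> 'v \<Rightarrow> 'v"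
  assumes A_add: "x \<in> A p q \<Longrightarrow> y \<in> A p q \<Longrightarrow> x + y \<in> A p q"
    and A_diff: "x \<in> A p q \<Longrightarrow> y \<in> A p q \<Longrightarrow> x - y \<in> A p q"
    and A_sc: "x \<in> A p q \<Longrightarrow> sc c x \<in> A p q"
    and dh_add: "dh p q (x + y) = dh p q x + dh p q y"
    and dv_add: "dv p q (x + y) = dv p q x + dv p q y"
    and dh_sc: "dh p q (sc c x) = sc c (dh p q x)"
    and dv_sc: "dv p q (sc c x) = sc c (dv p q x)"
    and sc_0: "sc c 0 = 0"
    and dh_mem: "x \<in> A (Suc p) q \<Longrightarrow> dh (Suc p) q x \<in> A p q"
    and dv_mem: "x \<in> A p (Suc q) \<Longrightarrow> dv p (Suc q) x \<in> A p q"
    and dh_0: "dh 0 q x = 0"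
    and dv_0: "dv p 0 x = 0"
    and dh_dh: "x \<in> A (Suc p) q \<Longrightarrow> dh p q (dh (Suc p) q x) = 0"
    and dv_dv: "x \<in> A p (Suc q) \<Longrightarrow> dv p q (dv p (Suc q) x) = 0"
    and comm: "x \<in> A (Suc p) (Suc q) \<Longrightarrow> dh (Suc p) q (dv (Suc p) (Suc q) x) = dv p (Suc q) (dh (Suc p) (Suc q) x)"
    and row_exact: "x \<in> A p (Suc q) \<Longrightarrow> dh p (Suc q) x = 0 \<Longrightarrow> \<exists>w\<in>A (Suc p) (Suc q). dh (Suc p) (Suc q) w = x"
    and col_exact: "x \<in> A (Suc p) q \<Longrightarrow> dv (Suc p) q x = 0 \<Longrightarrow> \<exists>w\<in>A (Suc p) (Suc q). dv (Suc p) (Suc q) w = x"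
begin

text \<open>
  The quotient of \<open>bicycles\<close> by \<open>bibounds\<close> at \<open>(p, q)\<close> is the homology of row \<open>0\<close> or column \<open>0\<close> on
  the two edges, and does not change along an antidiagonal in between.
\<close>

definition bicycles :: "nat \<Rightarrow> nat \<Rightarrow> 'v set"
  where "bicycles p q = {x \<in> A p q. dh p q x = 0 \<and> dv p q x = 0}"

definition bibounds :: "nat \<Rightarrow> nat \<Rightarrow> 'v set"
  where "bibounds p q = (\<lambda>u. dh (Suc p) q (dv (Suc p) (Suc q) u)) ` A (Suc p) (Suc q)"

definition link :: "nat \<Rightarrow> nat \<Rightarrow> ('v \<times> 'v) set"
  where "link p q = {(dv (Suc p) (Suc q) w, dh (Suc p) (Suc q) w) | w.
     w \<in> A (Suc p) (Suc q) \<and> dh (Suc p) q (dv (Suc p) (Suc q) w) = 0}"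

lemma dh_diff: "dh p q (x - y) = dh p q x - dh p q y"
  by (metis add_diff_cancel_right' dh_add diff_add_cancel)

lemma dv_diff: "dv p q (x - y) = dv p q x - dv p q y"
  by (metis add_diff_cancel_right' dv_add diff_add_cancel)

text \<open>
  One step down the antidiagonal: lift \<open>x\<close> along a vertical map and push the lift along the
  horizontal one. Both directions are symmetric, rows and columns exchanging their roles.
\<close>

lemma link_hom_rel:
  "hom_rel sc sc (bicycles (Suc p) q) (bibounds (Suc p) q) (bicycles p (Suc q)) (bibounds p (Suc q)) (link p q)"
  unfolding hom_rel_def
proof (intro conjI)
  show "link p q \<subseteq> bicycles (Suc p) q \<times> bicycles p (Suc q)"
  proof clarify
    fix x y assume "(x, y) \<in> link p q"
    then obtain w where w: "w \<in> A (Suc p) (Suc q)" "dv (Suc p) (Suc q) w = x" "dh (Suc p) (Suc q) w = y"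
      "dh (Suc p) q x = 0"
      unfolding link_def by auto
    then have "dv p (Suc q) y = 0" using comm[OF w(1)] by simp
    with w show "x \<in> bicycles (Suc p) q \<and> y \<in> bicycles p (Suc q)"
      unfolding bicycles_def using dh_mem[OF w(1)] dv_mem[OF w(1)] dh_dh[OF w(1)] dv_dv[OF w(1)] by simp
  qed
  show "\<forall>z\<in>bicycles (Suc p) q. \<exists>z'. (z, z') \<in> link p q"
  proof
    fix x assume "x \<in> bicycles (Suc p) q"
    then have x: "x \<in> A (Suc p) q" "dh (Suc p) q x = 0" "dv (Suc p) q x = 0"
      unfolding bicycles_def by auto
    then obtain w where "w \<in> A (Suc p) (Suc q)" "dv (Suc p) (Suc q) w = x"
      using col_exact by blast
    then show "\<exists>y. (x, y) \<in> link p q" using x unfolding link_def by blast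
  qed
  show "\<forall>z'\<in>bicycles p (Suc q). \<exists>z. (z, z') \<in> link p q"
  proof
    fix y assume "y \<in> bicycles p (Suc q)"
    then have y: "y \<in> A p (Suc q)" "dh p (Suc q) y = 0" "dv p (Suc q) y = 0"
      unfolding bicycles_def by auto
    then obtain w where w: "w \<in> A (Suc p) (Suc q)" "dh (Suc p) (Suc q) w = y"
      using row_exact by blast
    then have "dh (Suc p) q (dv (Suc p) (Suc q) w) = 0" using y by (simp add: comm)
    then show "\<exists>x. (x, y) \<in> link p q" using w unfolding link_def by blast
  qed
  show "\<forall>(z, z')\<in>link p q. z \<in> bibounds (Suc p) q \<longleftrightarrow> z' \<in> bibounds p (Suc q)"
  proof clarify
    fix x y assume "(x, y) \<in> link p q"
    then obtain w where w: "w \<in> A (Suc p) (Suc q)" "dv (Suc p) (Suc q) w = x" "dh (Suc p) (Suc q) w = y"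
      unfolding link_def by auto
    show "x \<in> bibounds (Suc p) q \<longleftrightarrow> y \<in> bibounds p (Suc q)"
    proof
      assume "x \<in> bibounds (Suc p) q"
      then obtain u where u: "u \<in> A (Suc (Suc p)) (Suc q)"
        "x = dh (Suc (Suc p)) q (dv (Suc (Suc p)) (Suc q) u)"
        unfolding bibounds_def by auto
      have "dv (Suc p) (Suc q) (w - dh (Suc (Suc p)) (Suc q) u) = 0"
        using u w by (simp add: dv_diff comm)
      then obtain t where t: "t \<in> A (Suc p) (Suc (Suc q))"
        "dv (Suc p) (Suc (Suc q)) t = w - dh (Suc (Suc p)) (Suc q) u"
        using col_exact A_diff[OF w(1) dh_mem[OF u(1)]] by blast
      then have "dh (Suc p) (Suc q) (dv (Suc p) (Suc (Suc q)) t) = y"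
        using w u by (simp add: dh_diff dh_dh)
      then show "y \<in> bibounds p (Suc q)" unfolding bibounds_def using t(1) by blast
    next
      assume "y \<in> bibounds p (Suc q)"
      then obtain u where u: "u \<in> A (Suc p) (Suc (Suc q))"
        "y = dh (Suc p) (Suc q) (dv (Suc p) (Suc (Suc q)) u)"
        unfolding bibounds_def by auto
      have "dh (Suc p) (Suc q) (w - dv (Suc p) (Suc (Suc q)) u) = 0"
        using u w by (simp add: dh_diff)
      then obtain t where t: "t \<in> A (Suc (Suc p)) (Suc q)"
        "dh (Suc (Suc p)) (Suc q) t = w - dv (Suc p) (Suc (Suc q)) u"
        using row_exact A_diff[OF w(1) dv_mem[OF u(1)]] by blast
      then have "dh (Suc (Suc p)) q (dv (Suc (Suc p)) (Suc q) t) = x"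
        using w u by (simp add: comm dv_diff dv_dv)
      then show "x \<in> bibounds (Suc p) q" unfolding bibounds_def using t(1) by blast
    qed
  qed
  show "\<forall>(x, x')\<in>link p q. \<forall>(y, y')\<in>link p q. (x + y, x' + y') \<in> link p q"
  proof clarify
    fix x x' y y' assume "(x, x') \<in> link p q" "(y, y') \<in> link p q"
    then obtain w u where "w \<in> A (Suc p) (Suc q)" "dv (Suc p) (Suc q) w = x" "dh (Suc p) (Suc q) w = x'"
       "dh (Suc p) q x = 0" "u \<in> A (Suc p) (Suc q)" "dv (Suc p) (Suc q) u = y" "dh (Suc p) (Suc q) u = y'"
       "dh (Suc p) q y = 0"
      unfolding link_def by auto
    then show "(x + y, x' + y') \<in> link p q"
      unfolding link_def
      by (auto simp: A_add dh_add dv_add intro!: exI[of _ "w + u"])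
  qed
  show "\<forall>c. \<forall>(x, x')\<in>link p q. (sc c x, sc c x') \<in> link p q"
  proof clarify
    fix c x x' assume "(x, x') \<in> link p q"
    then obtain w where "w \<in> A (Suc p) (Suc q)" "dv (Suc p) (Suc q) w = x" "dh (Suc p) (Suc q) w = x'"
       "dh (Suc p) q x = 0" unfolding link_def by auto
    then show "(sc c x, sc c x') \<in> link p q"
      unfolding link_def by (auto simp: A_sc dh_sc dv_sc sc_0 intro!: exI[of _ "sc c w"])
  qed
qed

lemma zigzag_partial:
  "k \<le> i \<Longrightarrow> \<exists>R. hom_rel sc sc (bicycles (Suc i) 0) (bibounds (Suc i) 0)
     (bicycles (i - k) (Suc k)) (bibounds (i - k) (Suc k)) R"
proof (induction k)
  case 0
  then show ?case using link_hom_rel[of i 0] by auto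
next
  case (Suc k)
  then obtain R where "hom_rel sc sc (bicycles (Suc i) 0) (bibounds (Suc i) 0)
     (bicycles (i - k) (Suc k)) (bibounds (i - k) (Suc k)) R" by auto
  moreover have "i - k = Suc (i - Suc k)" using Suc.prems by auto
  ultimately show ?case using link_hom_rel[of "i - Suc k" "Suc k"] hom_rel_comp by metis
qed

theorem row_column_hom_rel:
  "\<exists>R. hom_rel sc sc {x \<in> A (Suc i) 0. dh (Suc i) 0 x = 0} (dh (Suc (Suc i)) 0 ` A (Suc (Suc i)) 0)
     {y \<in> A 0 (Suc i). dv 0 (Suc i) y = 0} (dv 0 (Suc (Suc i)) ` A 0 (Suc (Suc i))) R"
proof -
  have "bicycles (Suc i) 0 = {x \<in> A (Suc i) 0. dh (Suc i) 0 x = 0}"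
    "bicycles 0 (Suc i) = {y \<in> A 0 (Suc i). dv 0 (Suc i) y = 0}"
    by (auto simp: bicycles_def dh_0 dv_0)
  moreover have "bibounds (Suc i) 0 = dh (Suc (Suc i)) 0 ` A (Suc (Suc i)) 0"
  proof -
    have "dv (Suc (Suc i)) (Suc 0) ` A (Suc (Suc i)) (Suc 0) = A (Suc (Suc i)) 0"
      using col_exact[OF _ dv_0] dv_mem by blast
    then show ?thesis unfolding bibounds_def by (metis image_image)
  qed
  moreover have "bibounds 0 (Suc i) = dv 0 (Suc (Suc i)) ` A 0 (Suc (Suc i))"
  proof -
    have "bibounds 0 (Suc i) = (\<lambda>u. dv 0 (Suc (Suc i)) (dh (Suc 0) (Suc (Suc i)) u)) ` A (Suc 0) (Suc (Suc i))"
      unfolding bibounds_def by (intro image_cong refl) (simp add: comm)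
    moreover have "dh (Suc 0) (Suc (Suc i)) ` A (Suc 0) (Suc (Suc i)) = A 0 (Suc (Suc i))"
      using row_exact[OF _ dh_0] dh_mem by blast
    ultimately show ?thesis by (metis image_image)
  qed
  ultimately show ?thesis using zigzag_partial[of i i] by auto
qed

end

section \<open>Monomial ideals and multidegrees\<close>

abbreviation lookup where "lookup \<equiv> Poly_Mapping.lookup"
abbreviation keys where "keys \<equiv> Poly_Mapping.keys"
abbreviation single where "single \<equiv> Poly_Mapping.single"
abbreviation map_key where "map_key \<equiv> Poly_Mapping.map_key"

text \<open>
  Negative entries are cut off at \<open>0\<close>, so the monomial with exponent vector \<open>a\<close> is meant only for
  \<open>0 \<le> a\<close>.
\<close>

definition expo :: "('n::finite \<Rightarrow> int) \<Rightarrow> 'n \<Rightarrow>\<^sub>0 nat"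
  where "expo a = Abs_poly_mapping (\<lambda>j. nat (a j))"

definition mdeg :: "('n \<Rightarrow>\<^sub>0 nat) \<Rightarrow> 'n \<Rightarrow> int"
  where "mdeg m j = int (lookup m j)"

text \<open>
  The exponent vectors of the monomials outside \<open>I\<close>, inside \<open>\<int>^n\<close> like all degrees below.
\<close>

definition standard :: "('n::finite, 'k::field) mpoly set \<Rightarrow> ('n \<Rightarrow> int) set"
  where "standard I = {a. 0 \<le> a \<and> monomial (expo a) \<notin> I}"

lemma lookup_expo [simp]: "lookup (expo a) j = nat (a j)"
  by (simp add: expo_def)

lemma expo_mdeg [simp]: "expo (mdeg m) = m"
  by (rule poly_mapping_eqI) (simp add: mdeg_def)

lemma mdeg_expo: "0 \<le> a \<Longrightarrow> mdeg (expo a) = a"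
  by (auto simp: mdeg_def le_fun_def)

lemma mdeg_nonneg [simp]: "0 \<le> mdeg m"
  by (simp add: mdeg_def le_fun_def)

lemma expo_add: "0 \<le> a \<Longrightarrow> 0 \<le> b \<Longrightarrow> expo (a + b) = expo a + expo b"
  by (rule poly_mapping_eqI) (simp add: le_fun_def lookup_add nat_add_distrib)

lemma expo_eq_iff: "0 \<le> a \<Longrightarrow> 0 \<le> b \<Longrightarrow> expo a = expo b \<longleftrightarrow> a = b"
  by (metis mdeg_expo)

lemma mdeg_add: "mdeg (m + n) = mdeg m + mdeg n"
  by (auto simp: mdeg_def lookup_add)

lemma homogeneous_iff: "homogeneous a f \<longleftrightarrow> (\<forall>m\<in>keys f. mdeg m = a)"
  by (auto simp: homogeneous_def mdeg_def fun_eq_iff)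

lemma homogeneous_single:
  assumes "homogeneous a f"
  shows "f = single (expo a) (lookup f (expo a))"
    and "lookup f (expo a) \<noteq> 0 \<Longrightarrow> 0 \<le> a"
proof -
  have *: "m = expo a" if "m \<in> keys f" for m
    using that assms by (auto simp: homogeneous_iff dest!: bspec)
  show "f = single (expo a) (lookup f (expo a))"
    by (rule poly_mapping_eqI) (metis * in_keys_iff lookup_single_eq lookup_single_not_eq)
  show "0 \<le> a" if "lookup f (expo a) \<noteq> 0"
    using that assms mdeg_nonneg by (metis homogeneous_iff in_keys_iff)
qed

lemma sum_single_keys:
  fixes f :: "'a \<Rightarrow>\<^sub>0 'b::comm_monoid_add"
  shows "(\<Sum>m\<in>keys f. single m (lookup f m)) = f"
proof (rule poly_mapping_eqI)
  fix k
  have "(\<Sum>m\<in>keys f. lookup (single m (lookup f m)) k)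
      = (\<Sum>m\<in>keys f. if m = k then lookup f m else 0)"
    by (intro sum.cong refl) (simp add: lookup_single when_def)
  then show "lookup (\<Sum>m\<in>keys f. single m (lookup f m)) k
      = lookup f k"
    by (simp add: lookup_sum in_keys_iff)
qed

lemma mult_single_expand:
  fixes f :: "'a::comm_monoid_add \<Rightarrow>\<^sub>0 'k::comm_ring_1"
  shows "f * single m s =
    (\<Sum>l\<in>keys f. single (l + m) (lookup f l * s))"
  by (subst sum_single_keys[of f, symmetric]) (simp add: sum_distrib_right mult_single)

lemma lookup_mult_single:
  fixes f :: "'a::cancel_comm_monoid_add \<Rightarrow>\<^sub>0 'k::comm_ring_1"
  shows "lookup (f * single m s) (l + m) = lookup f l * s"
proof -
  have "lookup (f * single m s) (l + m) =
      (\<Sum>l'\<in>keys f. if l' = l then lookup f l' * s else 0)"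
    unfolding mult_single_expand lookup_sum by (intro sum.cong refl) (simp add: lookup_single when_def)
  then show ?thesis by (simp add: in_keys_iff)
qed

lemma lookup_mult_single_0:
  fixes f :: "'a::cancel_comm_monoid_add \<Rightarrow>\<^sub>0 'k::comm_ring_1"
  assumes "\<And>l. k \<noteq> l + m"
  shows "lookup (f * single m s) k = 0"
  unfolding mult_single_expand lookup_sum
  using assms by (intro sum.neutral) (metis lookup_single_not_eq)

interpretation ideal: module "(*) :: 'r::comm_ring_1 \<Rightarrow> 'r \<Rightarrow> 'r"
  by unfold_locales (auto simp: algebra_simps)

text \<open>
  For multiplication this rule is associativity from right to left, which loops with the usual
  normalization.
\<close>

declare ideal.scale_scale [simp del]

definition upper :: "('n \<Rightarrow>\<^sub>0 nat) set \<Rightarrow> ('n \<Rightarrow>\<^sub>0 nat) set"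
  where "upper M = {m + l | m l. m \<in> M}"

lemma monomial_mult: "single l s * monomial m = single (l + m) s"
  by (simp add: monomial_def mult_single)

text \<open>
  Every polynomial combination of the generators has only multiples of generators among its
  monomials, and a polynomial with this property is the sum of its terms.
\<close>

lemma ideal_gen_monomials:
  "ideal_gen (monomial ` M) = {f :: ('n, 'k::field) mpoly. keys f \<subseteq> upper M}"
proof (rule antisym)
  show "ideal_gen (monomial ` M) \<subseteq> {f :: ('n, 'k) mpoly. keys f \<subseteq> upper M}"
  proof (rule ideal.span_minimal)
    show "monomial ` M \<subseteq> {f :: ('n, 'k) mpoly. keys f \<subseteq> upper M}"
      by (auto simp: monomial_def upper_def) (metis add.right_neutral)
    have up: "l + m \<in> upper M" if m: "m \<in> upper M" for l m
    proof -
      obtain m0 l0 where "m0 \<in> M" "m = m0 + l0" using m unfolding upper_def by blast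
      then have "m0 \<in> M" "l + m = m0 + (l + l0)" by (auto simp: add.left_commute)
      then show ?thesis unfolding upper_def by blast
    qed
    show "ideal {f :: ('n, 'k) mpoly. keys f \<subseteq> upper M}"
    proof (rule ideal.subspaceI)
      fix f g :: "('n, 'k) mpoly"
      assume "f \<in> {f. keys f \<subseteq> upper M}" "g \<in> {f. keys f \<subseteq> upper M}"
      then show "f + g \<in> {f. keys f \<subseteq> upper M}" using keys_add[of f g] by auto
    next
      fix c f :: "('n, 'k) mpoly"
      assume "f \<in> {f. keys f \<subseteq> upper M}"
      then have "{a + b |a b. a \<in> keys c \<and> b \<in> keys f} \<subseteq> upper M"
        using up by blast
      then show "c * f \<in> {f. keys f \<subseteq> upper M}" using keys_mult[of c f] by auto
    qed simp
  qed
next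
  show "{f :: ('n, 'k) mpoly. keys f \<subseteq> upper M} \<subseteq> ideal_gen (monomial ` M)"
  proof clarify
    fix f :: "('n, 'k) mpoly" assume f: "keys f \<subseteq> upper M"
    have "single k s \<in> ideal_gen (monomial ` M)" if k: "k \<in> keys f" for k and s :: 'k
    proof -
      obtain m l where "m \<in> M" "k = m + l" using k f unfolding upper_def by blast
      then show ?thesis
        using ideal.span_scale[OF ideal.span_base, of "monomial m" "monomial ` M" "single l s"]
        by (simp add: monomial_mult add.commute)
    qed
    then have "(\<Sum>m\<in>keys f. single m (lookup f m)) \<in> ideal_gen (monomial ` M)"
      by (intro ideal.span_sum)
    then show "f \<in> ideal_gen (monomial ` M)" by (simp add: sum_single_keys)
  qed
qed

lemma monomial_ideal_keys:
  fixes I :: "('n, 'k::field) mpoly set"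
  assumes "monomial_ideal I"
  shows "f \<in> I \<longleftrightarrow> (\<forall>m\<in>keys f. monomial m \<in> I)"
proof -
  obtain M where "I = ideal_gen (monomial ` M)" using assms unfolding monomial_ideal_def by blast
  then have "I = {f. keys f \<subseteq> upper M}" by (simp add: ideal_gen_monomials)
  then show ?thesis by (auto simp: monomial_def)
qed

lemma monomial_ideal_upper:
  fixes I :: "('n, 'k::field) mpoly set"
  assumes "ideal I" "monomial m \<in> I"
  shows "monomial (l + m) \<in> I"
  using ideal.subspace_scale[OF assms, of "single l 1"]
  by (simp add: monomial_mult) (simp add: monomial_def)

lemma standard_mono:
  assumes "ideal I" "a \<in> standard I" "0 \<le> b" "b \<le> a"
  shows "b \<in> standard I"
proof -
  have "expo a = expo (a - b) + expo b"
    using assms(3,4) expo_add[of "a - b" b] by (simp add: le_fun_def)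
  then show ?thesis
    using assms monomial_ideal_upper[OF assms(1), of "expo b" "expo (a - b)"]
    unfolding standard_def by auto
qed

section \<open>Degree strands of a graded complex\<close>

definition homog_complex :: "('n, 'k::field) free_complex \<Rightarrow> bool"
  where "homog_complex F \<longleftrightarrow>
    (\<forall>b<frank F 0. homogeneous (fdeg F 0 b) (faug F b)) \<and>
    (\<forall>i. \<forall>b<frank F (Suc i). \<forall>c<frank F i.
       homogeneous (\<lambda>j. fdeg F (Suc i) b j - fdeg F i c j) (fdiff F i b c))"

text \<open>
  A homogeneous matrix entry is a scalar multiple of one monomial, whose exponent vector is the
  difference of the degrees. All information is therefore in the scalar; it vanishes when the
  difference has a negative entry.
\<close>

definition scal :: "('n::finite, 'k::field) free_complex \<Rightarrow> nat \<Rightarrow> nat \<Rightarrow> nat \<Rightarrow> 'k"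
  where "scal F p b c = lookup (fdiff F p b c) (expo (fdeg F (Suc p) b - fdeg F p c))"

definition scal_aug :: "('n::finite, 'k::field) free_complex \<Rightarrow> nat \<Rightarrow> 'k"
  where "scal_aug F b = lookup (faug F b) (expo (fdeg F 0 b))"

text \<open>
  The component of \<open>F_p\<close> in degree \<open>a\<close> has the basis \<open>x^(a - deg b) b\<close> with \<open>deg b \<le> a\<close>. In these
  coordinates the differential is the same scalar matrix for all \<open>a\<close>.
\<close>

definition strand :: "('n, 'k::field) free_complex \<Rightarrow> nat \<Rightarrow> ('n \<Rightarrow> int) \<Rightarrow> (nat \<Rightarrow> 'k) set"
  where "strand F p a = {w. \<forall>b. w b \<noteq> 0 \<longrightarrow> b < frank F p \<and> fdeg F p b \<le> a}"

definition sdiff :: "('n::finite, 'k::field) free_complex \<Rightarrow> nat \<Rightarrow> (nat \<Rightarrow> 'k) \<Rightarrow> nat \<Rightarrow> 'k"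
  where "sdiff F p w = (\<lambda>c. if c < frank F p then \<Sum>b<frank F (Suc p). w b * scal F p b c else 0)"

definition saug :: "('n::finite, 'k::field) free_complex \<Rightarrow> (nat \<Rightarrow> 'k) \<Rightarrow> 'k"
  where "saug F w = (\<Sum>b<frank F 0. w b * scal_aug F b)"

definition exact_strands :: "('n::finite, 'k::field) mpoly set \<Rightarrow> ('n, 'k) free_complex \<Rightarrow> bool"
  where "exact_strands I F \<longleftrightarrow> (\<forall>a.
    (a \<in> standard I \<longrightarrow> (\<exists>w\<in>strand F 0 a. saug F w = 1)) \<and>
    {w \<in> strand F 0 a. a \<in> standard I \<longrightarrow> saug F w = 0} = sdiff F 0 ` strand F 1 a \<and>
    (\<forall>p. {w \<in> strand F (Suc p) a. sdiff F p w = 0} = sdiff F (Suc p) ` strand F (Suc (Suc p)) a))"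

text \<open>
  The inclusion of the degree \<open>a\<close> component and the projection onto it, in strand coordinates.
\<close>

definition emb :: "('n::finite, 'k::field) free_complex \<Rightarrow> nat \<Rightarrow> ('n \<Rightarrow> int) \<Rightarrow> (nat \<Rightarrow> 'k) \<Rightarrow> nat \<Rightarrow> ('n, 'k) mpoly"
  where "emb F p a w = (\<lambda>b. if b < frank F p then single (expo (a - fdeg F p b)) (w b) else 0)"

definition proj :: "('n::finite, 'k::field) free_complex \<Rightarrow> nat \<Rightarrow> ('n \<Rightarrow> int) \<Rightarrow> (nat \<Rightarrow> ('n, 'k) mpoly) \<Rightarrow> nat \<Rightarrow> 'k"
  where "proj F p a f = (\<lambda>b. if b < frank F p \<and> fdeg F p b \<le> a
    then lookup (f b) (expo (a - fdeg F p b)) else 0)"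

lemma homog_complex_diff:
  assumes "homog_complex F" "b < frank F (Suc p)" "c < frank F p"
  shows "fdiff F p b c = single (expo (fdeg F (Suc p) b - fdeg F p c)) (scal F p b c)"
    and "scal F p b c \<noteq> 0 \<Longrightarrow> fdeg F p c \<le> fdeg F (Suc p) b"
proof -
  have *: "homogeneous (fdeg F (Suc p) b - fdeg F p c) (fdiff F p b c)"
    using assms unfolding homog_complex_def by (simp add: fun_diff_def)
  show "fdiff F p b c = single (expo (fdeg F (Suc p) b - fdeg F p c)) (scal F p b c)"
    using homogeneous_single(1)[OF *] by (simp add: scal_def)
  show "fdeg F p c \<le> fdeg F (Suc p) b" if "scal F p b c \<noteq> 0"
    using homogeneous_single(2)[OF *] that by (simp add: scal_def le_fun_def)
qed

lemma homog_complex_aug: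
  assumes "homog_complex F" "b < frank F 0"
  shows "faug F b = single (expo (fdeg F 0 b)) (scal_aug F b)"
    and "scal_aug F b \<noteq> 0 \<Longrightarrow> 0 \<le> fdeg F 0 b"
proof -
  have *: "homogeneous (fdeg F 0 b) (faug F b)"
    using assms unfolding homog_complex_def by simp
  show "faug F b = single (expo (fdeg F 0 b)) (scal_aug F b)"
    using homogeneous_single(1)[OF *] by (simp add: scal_aug_def)
  show "0 \<le> fdeg F 0 b" if "scal_aug F b \<noteq> 0"
    using homogeneous_single(2)[OF *] that by (simp add: scal_aug_def)
qed

lemma single_expo_mult:
  assumes "w \<noteq> 0 \<Longrightarrow> d \<le> a" "s \<noteq> 0 \<Longrightarrow> e \<le> d"
  shows "single (expo (a - d)) w * single (expo (d - e)) s =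
    single (expo (a - e)) (w * s :: 'k::field)"
proof (cases "w = 0 \<or> s = 0")
  case False
  then have "expo (a - e) = expo (a - d) + expo (d - e)"
    using assms expo_add[of "a - d" "d - e"] by (simp add: le_fun_def)
  then show ?thesis by (simp add: mult_single)
qed auto

text \<open>
  Multiplication by the entry of degree \<open>d - e\<close> moves the coefficient in position \<open>a - d\<close> to position
  \<open>a - e\<close>; this is what makes the projections commute with the differential.
\<close>

lemma lookup_mult_single_expo:
  fixes g :: "('n::finite, 'k::field) mpoly"
  assumes "s \<noteq> 0 \<Longrightarrow> e \<le> d" "e \<le> a"
  shows "lookup (g * single (expo (d - e)) s) (expo (a - e)) =
    (if d \<le> a then lookup g (expo (a - d)) else 0) * s"
proof (cases "s = 0")
  case False
  then have ed: "e \<le> d" using assms by auto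
  show ?thesis
  proof (cases "d \<le> a")
    case True
    then have "expo (a - e) = expo (a - d) + expo (d - e)"
      using ed expo_add[of "a - d" "d - e"] by (simp add: le_fun_def)
    then show ?thesis using True by (simp add: lookup_mult_single)
  next
    case False
    have "expo (a - e) \<noteq> l + expo (d - e)" for l
    proof
      assume eq: "expo (a - e) = l + expo (d - e)"
      have "mdeg (expo (a - e)) = a - e" "mdeg (expo (d - e)) = d - e"
        using ed assms(2) by (auto intro!: mdeg_expo simp: le_fun_def)
      then have "a - e = mdeg l + (d - e)" using eq mdeg_add by metis
      then have "a = mdeg l + d" by (metis add_diff_eq diff_add_cancel)
      then have "d \<le> a" using mdeg_nonneg[of l] by (auto simp: le_fun_def)
      with False show False by simp
    qed
    then show ?thesis using False by (simp add: lookup_mult_single_0)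
  qed
qed auto

lemma sdiff_strand:
  assumes "homog_complex F" "w \<in> strand F (Suc p) a"
  shows "sdiff F p w \<in> strand F p a"
  unfolding strand_def
proof (clarify)
  fix c assume c: "sdiff F p w c \<noteq> 0"
  then have cf: "c < frank F p" by (auto simp: sdiff_def split: if_splits)
  with c obtain b where b: "b < frank F (Suc p)" "w b * scal F p b c \<noteq> 0"
    unfolding sdiff_def by (auto elim!: sum.not_neutral_contains_not_neutral)
  then have "fdeg F p c \<le> fdeg F (Suc p) b" using homog_complex_diff(2)[OF assms(1) b(1) cf] by auto
  also have "\<dots> \<le> a" using b assms(2) unfolding strand_def by auto
  finally show "c < frank F p \<and> fdeg F p c \<le> a" using cf by auto
qed

lemma diff_map_emb:
  assumes "homog_complex F" "w \<in> strand F (Suc p) a"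
  shows "diff_map F p (emb F (Suc p) a w) = emb F p a (sdiff F p w)"
proof
  fix c
  show "diff_map F p (emb F (Suc p) a w) c = emb F p a (sdiff F p w) c"
  proof (cases "c < frank F p")
    case True
    have "(\<Sum>b<frank F (Suc p). emb F (Suc p) a w b * fdiff F p b c) =
        (\<Sum>b<frank F (Suc p). single (expo (a - fdeg F p c)) (w b * scal F p b c))"
    proof (intro sum.cong refl)
      fix b assume "b \<in> {..<frank F (Suc p)}"
      then have b: "b < frank F (Suc p)" by simp
      have *: "fdeg F (Suc p) b \<le> a" if "w b \<noteq> 0" using that assms(2) by (simp add: strand_def)
      show "emb F (Suc p) a w b * fdiff F p b c = single (expo (a - fdeg F p c)) (w b * scal F p b c)"
        unfolding homog_complex_diff(1)[OF assms(1) b True]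
        using b single_expo_mult[OF * homog_complex_diff(2)[OF assms(1) b True]] by (simp add: emb_def)
    qed
    also have "\<dots> = single (expo (a - fdeg F p c)) (\<Sum>b<frank F (Suc p). w b * scal F p b c)"
      by (rule poly_mapping_eqI) (simp add: lookup_sum lookup_single when_def)
    finally show ?thesis using True by (simp add: diff_map_def emb_def sdiff_def)
  qed (simp add: diff_map_def emb_def)
qed

lemma proj_diff_map:
  assumes "homog_complex F"
  shows "proj F p a (diff_map F p f) = sdiff F p (proj F (Suc p) a f)"
proof
  fix c
  show "proj F p a (diff_map F p f) c = sdiff F p (proj F (Suc p) a f) c"
  proof (cases "c < frank F p \<and> fdeg F p c \<le> a")
    case True
    then have c: "c < frank F p" "fdeg F p c \<le> a" by auto
    have "lookup (f b * fdiff F p b c) (expo (a - fdeg F p c)) = proj F (Suc p) a f b * scal F p b c"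
      if b: "b < frank F (Suc p)" for b
      unfolding homog_complex_diff(1)[OF assms b c(1)]
      using lookup_mult_single_expo[OF homog_complex_diff(2)[OF assms b c(1)] c(2), of "scal F p b c"] b
      by (simp add: proj_def)
    then show ?thesis using c by (simp add: proj_def[of F p] diff_map_def sdiff_def lookup_sum)
  next
    case False
    have "proj F (Suc p) a f \<in> strand F (Suc p) a" by (simp add: proj_def strand_def)
    then have "sdiff F p (proj F (Suc p) a f) c = 0"
      using sdiff_strand[OF assms] False unfolding strand_def by blast
    moreover have "proj F p a (diff_map F p f) c = 0" using False by (auto simp: proj_def)
    ultimately show ?thesis by simp
  qed
qed

lemma aug_map_emb:
  assumes "homog_complex F" "w \<in> strand F 0 a"
  shows "aug_map F (emb F 0 a w) = single (expo a) (saug F w)"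
proof -
  have "aug_map F (emb F 0 a w) = (\<Sum>b<frank F 0. single (expo a) (w b * scal_aug F b))"
    unfolding aug_map_def
  proof (intro sum.cong refl)
    fix b assume "b \<in> {..<frank F 0}"
    then have b: "b < frank F 0" by simp
    have *: "fdeg F 0 b \<le> a" if "w b \<noteq> 0" using that assms(2) by (simp add: strand_def)
    show "emb F 0 a w b * faug F b = single (expo a) (w b * scal_aug F b)"
      unfolding homog_complex_aug(1)[OF assms(1) b]
      using b single_expo_mult[OF * homog_complex_aug(2)[OF assms(1) b]] by (simp add: emb_def)
  qed
  also have "\<dots> = single (expo a) (saug F w)"
    unfolding saug_def by (rule poly_mapping_eqI) (simp add: lookup_sum lookup_single when_def)
  finally show ?thesis .
qed

lemma lookup_aug_map:
  assumes "homog_complex F" "0 \<le> a"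
  shows "lookup (aug_map F f) (expo a) = saug F (proj F 0 a f)"
proof -
  have "lookup (f b * faug F b) (expo a) = proj F 0 a f b * scal_aug F b"
    if b: "b < frank F 0" for b
    unfolding homog_complex_aug(1)[OF assms(1) b]
    using lookup_mult_single_expo[OF homog_complex_aug(2)[OF assms(1) b] assms(2), of "scal_aug F b"] b
    by (simp add: proj_def)
  then show ?thesis by (simp add: aug_map_def saug_def lookup_sum)
qed

lemma emb_free_mod: "emb F p a w \<in> free_mod F p"
  by (simp add: emb_def free_mod_def)

lemma proj_strand: "proj F p a f \<in> strand F p a"
  by (simp add: proj_def strand_def)

lemma proj_emb: "w \<in> strand F p a \<Longrightarrow> proj F p a (emb F p a w) = w"
  by (auto simp: proj_def emb_def strand_def fun_eq_iff)

lemma emb_decomposition: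
  assumes "f \<in> free_mod F p"
  shows "\<exists>A. finite A \<and> f = (\<Sum>a\<in>A. emb F p a (proj F p a f))"
proof (intro exI conjI)
  let ?A = "\<Union>b<frank F p. (\<lambda>m. fdeg F p b + mdeg m) ` keys (f b)"
  show "finite ?A" by auto
  show "f = (\<Sum>a\<in>?A. emb F p a (proj F p a f))"
  proof
    fix b
    have sum_ap: "(\<Sum>a\<in>A. emb F p a (proj F p a f)) b = (\<Sum>a\<in>A. emb F p a (proj F p a f) b)" for A
      by (induction A rule: infinite_finite_induct) auto
    show "f b = (\<Sum>a\<in>?A. emb F p a (proj F p a f)) b"
    proof (cases "b < frank F p")
      case True
      show ?thesis unfolding sum_ap
      proof (rule poly_mapping_eqI)
        fix m
        have "lookup (emb F p a (proj F p a f) b) m =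
            (if a = fdeg F p b + mdeg m then lookup (f b) m else 0)" for a
        proof (cases "a = fdeg F p b + mdeg m")
          case True': True
          then have "a - fdeg F p b = mdeg m" "fdeg F p b \<le> a"
            using mdeg_nonneg[of m] by (auto simp: le_fun_def)
          then show ?thesis using True True' by (simp add: emb_def proj_def)
        next
          case False
          have "m \<noteq> expo (a - fdeg F p b)" if "fdeg F p b \<le> a"
            using that False mdeg_expo[of "a - fdeg F p b"] by (auto simp: le_fun_def)
          then show ?thesis using True False
            by (auto simp: emb_def proj_def lookup_single when_def)
        qed
        then have "lookup (\<Sum>a\<in>?A. emb F p a (proj F p a f) b) m =
            (if fdeg F p b + mdeg m \<in> ?A then lookup (f b) m else 0)"
          by (simp add: lookup_sum)
        moreover have "lookup (f b) m = 0" if "fdeg F p b + mdeg m \<notin> ?A"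
          using that True by (metis (no_types, lifting) UN_I image_eqI in_keys_iff lessThan_iff)
        ultimately show "lookup (f b) m = lookup (\<Sum>a\<in>?A. emb F p a (proj F p a f) b) m"
          by auto
      qed
    next
      case False
      then show ?thesis unfolding sum_ap using assms by (simp add: emb_def free_mod_def)
    qed
  qed
qed

lemma diff_map_add: "diff_map F p (f + g) = diff_map F p f + diff_map F p g"
  by (auto simp: diff_map_def fun_eq_iff distrib_right sum.distrib)

lemma diff_map_zero: "diff_map F p 0 = 0"
  by (auto simp: diff_map_def fun_eq_iff)

lemma diff_map_sum: "diff_map F p (\<Sum>a\<in>A. g a) = (\<Sum>a\<in>A. diff_map F p (g a))"
proof (induction A rule: infinite_finite_induct)
  case (insert x A)
  show ?case unfolding sum.insert[OF insert(1,2)] diff_map_add insert(3) ..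
qed (simp_all only: sum.infinite not_False_eq_True sum.empty diff_map_zero)

lemma aug_map_add: "aug_map F (f + g) = aug_map F f + aug_map F g"
  by (auto simp: aug_map_def distrib_right sum.distrib)

lemma aug_map_zero: "aug_map F 0 = 0"
  by (auto simp: aug_map_def)

lemma aug_map_sum: "aug_map F (\<Sum>a\<in>A. g a) = (\<Sum>a\<in>A. aug_map F (g a))"
proof (induction A rule: infinite_finite_induct)
  case (insert x A)
  show ?case unfolding sum.insert[OF insert(1,2)] aug_map_add insert(3) ..
qed (simp_all only: sum.infinite not_False_eq_True sum.empty aug_map_zero)

lemma free_mod_sum: "(\<And>a. a \<in> A \<Longrightarrow> g a \<in> free_mod F p) \<Longrightarrow> (\<Sum>a\<in>A. g a) \<in> free_mod F p"
  by (induction A rule: infinite_finite_induct) (auto simp: free_mod_def)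

lemma emb_zero: "emb F p a 0 = 0"
  by (auto simp: emb_def fun_eq_iff)

lemma proj_zero: "proj F p a 0 = 0"
  by (auto simp: proj_def fun_eq_iff)

text \<open>
  An element of a free module is the finite sum of its homogeneous components, so preimages of the
  components add up to a preimage.
\<close>

lemma image_of_strandwise_image:
  assumes h: "homog_complex F" and f: "f \<in> free_mod F p"
    and ex: "\<And>a. \<exists>u\<in>strand F (Suc p) a. sdiff F p u = proj F p a f"
  shows "f \<in> diff_map F p ` free_mod F (Suc p)"
proof -
  obtain A where A: "f = (\<Sum>a\<in>A. emb F p a (proj F p a f))"
    using emb_decomposition[OF f] by blast
  obtain u where u: "\<And>a. u a \<in> strand F (Suc p) a" "\<And>a. sdiff F p (u a) = proj F p a f"
    using ex by metis
  have "diff_map F p (\<Sum>a\<in>A. emb F (Suc p) a (u a)) = (\<Sum>a\<in>A. emb F p a (proj F p a f))"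
    unfolding diff_map_sum by (intro sum.cong refl) (simp add: diff_map_emb[OF h u(1)] u(2))
  with A have "f = diff_map F p (\<Sum>a\<in>A. emb F (Suc p) a (u a))" by simp
  then show ?thesis using free_mod_sum[of A "\<lambda>a. emb F (Suc p) a (u a)"] emb_free_mod by blast
qed

text \<open>
  All maps are homogeneous, so exactness can be tested on components. The degrees of a strand range
  over \<open>\<int>^n\<close>; the augmentation target is one-dimensional in the standard degrees and zero in all
  others, which accounts for the side conditions in \<open>exact_strands\<close>.
\<close>

lemma graded_free_resolution_iff:
  fixes I :: "('n::finite, 'k::field) mpoly set"
  assumes I: "ideal I" "monomial_ideal I"
  shows "graded_free_resolution I F \<longleftrightarrow> homog_complex F \<and> exact_strands I F"
proof
  assume res: "graded_free_resolution I F"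
  then have h: "homog_complex F"
    unfolding graded_free_resolution_def homog_complex_def by (elim conjE) (intro conjI)
  have surj: "\<exists>f\<in>free_mod F 0. aug_map F f - g \<in> I" for g
    using res unfolding graded_free_resolution_def by (elim conjE) (erule spec)
  have ex0: "{f \<in> free_mod F 0. aug_map F f \<in> I} = diff_map F 0 ` free_mod F 1"
    using res unfolding graded_free_resolution_def by (elim conjE)
  have ex: "{f \<in> free_mod F (Suc i). diff_map F i f = 0} = diff_map F (Suc i) ` free_mod F (Suc (Suc i))" for i
    using res unfolding graded_free_resolution_def by (elim conjE) (erule spec)
  have aug0: "aug_map F f \<in> I \<Longrightarrow> a \<in> standard I \<Longrightarrow> saug F (proj F 0 a f) = 0" for f a
    using monomial_ideal_keys[OF I(2), of "aug_map F f"] lookup_aug_map[OF h, of a f]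
    unfolding standard_def by (auto simp: in_keys_iff)
  have "exact_strands I F"
    unfolding exact_strands_def
  proof (intro allI conjI impI)
    fix a assume a: "a \<in> standard I"
    obtain f where f: "f \<in> free_mod F 0" "aug_map F f - monomial (expo a) \<in> I"
      using surj by blast
    have "expo a \<notin> keys (aug_map F f - monomial (expo a))"
      using f(2) a monomial_ideal_keys[OF I(2)] unfolding standard_def by blast
    then have "lookup (aug_map F f) (expo a) = 1"
      by (simp add: in_keys_iff lookup_minus monomial_def)
    then have "saug F (proj F 0 a f) = 1"
      using lookup_aug_map[OF h, of a f] a by (simp add: standard_def)
    then show "\<exists>w\<in>strand F 0 a. saug F w = 1" using proj_strand by blast
  next
    fix a
    show "{w \<in> strand F 0 a. a \<in> standard I \<longrightarrow> saug F w = 0} = sdiff F 0 ` strand F 1 a"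
    proof (intro set_eqI iffI)
      fix w assume "w \<in> {w \<in> strand F 0 a. a \<in> standard I \<longrightarrow> saug F w = 0}"
      then have w: "w \<in> strand F 0 a" "a \<in> standard I \<longrightarrow> saug F w = 0" by auto
      have "single (expo a) (saug F w) \<in> I"
      proof (cases "saug F w = 0")
        case True
        then show ?thesis using ideal.subspace_0[OF I(1)] by simp
      next
        case False
        then obtain b where b: "b < frank F 0" "w b * scal_aug F b \<noteq> 0"
          unfolding saug_def by (auto elim!: sum.not_neutral_contains_not_neutral)
        then have "0 \<le> fdeg F 0 b" "fdeg F 0 b \<le> a"
          using homog_complex_aug(2)[OF h] w(1) unfolding strand_def by auto
        then have "0 \<le> a" by (rule order_trans)
        with False w(2) have "monomial (expo a) \<in> I" by (auto simp: standard_def)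
        then show ?thesis
          using monomial_ideal_keys[OF I(2), of "single (expo a) (saug F w)"] by auto
      qed
      then have "emb F 0 a w \<in> diff_map F 0 ` free_mod F 1"
        using ex0 emb_free_mod aug_map_emb[OF h w(1)] by (metis (mono_tags, lifting) mem_Collect_eq)
      then obtain g where "emb F 0 a w = diff_map F 0 g" by blast
      then have "w = sdiff F 0 (proj F 1 a g)"
        using proj_emb[OF w(1)] proj_diff_map[OF h, of 0 a g] by simp
      then show "w \<in> sdiff F 0 ` strand F 1 a" using proj_strand by blast
    next
      fix w assume "w \<in> sdiff F 0 ` strand F 1 a"
      then obtain u where u: "u \<in> strand F 1 a" "w = sdiff F 0 u" by blast
      have w: "w \<in> strand F 0 a" using sdiff_strand[OF h, of u 0 a] u by simp
      have "diff_map F 0 (emb F 1 a u) \<in> {f \<in> free_mod F 0. aug_map F f \<in> I}"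
        unfolding ex0 using emb_free_mod by blast
      then have "aug_map F (emb F 0 a w) \<in> I" using diff_map_emb[OF h, of u 0 a] u by simp
      then show "w \<in> {w \<in> strand F 0 a. a \<in> standard I \<longrightarrow> saug F w = 0}"
        using w aug0[of "emb F 0 a w" a] by (simp add: proj_emb)
    qed
  next
    fix a p
    show "{w \<in> strand F (Suc p) a. sdiff F p w = 0} = sdiff F (Suc p) ` strand F (Suc (Suc p)) a"
    proof (intro set_eqI iffI)
      fix w assume "w \<in> {w \<in> strand F (Suc p) a. sdiff F p w = 0}"
      then have w: "w \<in> strand F (Suc p) a" "sdiff F p w = 0" by auto
      then have "diff_map F p (emb F (Suc p) a w) = 0"
        using diff_map_emb[OF h w(1)] by (simp add: emb_zero)
      then obtain g where "emb F (Suc p) a w = diff_map F (Suc p) g"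
        using ex[of p] emb_free_mod[of F "Suc p" a w] by blast
      then have "w = sdiff F (Suc p) (proj F (Suc (Suc p)) a g)"
        using proj_emb[OF w(1)] proj_diff_map[OF h, of "Suc p" a g] by simp
      then show "w \<in> sdiff F (Suc p) ` strand F (Suc (Suc p)) a" using proj_strand by blast
    next
      fix w assume "w \<in> sdiff F (Suc p) ` strand F (Suc (Suc p)) a"
      then obtain u where u: "u \<in> strand F (Suc (Suc p)) a" "w = sdiff F (Suc p) u" by blast
      have w: "w \<in> strand F (Suc p) a" using sdiff_strand[OF h u(1)] u by simp
      have "diff_map F p (diff_map F (Suc p) (emb F (Suc (Suc p)) a u)) = 0"
        using ex[of p] emb_free_mod[of F "Suc (Suc p)" a u] by blast
      then have "emb F p a (sdiff F p w) = 0"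
        using diff_map_emb[OF h u(1)] diff_map_emb[OF h w] u(2) by simp
      then have "sdiff F p w = 0"
        using proj_emb[OF sdiff_strand[OF h w]] by (metis proj_zero)
      then show "w \<in> {w \<in> strand F (Suc p) a. sdiff F p w = 0}" using w by simp
    qed
  qed
  with h show "homog_complex F \<and> exact_strands I F" by simp
next
  assume "homog_complex F \<and> exact_strands I F"
  then have h: "homog_complex F" and e: "exact_strands I F" by auto
  have surj: "a \<in> standard I \<Longrightarrow> \<exists>w\<in>strand F 0 a. saug F w = 1" for a
    using e unfolding exact_strands_def by blast
  have ex0: "{w \<in> strand F 0 a. a \<in> standard I \<longrightarrow> saug F w = 0} = sdiff F 0 ` strand F 1 a" for a
    using e unfolding exact_strands_def by blast
  have ex: "{w \<in> strand F (Suc p) a. sdiff F p w = 0} = sdiff F (Suc p) ` strand F (Suc (Suc p)) a" for p a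
    using e unfolding exact_strands_def by blast
  have mono_surj: "\<exists>f\<in>free_mod F 0. aug_map F f - single m s \<in> I" for m and s :: 'k
  proof (cases "monomial m \<in> I")
    case True
    then have "single m s \<in> I"
      using ideal.subspace_scale[OF I(1) True, of "single 0 s"] by (simp add: monomial_mult)
    then have "aug_map F 0 - single m s \<in> I"
      using ideal.subspace_neg[OF I(1)] by (simp add: aug_map_zero)
    moreover have "0 \<in> free_mod F 0" by (simp add: free_mod_def)
    ultimately show ?thesis by blast
  next
    case False
    then have "mdeg m \<in> standard I" by (simp add: standard_def)
    then obtain w where w: "w \<in> strand F 0 (mdeg m)" "saug F w = 1" using surj by blast
    then have w': "(\<lambda>b. s * w b) \<in> strand F 0 (mdeg m)" by (auto simp: strand_def)
    have "saug F (\<lambda>b. s * w b) = s * saug F w"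
      by (simp add: saug_def sum_distrib_left mult.assoc)
    then have "aug_map F (emb F 0 (mdeg m) (\<lambda>b. s * w b)) - single m s \<in> I"
      using aug_map_emb[OF h w'] w(2) ideal.subspace_0[OF I(1)] by simp
    then show ?thesis using emb_free_mod by blast
  qed
  have "\<exists>f\<in>free_mod F 0. aug_map F f - g \<in> I" for g
  proof -
    have "\<forall>m. \<exists>f. f \<in> free_mod F 0 \<and> aug_map F f - single m (lookup g m) \<in> I"
      using mono_surj by blast
    from choice[OF this] obtain f where f: "\<And>m. f m \<in> free_mod F 0"
      "\<And>m. aug_map F (f m) - single m (lookup g m) \<in> I"
      by blast
    have "aug_map F (\<Sum>m\<in>keys g. f m) - g =
        (\<Sum>m\<in>keys g. aug_map F (f m) - single m (lookup g m))"
      by (simp add: aug_map_sum sum_subtractf sum_single_keys)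
    also have "\<dots> \<in> I" by (rule ideal.subspace_sum[OF I(1)]) (rule f(2))
    finally show ?thesis using free_mod_sum[of "keys g" f] f(1) by blast
  qed
  moreover have "{f \<in> free_mod F 0. aug_map F f \<in> I} = diff_map F 0 ` free_mod F 1"
  proof (intro set_eqI iffI)
    fix f assume "f \<in> {f \<in> free_mod F 0. aug_map F f \<in> I}"
    then have f: "f \<in> free_mod F 0" "aug_map F f \<in> I" by auto
    have "a \<in> standard I \<Longrightarrow> saug F (proj F 0 a f) = 0" for a
      using monomial_ideal_keys[OF I(2), of "aug_map F f"] lookup_aug_map[OF h, of a f] f(2)
      unfolding standard_def by (auto simp: in_keys_iff)
    then have "proj F 0 a f \<in> sdiff F 0 ` strand F 1 a" for a
      unfolding ex0[symmetric] by (simp add: proj_strand)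
    then have "\<exists>u\<in>strand F (Suc 0) a. sdiff F 0 u = proj F 0 a f" for a
      unfolding image_iff One_nat_def by metis
    from image_of_strandwise_image[OF h f(1) this] show "f \<in> diff_map F 0 ` free_mod F 1" by simp
  next
    fix f assume "f \<in> diff_map F 0 ` free_mod F 1"
    then obtain g where g: "g \<in> free_mod F 1" "f = diff_map F 0 g" by blast
    have "lookup (aug_map F f) m = 0" if "monomial m \<notin> I" for m
    proof -
      have "saug F (sdiff F 0 (proj F 1 (mdeg m) g)) = 0"
        using ex0[of "mdeg m"] proj_strand[of F 1 "mdeg m" g] that by (auto simp: standard_def)
      then show ?thesis
        using lookup_aug_map[OF h, of "mdeg m" f] proj_diff_map[OF h, of 0 "mdeg m" g] g(2) by simp
    qed
    then have "aug_map F f \<in> I" using monomial_ideal_keys[OF I(2)] by (metis in_keys_iff)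
    moreover have "f \<in> free_mod F 0" using g(2) by (simp add: free_mod_def diff_map_def)
    ultimately show "f \<in> {f \<in> free_mod F 0. aug_map F f \<in> I}" by simp
  qed
  moreover have "{f \<in> free_mod F (Suc i). diff_map F i f = 0} = diff_map F (Suc i) ` free_mod F (Suc (Suc i))" for i
  proof (intro set_eqI iffI)
    fix f assume "f \<in> {f \<in> free_mod F (Suc i). diff_map F i f = 0}"
    then have f: "f \<in> free_mod F (Suc i)" "diff_map F i f = 0" by auto
    have "sdiff F i (proj F (Suc i) a f) = 0" for a
      using proj_diff_map[OF h, of i a f] f(2) by (simp add: proj_zero)
    then have "proj F (Suc i) a f \<in> sdiff F (Suc i) ` strand F (Suc (Suc i)) a" for a
      unfolding ex[symmetric] by (simp add: proj_strand)
    then have "\<exists>u\<in>strand F (Suc (Suc i)) a. sdiff F (Suc i) u = proj F (Suc i) a f" for a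
      unfolding image_iff by metis
    from image_of_strandwise_image[OF h f(1) this]
    show "f \<in> diff_map F (Suc i) ` free_mod F (Suc (Suc i))" .
  next
    fix f assume "f \<in> diff_map F (Suc i) ` free_mod F (Suc (Suc i))"
    then obtain g where g: "f = diff_map F (Suc i) g" "g \<in> free_mod F (Suc (Suc i))" by blast
    obtain A where A: "g = (\<Sum>a\<in>A. emb F (Suc (Suc i)) a (proj F (Suc (Suc i)) a g))"
      using emb_decomposition[OF g(2)] by blast
    have "diff_map F i (diff_map F (Suc i) (emb F (Suc (Suc i)) a w)) = 0"
      if w: "w \<in> strand F (Suc (Suc i)) a" for a w
    proof -
      have "sdiff F i (sdiff F (Suc i) w) = 0" using ex[of i a] w by blast
      then show ?thesis
        using diff_map_emb[OF h w] diff_map_emb[OF h sdiff_strand[OF h w]] by (simp add: emb_zero)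
    qed
    then have "diff_map F i (diff_map F (Suc i) g) = 0"
      by (subst A) (auto simp only: diff_map_sum intro!: sum.neutral proj_strand)
    moreover have "f \<in> free_mod F (Suc i)" using g(1) by (simp add: free_mod_def diff_map_def)
    ultimately show "f \<in> {f \<in> free_mod F (Suc i). diff_map F i f = 0}" using g by simp
  qed
  ultimately show "graded_free_resolution I F"
    using h unfolding graded_free_resolution_def homog_complex_def
    by (elim conjE) (intro conjI allI, simp_all)
qed

section \<open>Finite generation of monomial ideals\<close>

text \<open>
  Jump from each index to a later one at which the minimum over the remaining tail is attained.
\<close>

lemma monotone_subsequence_nat:
  fixes f :: "nat \<Rightarrow> nat"
  shows "\<exists>r::nat \<Rightarrow> nat. strict_mono r \<and> mono (\<lambda>n. f (r n))"
proof -
  let ?P = "\<lambda>x. \<forall>m\<ge>x. f x \<le> f m"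
  have tail_min: "\<exists>x\<ge>N. ?P x" for N
  proof -
    define y where "y = (LEAST y. y \<in> f ` {N..})"
    have y: "y \<in> f ` {N..}" "z \<in> f ` {N..} \<Longrightarrow> y \<le> z" for z
      unfolding y_def by (rule LeastI[of _ "f N"], simp) (rule Least_le)
    then obtain x where "x \<ge> N" "f x = y" by auto
    then show ?thesis using y(2) by (intro exI[of _ x]) auto
  qed
  have "\<exists>r. \<forall>n. ?P (r n) \<and> r n < r (Suc n)"
  proof (rule dependent_nat_choice)
    show "\<exists>x. ?P x" using tail_min by blast
    show "\<exists>y. ?P y \<and> x < y" for x :: nat using tail_min[of "Suc x"] by auto
  qed
  then obtain r where r: "\<And>n. ?P (r n)" "\<And>n. r n < r (Suc n)" by blast
  then have "strict_mono r" by (simp add: strict_mono_Suc_iff)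
  moreover have "mono (\<lambda>n. f (r n))" using r(1) r(2) by (simp add: mono_iff_le_Suc less_imp_le)
  ultimately show ?thesis by blast
qed

lemma monotone_subsequence_vector:
  fixes f :: "nat \<Rightarrow> 'n \<Rightarrow> nat"
  assumes "finite A"
  shows "\<exists>r::nat \<Rightarrow> nat. strict_mono r \<and> (\<forall>j\<in>A. mono (\<lambda>n. f (r n) j))"
  using assms
proof (induction A)
  case empty
  show ?case by (auto intro: exI[of _ id] simp: strict_mono_def)
next
  case (insert i A)
  then obtain r :: "nat \<Rightarrow> nat" where r: "strict_mono r" "\<And>j. j \<in> A \<Longrightarrow> mono (\<lambda>n. f (r n) j)" by blast
  obtain s :: "nat \<Rightarrow> nat" where s: "strict_mono s" "mono (\<lambda>n. f (r (s n)) i)"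
    using monotone_subsequence_nat[of "\<lambda>n. f (r n) i"] by blast
  have "mono (\<lambda>n. f (r (s n)) j)" if "j \<in> A" for j
    using r(2)[OF that] strict_mono_mono[OF s(1)] by (auto simp: mono_def)
  then show ?case using r(1) s
    by (intro exI[of _ "\<lambda>n. r (s n)"]) (auto simp: strict_mono_def)
qed

text \<open>
  The minimal elements do it. An infinite set of them would contain a sequence that is monotone in
  every coordinate, hence two distinct comparable minimal elements.
\<close>

lemma Dickson:
  fixes M :: "('n::finite \<Rightarrow> nat) set"
  shows "\<exists>G. finite G \<and> G \<subseteq> M \<and> (\<forall>m\<in>M. \<exists>g\<in>G. g \<le> m)"
proof (intro exI conjI)
  let ?G = "{g \<in> M. \<forall>h\<in>M. h \<le> g \<longrightarrow> h = g}"
  show "?G \<subseteq> M" by blast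
  show "\<forall>m\<in>M. \<exists>g\<in>?G. g \<le> m"
  proof
    fix m assume "m \<in> M"
    then show "\<exists>g\<in>?G. g \<le> m"
    proof (induction "\<Sum>j\<in>UNIV. m j" arbitrary: m rule: less_induct)
      case less
      show ?case
      proof (cases "m \<in> ?G")
        case False
        then obtain h where h: "h \<in> M" "h \<le> m" "h \<noteq> m" using less.prems by blast
        then obtain i where "h i < m i" by (metis le_fun_def nat_less_le ext)
        then have "sum h UNIV < sum m UNIV"
          using h(2) by (intro sum_strict_mono_ex1) (auto simp: le_fun_def)
        then show ?thesis using less.hyps[OF _ h(1)] h(2) by (meson order_trans)
      qed auto
    qed
  qed
  show "finite ?G"
  proof (rule ccontr)
    assume "infinite ?G"
    then obtain f :: "nat \<Rightarrow> 'n \<Rightarrow> nat" where f: "inj f" "range f \<subseteq> ?G"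
      using infinite_countable_subset by blast
    obtain r :: "nat \<Rightarrow> nat" where r: "strict_mono r" "\<And>j. mono (\<lambda>n. f (r n) j)"
      using monotone_subsequence_vector[of UNIV f] by auto
    have "f (r 0) \<le> f (r 1)" using r(2) by (auto simp: le_fun_def mono_def)
    then have "f (r 0) = f (r 1)" using f(2) by blast
    then have "r 0 = r 1" using f(1) by (meson injD)
    then show False using r(1) by (metis strict_mono_eq zero_neq_one)
  qed
qed

text \<open>
  Dickson's lemma, applied to the exponent vectors of the monomials in \<open>I\<close>.
\<close>

lemma standard_finitely_determined:
  fixes I :: "('n::finite, 'k::field) mpoly set"
  assumes "ideal I"
  shows "\<exists>r g. (\<forall>k<r. 0 \<le> g k) \<and> (\<forall>a. a \<in> standard I \<longleftrightarrow> 0 \<le> a \<and> (\<forall>k<(r::nat). \<not> g k \<le> a))"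
proof -
  let ?M = "{m :: 'n \<Rightarrow> nat. monomial (Abs_poly_mapping m) \<in> I}"
  obtain G where G: "finite G" "G \<subseteq> ?M" "\<And>m. m \<in> ?M \<Longrightarrow> \<exists>g\<in>G. g \<le> m"
    using Dickson[of ?M] by blast
  obtain r :: nat and h where h: "G = h ` {i. i < r}" using finite_imp_nat_seg_image_inj_on[OF G(1)] by blast
  let ?g = "\<lambda>k j. int (h k j)"
  have "0 \<le> ?g k" for k by (simp add: le_fun_def)
  moreover have "a \<in> standard I \<longleftrightarrow> (\<forall>k<r. \<not> ?g k \<le> a)" if a: "0 \<le> a" for a
  proof
    assume st: "a \<in> standard I"
    show "\<forall>k<r. \<not> ?g k \<le> a"
    proof (intro allI impI notI)
      fix k assume k: "k < r" "?g k \<le> a"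
      have "?g k \<in> standard I" using standard_mono[OF assms st _ k(2)] by (simp add: le_fun_def)
      moreover have "monomial (expo (?g k)) \<in> I" using G(2) h k(1) by (auto simp: expo_def)
      ultimately show False by (simp add: standard_def)
    qed
  next
    assume *: "\<forall>k<r. \<not> ?g k \<le> a"
    show "a \<in> standard I"
    proof (rule ccontr)
      assume "a \<notin> standard I"
      then have "(\<lambda>j. nat (a j)) \<in> ?M" using a by (simp add: standard_def expo_def)
      then obtain k where "k < r" "h k \<le> (\<lambda>j. nat (a j))" using G(3) h by blast
      then have "?g k \<le> a" using a unfolding le_fun_def zero_fun_apply by (metis int_nat_eq of_nat_mono)
      with * \<open>k < r\<close> show False by blast
    qed
  qed
  moreover have "0 \<le> a" if "a \<in> standard I" for a using that by (simp add: standard_def)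
  ultimately show ?thesis by (intro exI[of _ r] exI[of _ ?g]) metis
qed

section \<open>The Taylor complex\<close>

text \<open>
  The exponent vector of the least common multiple of the generators indexed by \<open>S\<close>. The inserted
  \<open>0\<close> makes the empty least common multiple the monomial \<open>1\<close>.
\<close>

definition lcm_deg :: "(nat \<Rightarrow> 'n \<Rightarrow> int) \<Rightarrow> nat set \<Rightarrow> 'n \<Rightarrow> int"
  where "lcm_deg g S j = Max (insert 0 ((\<lambda>k. g k j) ` S))"

definition subsets_of_card :: "nat \<Rightarrow> nat \<Rightarrow> nat set set"
  where "subsets_of_card r p = {S. S \<subseteq> {..<r} \<and> card S = p}"

text \<open>
  Free modules have their bases numbered by natural numbers, those of the Taylor complex are indexed
  by sets of generators; an arbitrary numbering of the \<open>p\<close>-element sets translates.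
\<close>

definition enum_subset :: "nat \<Rightarrow> nat \<Rightarrow> nat \<Rightarrow> nat set"
  where "enum_subset r p = (SOME h. bij_betw h {..<r choose p} (subsets_of_card r p))"

text \<open>
  Meant for \<open>T\<close> with one element less than \<open>S\<close>; then \<open>the_elem\<close> picks the removed element.
\<close>

definition incidence :: "nat set \<Rightarrow> nat set \<Rightarrow> 'k::comm_ring_1"
  where "incidence S T = (if T \<subseteq> S then sg (the_elem (S - T)) T else 0)"

text \<open>
  The Taylor complex of the monomials with exponent vectors \<open>g 0, \<dots>, g (r - 1)\<close>: the simplicial
  chain complex of the full simplex on the generators, homogenized by least common multiples. It is
  in general not minimal, but it always resolves the quotient by the ideal of these monomials.
\<close>

definition taylor :: "nat \<Rightarrow> (nat \<Rightarrow> 'n::finite \<Rightarrow> int) \<Rightarrow> ('n, 'k::field) free_complex"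
  where "taylor r g = \<lparr>
    frank = \<lambda>p. r choose p,
    fdeg = \<lambda>p b. lcm_deg g (enum_subset r p b),
    fdiff = \<lambda>p b c. single
      (expo (lcm_deg g (enum_subset r (Suc p) b) - lcm_deg g (enum_subset r p c)))
      (incidence (enum_subset r (Suc p) b) (enum_subset r p c)),
    faug = \<lambda>_. 1\<rparr>"

lemma taylor_simps [simp]:
  "frank (taylor r g) p = r choose p"
  "fdeg (taylor r g) p b = lcm_deg g (enum_subset r p b)"
  "scal (taylor r g) p b c = incidence (enum_subset r (Suc p) b) (enum_subset r p c)"
  "faug (taylor r g) b = 1"
  by (simp_all add: taylor_def scal_def)

lemma enum_subset: "bij_betw (enum_subset r p) {..<r choose p} (subsets_of_card r p)"
proof -
  have "card (subsets_of_card r p) = r choose p"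
    unfolding subsets_of_card_def using n_subsets[of "{..<r}" p] by simp
  moreover have "finite (subsets_of_card r p)"
    unfolding subsets_of_card_def by (rule finite_subset[of _ "Pow {..<r}"]) auto
  ultimately have "\<exists>h. bij_betw h {..<r choose p} (subsets_of_card r p)"
    using ex_bij_betw_nat_finite[of "subsets_of_card r p"] by (simp add: lessThan_atLeast0)
  then show ?thesis unfolding enum_subset_def by (rule someI_ex)
qed

lemma enum_subset_props:
  assumes "b < r choose p"
  shows "enum_subset r p b \<subseteq> {..<r}" "card (enum_subset r p b) = p" "finite (enum_subset r p b)"
proof -
  have "enum_subset r p b \<in> subsets_of_card r p"
    using enum_subset[of r p] assms unfolding bij_betw_def by auto
  then show *: "enum_subset r p b \<subseteq> {..<r}" "card (enum_subset r p b) = p"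
    by (auto simp: subsets_of_card_def)
  then show "finite (enum_subset r p b)" using finite_subset by blast
qed

lemma enum_subset_surj:
  assumes "S \<subseteq> {..<r}" "card S = p"
  shows "\<exists>b<r choose p. enum_subset r p b = S"
proof -
  have "S \<in> enum_subset r p ` {..<r choose p}"
    using enum_subset[of r p] assms unfolding bij_betw_def subsets_of_card_def by auto
  then show ?thesis by auto
qed

lemma enum_subset_0: "enum_subset r 0 0 = {}"
  using enum_subset_props[of 0 r 0] by simp

lemma lcm_deg_le_iff:
  assumes "finite S"
  shows "lcm_deg g S \<le> a \<longleftrightarrow> 0 \<le> a \<and> (\<forall>k\<in>S. g k \<le> a)"
  using assms by (auto simp: lcm_deg_def le_fun_def)

lemma homog_complex_taylor: "homog_complex (taylor r g :: ('n::finite, 'k::field) free_complex)"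
  unfolding homog_complex_def
proof (intro conjI allI impI)
  fix b assume "b < frank (taylor r g :: ('n, 'k) free_complex) 0"
  then have "b = 0" by simp
  then show "homogeneous (fdeg (taylor r g :: ('n, 'k) free_complex) 0 b) (faug (taylor r g :: ('n, 'k) free_complex) b)"
    by (simp add: homogeneous_def enum_subset_0 lcm_deg_def)
next
  fix p b c
  assume b: "b < frank (taylor r g :: ('n, 'k) free_complex) (Suc p)"
    and c: "c < frank (taylor r g :: ('n, 'k) free_complex) p"
  show "homogeneous (\<lambda>j. fdeg (taylor r g :: ('n, 'k) free_complex) (Suc p) b j - fdeg (taylor r g :: ('n, 'k) free_complex) p c j)
     (fdiff (taylor r g :: ('n, 'k) free_complex) p b c)"
  proof (cases "enum_subset r p c \<subseteq> enum_subset r (Suc p) b")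
    case True
    have "lcm_deg g (enum_subset r p c) \<le> lcm_deg g (enum_subset r (Suc p) b)"
      using True b c lcm_deg_le_iff[OF enum_subset_props(3), of b r "Suc p" g "lcm_deg g (enum_subset r (Suc p) b)"]
        lcm_deg_le_iff[OF enum_subset_props(3), of c r p g "lcm_deg g (enum_subset r (Suc p) b)"]
      by auto
    then show ?thesis by (simp add: taylor_def homogeneous_def le_fun_def)
  next
    case False
    then show ?thesis by (simp add: taylor_def homogeneous_def incidence_def)
  qed
qed

text \<open>
  Up to the numbering of subsets, the scalar differential is the simplicial boundary map.
\<close>

lemma sdiff_taylor:
  fixes u :: "nat \<Rightarrow> 'k::field"
  assumes c: "c < r choose p" and uz: "\<And>b. b < r choose Suc p \<Longrightarrow> u b = z (enum_subset r (Suc p) b)"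
  shows "sdiff (taylor r g :: ('n::finite, 'k) free_complex) p u c = drop_sum {..<r} z (enum_subset r p c)"
proof -
  let ?T = "enum_subset r p c" and ?C = "subsets_of_card r (Suc p)"
  have T: "?T \<subseteq> {..<r}" "card ?T = p" "finite ?T" using enum_subset_props[OF c] by auto
  have "sdiff (taylor r g :: ('n, 'k) free_complex) p u c =
      (\<Sum>b<r choose Suc p. z (enum_subset r (Suc p) b) * incidence (enum_subset r (Suc p) b) ?T)"
    using c uz by (simp add: sdiff_def)
  also have "\<dots> = (\<Sum>S\<in>?C. z S * incidence S ?T)"
    by (rule sum.reindex_bij_betw[OF enum_subset])
  also have "\<dots> = (\<Sum>S\<in>(\<lambda>j. insert j ?T) ` ({..<r} - ?T). z S * incidence S ?T)"
  proof (rule sum.mono_neutral_right)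
    show "finite ?C" unfolding subsets_of_card_def by (rule finite_subset[of _ "Pow {..<r}"]) auto
    show "(\<lambda>j. insert j ?T) ` ({..<r} - ?T) \<subseteq> ?C" using T by (auto simp: subsets_of_card_def)
    show "\<forall>S\<in>?C - (\<lambda>j. insert j ?T) ` ({..<r} - ?T). z S * incidence S ?T = 0"
    proof
      fix S assume S: "S \<in> ?C - (\<lambda>j. insert j ?T) ` ({..<r} - ?T)"
      have "\<not> ?T \<subseteq> S"
      proof
        assume sub: "?T \<subseteq> S"
        have "finite S" using S unfolding subsets_of_card_def by (auto intro: finite_subset)
        then have "card (S - ?T) = 1" using S T sub by (simp add: card_Diff_subset subsets_of_card_def)
        then obtain j where "S - ?T = {j}" by (metis card_1_singletonE)
        then have "S = insert j ?T" "j \<in> {..<r} - ?T" using sub S by (auto simp: subsets_of_card_def)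
        then show False using S by blast
      qed
      then show "z S * incidence S ?T = 0" by (simp add: incidence_def)
    qed
  qed
  also have "\<dots> = (\<Sum>j\<in>{..<r} - ?T. z (insert j ?T) * incidence (insert j ?T) ?T)"
    by (rule sum.reindex_cong[OF _ refl refl]) (auto simp: inj_on_def)
  also have "\<dots> = drop_sum {..<r} z ?T"
    unfolding drop_sum_def
  proof (intro sum.cong refl)
    fix j assume "j \<in> {..<r} - ?T"
    then have "insert j ?T - ?T = {j}" by auto
    then show "z (insert j ?T) * incidence (insert j ?T) ?T = sg j ?T * z (insert j ?T)"
      by (simp add: incidence_def subset_insertI mult.commute)
  qed
  finally show ?thesis .
qed

lemma enum_lift:
  fixes u :: "nat \<Rightarrow> 'k::zero"
  obtains z where "\<And>b. b < r choose p \<Longrightarrow> u b = z (enum_subset r p b)"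
    and "\<And>S. S \<subseteq> {..<r} \<Longrightarrow> z S \<noteq> 0 \<Longrightarrow> card S = p"
proof
  let ?z = "\<lambda>S. if card S = p then u (the_inv_into {..<r choose p} (enum_subset r p) S) else 0"
  show "u b = ?z (enum_subset r p b)" if "b < r choose p" for b
    using that enum_subset_props(2)[OF that] the_inv_into_f_f[OF bij_betw_imp_inj_on[OF enum_subset[of r p]], of b] by simp
  show "card S = p" if "?z S \<noteq> 0" for S using that by (auto split: if_splits)
qed

lemma taylor_strand_iff:
  "w \<in> strand (taylor r g :: ('n::finite, 'k::field) free_complex) p a \<longleftrightarrow>
    (\<forall>b. w b \<noteq> 0 \<longrightarrow> b < r choose p \<and> 0 \<le> a \<and> (\<forall>k\<in>enum_subset r p b. g k \<le> a))"
proof -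
  have "b < r choose p \<and> lcm_deg g (enum_subset r p b) \<le> a \<longleftrightarrow>
      b < r choose p \<and> 0 \<le> a \<and> (\<forall>k\<in>enum_subset r p b. g k \<le> a)" for b
    using lcm_deg_le_iff[OF enum_subset_props(3)] by metis
  then show ?thesis by (simp only: strand_def taylor_simps mem_Collect_eq)
qed

lemma taylor_complex:
  assumes "c < r choose p"
  shows "sdiff (taylor r g :: ('n::finite, 'k::field) free_complex) p (sdiff (taylor r g :: ('n, 'k) free_complex) (Suc p) u) c = 0"
proof -
  obtain z where z: "\<And>b. b < r choose Suc (Suc p) \<Longrightarrow> u b = z (enum_subset r (Suc (Suc p)) b)"
    using enum_lift by metis
  have "sdiff (taylor r g :: ('n, 'k) free_complex) (Suc p) u b = drop_sum {..<r} z (enum_subset r (Suc p) b)"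
    if "b < r choose Suc p" for b
    using sdiff_taylor[where z = z] that z by blast
  then have "sdiff (taylor r g :: ('n, 'k) free_complex) p (sdiff (taylor r g :: ('n, 'k) free_complex) (Suc p) u) c =
      drop_sum {..<r} (drop_sum {..<r} z) (enum_subset r p c)"
    using sdiff_taylor[OF assms] by blast
  then show ?thesis using drop_sum_drop_sum[OF _ enum_subset_props(1)[OF assms]] by simp
qed

text \<open>
  In degree \<open>a\<close> only the generators dividing \<open>x^a\<close> contribute, and they span a full simplex. If
  there is one, \<open>v\<close>, the strand is a cone with apex \<open>v\<close>.
\<close>

lemma taylor_contraction:
  fixes w :: "nat \<Rightarrow> 'k::field"
  assumes v: "v < r" "g v \<le> a" and w: "w \<in> strand (taylor r g :: ('n::finite, 'k) free_complex) p a"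
    and cyc: "\<And>q. p = Suc q \<Longrightarrow> sdiff (taylor r g :: ('n, 'k) free_complex) q w = 0"
  shows "\<exists>u\<in>strand (taylor r g :: ('n, 'k) free_complex) (Suc p) a. sdiff (taylor r g :: ('n, 'k) free_complex) p u = w"
proof -
  obtain z where z: "\<And>b. b < r choose p \<Longrightarrow> w b = z (enum_subset r p b)"
    and zcard: "\<And>S. S \<subseteq> {..<r} \<Longrightarrow> z S \<noteq> 0 \<Longrightarrow> card S = p"
    using enum_lift[of r p w] by metis
  define u where "u b = (if b < r choose Suc p then cone_map v z (enum_subset r (Suc p) b) else 0)" for b
  have us: "u \<in> strand (taylor r g :: ('n, 'k) free_complex) (Suc p) a"
    unfolding taylor_strand_iff
  proof (intro allI impI)
    fix b assume "u b \<noteq> 0"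
    then have b: "b < r choose Suc p" "v \<in> enum_subset r (Suc p) b" "z (enum_subset r (Suc p) b - {v}) \<noteq> 0"
      by (auto simp: u_def cone_map_def split: if_splits)
    have "enum_subset r (Suc p) b - {v} \<subseteq> {..<r}" using enum_subset_props(1)[OF b(1)] by auto
    moreover have "card (enum_subset r (Suc p) b - {v}) = p" using enum_subset_props[OF b(1)] b(2) by simp
    ultimately obtain b' where b': "b' < r choose p" "enum_subset r p b' = enum_subset r (Suc p) b - {v}"
      using enum_subset_surj by blast
    then have "w b' \<noteq> 0" using z b(3) by simp
    then have "0 \<le> a" "\<forall>k\<in>enum_subset r p b'. g k \<le> a" using w unfolding taylor_strand_iff by blast+
    then show "b < r choose Suc p \<and> 0 \<le> a \<and> (\<forall>k\<in>enum_subset r (Suc p) b. g k \<le> a)"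
      using b b' v(2) by auto
  qed
  have "sdiff (taylor r g :: ('n, 'k) free_complex) p u c = w c" for c
  proof (cases "c < r choose p")
    case True
    let ?T = "enum_subset r p c"
    have "cone_map v (drop_sum {..<r} z) ?T = 0"
    proof (cases "v \<in> ?T")
      case vT: True
      then have "p > 0" using enum_subset_props(2,3)[OF True] by (metis card_gt_0_iff empty_iff)
      then obtain q where q: "p = Suc q" by (metis gr0_implies_Suc)
      have "?T - {v} \<subseteq> {..<r}" using enum_subset_props(1)[OF True] by auto
      moreover have "card (?T - {v}) = q" using enum_subset_props[OF True] vT q by simp
      ultimately obtain c' where c': "c' < r choose q" "enum_subset r q c' = ?T - {v}"
        using enum_subset_surj by blast
      have "drop_sum {..<r} z (enum_subset r q c') = sdiff (taylor r g :: ('n, 'k) free_complex) q w c'"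
        using sdiff_taylor[OF c'(1), where u = w and z = z and g = g] z q by simp
      then show ?thesis using cyc[OF q] c'(2) by (simp add: cone_map_def)
    qed (simp add: cone_map_def)
    then have "drop_sum {..<r} (cone_map v z) ?T = z ?T"
      using cone_homotopy[of "{..<r}" ?T v z] enum_subset_props(1)[OF True] v(1) by simp
    moreover have "sdiff (taylor r g :: ('n, 'k) free_complex) p u c = drop_sum {..<r} (cone_map v z) ?T"
      by (rule sdiff_taylor[OF True]) (simp add: u_def)
    ultimately show ?thesis using z[OF True] by simp
  next
    case False
    then show ?thesis using w by (auto simp: sdiff_def strand_def)
  qed
  then show ?thesis using us by blast
qed

text \<open>
  A degree with a negative entry has a zero strand, a standard degree sees only the empty set of
  generators, and every other degree is covered by the contraction.
\<close>

lemma exact_strands_taylor: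
  fixes I :: "('n::finite, 'k::field) mpoly set"
  assumes std: "\<And>a. a \<in> standard I \<longleftrightarrow> 0 \<le> a \<and> (\<forall>k<r. \<not> g k \<le> a)"
  shows "exact_strands I (taylor r g)"
proof -
  let ?F = "taylor r g :: ('n, 'k) free_complex"
  have saug: "saug ?F w = w 0" for w :: "nat \<Rightarrow> 'k"
    by (simp add: saug_def scal_aug_def enum_subset_0 lcm_deg_def expo_def lookup_one)
  have triv: "strand ?F p a = {0}" if "\<not> 0 \<le> a \<or> (a \<in> standard I \<and> p > 0)" for p a
  proof -
    have "w = 0" if w: "w \<in> strand ?F p a" for w
    proof
      fix b
      show "w b = 0 b"
      proof (rule ccontr)
        assume "w b \<noteq> 0 b"
        then have b: "b < r choose p" "0 \<le> a" "\<forall>k\<in>enum_subset r p b. g k \<le> a"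
          using w unfolding taylor_strand_iff by auto
        then have *: "a \<in> standard I" "p > 0" using \<open>\<not> 0 \<le> a \<or> (a \<in> standard I \<and> p > 0)\<close> by auto
        then obtain k where "k \<in> enum_subset r p b" using enum_subset_props(2)[OF b(1)] by fastforce
        then have "k < r" "g k \<le> a" using b enum_subset_props(1)[OF b(1)] by auto
        then show False using * std by blast
      qed
    qed
    then show ?thesis by (auto simp: strand_def)
  qed
  have sd0: "sdiff ?F p 0 = 0" for p by (auto simp: sdiff_def fun_eq_iff)
  have contract: "\<exists>u\<in>strand ?F (Suc p) a. sdiff ?F p u = w"
    if w: "w \<in> strand ?F p a" and cyc: "\<And>q. p = Suc q \<Longrightarrow> sdiff ?F q w = 0"
      and aug: "p = 0 \<Longrightarrow> a \<in> standard I \<Longrightarrow> saug ?F w = 0" for w p a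
  proof (cases "0 \<le> a \<and> a \<notin> standard I")
    case True
    then obtain v where "v < r" "g v \<le> a" using std by blast
    then show ?thesis using taylor_contraction[OF _ _ w cyc] by blast
  next
    case False
    have "w = 0"
    proof (cases "0 \<le> a \<and> p = 0")
      case True
      then have "w 0 = 0" using aug False saug by auto
      moreover have "b = 0" if "w b \<noteq> 0" for b using w that True by (auto simp: strand_def)
      ultimately have "w b = 0" for b by metis
      then show ?thesis by auto
    next
      case False': False
      then show ?thesis using triv[of a p] w False by auto
    qed
    moreover have "0 \<in> strand ?F (Suc p) a" by (simp add: strand_def)
    ultimately show ?thesis using sd0[of p] by blast
  qed
  show ?thesis
    unfolding exact_strands_def
  proof (intro allI conjI impI)
    fix a assume a: "a \<in> standard I"
    then have "(\<lambda>b. if b = 0 then 1 else 0) \<in> strand ?F 0 a"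
      using std by (auto simp: taylor_strand_iff enum_subset_0)
    moreover have "saug ?F (\<lambda>b. if b = 0 then 1 else 0) = 1" by (simp add: saug)
    ultimately show "\<exists>w\<in>strand ?F 0 a. saug ?F w = 1" by blast
  next
    fix a
    show "{w \<in> strand ?F 0 a. a \<in> standard I \<longrightarrow> saug ?F w = 0} = sdiff ?F 0 ` strand ?F 1 a"
    proof (intro set_eqI iffI)
      fix w assume "w \<in> {w \<in> strand ?F 0 a. a \<in> standard I \<longrightarrow> saug ?F w = 0}"
      then have "\<exists>u\<in>strand ?F (Suc 0) a. sdiff ?F 0 u = w" using contract[of w 0 a] by simp
      then show "w \<in> sdiff ?F 0 ` strand ?F 1 a" by auto
    next
      fix w assume "w \<in> sdiff ?F 0 ` strand ?F 1 a"
      then obtain u where u: "u \<in> strand ?F (Suc 0) a" "w = sdiff ?F 0 u" by auto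
      have "w = 0" if "a \<in> standard I" using triv[of a 1] that u sd0[of 0] by auto
      then show "w \<in> {w \<in> strand ?F 0 a. a \<in> standard I \<longrightarrow> saug ?F w = 0}"
        using sdiff_strand[OF homog_complex_taylor u(1)] u(2) saug by auto
    qed
  next
    fix a p
    show "{w \<in> strand ?F (Suc p) a. sdiff ?F p w = 0} = sdiff ?F (Suc p) ` strand ?F (Suc (Suc p)) a"
    proof (intro set_eqI iffI)
      fix w assume "w \<in> {w \<in> strand ?F (Suc p) a. sdiff ?F p w = 0}"
      then have "\<exists>u\<in>strand ?F (Suc (Suc p)) a. sdiff ?F (Suc p) u = w" using contract[of w "Suc p" a] by simp
      then show "w \<in> sdiff ?F (Suc p) ` strand ?F (Suc (Suc p)) a" by auto
    next
      fix w assume "w \<in> sdiff ?F (Suc p) ` strand ?F (Suc (Suc p)) a"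
      then obtain u where u: "u \<in> strand ?F (Suc (Suc p)) a" "w = sdiff ?F (Suc p) u" by auto
      have "sdiff ?F p w c = 0" for c
        using taylor_complex[of c r p g u] u(2) by (cases "c < r choose p") (auto simp: sdiff_def[of ?F p])
      then have "sdiff ?F p w = 0" by auto
      then show "w \<in> {w \<in> strand ?F (Suc p) a. sdiff ?F p w = 0}"
        using sdiff_strand[OF homog_complex_taylor u(1)] u(2) by auto
    qed
  qed
qed

theorem graded_free_resolution_exists:
  fixes I :: "('n::finite, 'k::field) mpoly set"
  assumes "ideal I" "monomial_ideal I"
  shows "\<exists>F. graded_free_resolution I F"
  using standard_finitely_determined[OF assms(1)] exact_strands_taylor homog_complex_taylor
    graded_free_resolution_iff[OF assms] by metis

lemma chosen_resolution:
  fixes I :: "('n::finite, 'k::field) mpoly set"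
  assumes "ideal I" "monomial_ideal I"
  shows "homog_complex (chosen_resolution I)" "exact_strands I (chosen_resolution I)"
proof -
  have "graded_free_resolution I (chosen_resolution I)"
    unfolding chosen_resolution_def using graded_free_resolution_exists[OF assms] by (rule someI_ex)
  then show "homog_complex (chosen_resolution I)" "exact_strands I (chosen_resolution I)"
    using graded_free_resolution_iff[OF assms] by auto
qed

section \<open>Tor as Koszul homology\<close>

text \<open>
  The degree \<open>a - e_S\<close>.
\<close>

definition lower :: "('n \<Rightarrow> int) \<Rightarrow> 'n set \<Rightarrow> 'n \<Rightarrow> int"
  where "lower a S = (\<lambda>j. if j \<in> S then a j - 1 else a j)"

text \<open>
  The sets \<open>S\<close> for which \<open>x^(a - e_S)\<close> times the Koszul basis vector \<open>e_S\<close> is a nonzero element of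
  degree \<open>a\<close> of the Koszul complex of \<open>R/I\<close>. These sets are closed upwards inside the support of
  \<open>a\<close>, so the Koszul complex is a quotient of the chain complex of a simplex.
\<close>

definition kfaces :: "('n::finite, 'k::field) mpoly set \<Rightarrow> ('n \<Rightarrow> int) \<Rightarrow> 'n set set"
  where "kfaces I a = {S. lower a S \<in> standard I}"

definition kchains :: "('n::finite, 'k::field) mpoly set \<Rightarrow> ('n \<Rightarrow> int) \<Rightarrow> nat \<Rightarrow> ('n set \<Rightarrow> 'k) set"
  where "kchains I a q = {z. \<forall>S. z S \<noteq> 0 \<longrightarrow> S \<in> kfaces I a \<and> card S = q}"

definition kdiff :: "('n::{finite,linorder}, 'k::field) mpoly set \<Rightarrow> ('n \<Rightarrow> int) \<Rightarrow> ('n set \<Rightarrow> 'k) \<Rightarrow> 'n set \<Rightarrow> 'k"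
  where "kdiff I a z = (\<lambda>T. if T \<in> kfaces I a then drop_sum UNIV z T else 0)"

definition kcycles :: "('n::{finite,linorder}, 'k::field) mpoly set \<Rightarrow> ('n \<Rightarrow> int) \<Rightarrow> nat \<Rightarrow> ('n set \<Rightarrow> 'k) set"
  where "kcycles I a q = {z \<in> kchains I a q. kdiff I a z = 0}"

definition kboundaries :: "('n::{finite,linorder}, 'k::field) mpoly set \<Rightarrow> ('n \<Rightarrow> int) \<Rightarrow> nat \<Rightarrow> ('n set \<Rightarrow> 'k) set"
  where "kboundaries I a q = kdiff I a ` kchains I a (Suc q)"

lemma lower_antimono: "S \<subseteq> T \<Longrightarrow> lower a T \<le> lower a S"
  by (auto simp: lower_def le_fun_def)

lemma lower_empty [simp]: "lower a {} = a"
  by (simp add: lower_def)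

lemma kfaces_between:
  assumes "ideal I" "S \<in> kfaces I a" "S \<subseteq> T" "0 \<le> lower a T"
  shows "T \<in> kfaces I a"
  using standard_mono[OF assms(1) _ assms(4) lower_antimono[OF assms(3)]] assms(2)
  by (simp add: kfaces_def)

lemma kfaces_nonneg: "S \<in> kfaces I a \<Longrightarrow> 0 \<le> lower a S"
  by (simp add: kfaces_def standard_def)

lemma drop_sum_add: "drop_sum N (\<lambda>S. y S + z S) T = drop_sum N y T + drop_sum N z T"
  by (simp add: drop_sum_def distrib_left sum.distrib)

lemma drop_sum_scale: "drop_sum N (\<lambda>S. c * z S) T = c * drop_sum N z T"
  by (simp add: drop_sum_def sum_distrib_left mult.left_commute)

lemma drop_sum_cong:
  "(\<And>j. j \<in> N - T \<Longrightarrow> y (insert j T) = z (insert j T)) \<Longrightarrow> drop_sum N y T = drop_sum N z T"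
  by (simp add: drop_sum_def)

lemma drop_sum_nonzero:
  assumes "drop_sum N z T \<noteq> 0"
  obtains j where "j \<in> N - T" "z (insert j T) \<noteq> 0"
proof -
  obtain j where "j \<in> N - T" "sg j T * z (insert j T) \<noteq> 0"
    using assms unfolding drop_sum_def by (rule sum.not_neutral_contains_not_neutral)
  then show thesis using that[of j] by (metis mult_zero_right)
qed

text \<open>
  Discarding sets that are not faces is harmless because a set between two faces is a face.
\<close>

lemma kdiff_kdiff:
  assumes I: "ideal I" and z: "z \<in> kchains I a q"
  shows "kdiff I a (kdiff I a z) = 0"
proof
  fix T
  show "kdiff I a (kdiff I a z) T = 0 T"
  proof (cases "T \<in> kfaces I a")
    case True
    have "kdiff I a z (insert j T) = drop_sum UNIV z (insert j T)" for j
    proof (cases "drop_sum UNIV z (insert j T) = 0")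
      case False
      then obtain k where "z (insert k (insert j T)) \<noteq> 0" by (rule drop_sum_nonzero)
      then have "0 \<le> lower a (insert k (insert j T))"
        using z kfaces_nonneg unfolding kchains_def by blast
      also have "\<dots> \<le> lower a (insert j T)" by (rule lower_antimono) auto
      finally have "insert j T \<in> kfaces I a" using kfaces_between[OF I True] by auto
      then show ?thesis by (simp add: kdiff_def)
    qed (simp add: kdiff_def)
    then have "kdiff I a (kdiff I a z) T = drop_sum UNIV (drop_sum UNIV z) T"
      using True by (simp add: kdiff_def[of I a "kdiff I a z"] cong: drop_sum_cong)
    then show ?thesis by (simp add: drop_sum_drop_sum)
  qed (simp add: kdiff_def)
qed

lemma kdiff_chain: "z \<in> kchains I a (Suc q) \<Longrightarrow> kdiff I a z \<in> kchains I a q"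
  unfolding kchains_def
proof clarify
  fix T assume z: "\<forall>S. z S \<noteq> 0 \<longrightarrow> S \<in> kfaces I a \<and> card S = Suc q" and T: "kdiff I a z T \<noteq> 0"
  then have "T \<in> kfaces I a" "drop_sum UNIV z T \<noteq> 0" by (auto simp: kdiff_def split: if_splits)
  moreover from this(2) obtain j where "j \<in> UNIV - T" "z (insert j T) \<noteq> 0" by (rule drop_sum_nonzero)
  then have "j \<notin> T" "card (insert j T) = Suc q" using z by auto
  then have "card T = q" by simp
  ultimately show "T \<in> kfaces I a \<and> card T = q" by simp
qed

lemma kdiff_0_chain: "z \<in> kchains I a 0 \<Longrightarrow> kdiff I a z = 0"
proof
  fix T assume z: "z \<in> kchains I a 0"
  have "z (insert j T) = 0" for j
  proof (rule ccontr)
    assume "z (insert j T) \<noteq> 0"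
    then have "card (insert j T) = 0" using z unfolding kchains_def by blast
    then show False by simp
  qed
  then show "kdiff I a z T = 0 T" by (simp add: kdiff_def drop_sum_def)
qed

text \<open>
  The degree \<open>a\<close> component of \<open>F \<otimes> K\<close>, with \<open>K\<close> the Koszul complex, is the double complex with
  entries indexed by \<open>p + 1\<close> and \<open>q + 1\<close>: the basis vector \<open>b\<close> of \<open>F_p\<close> and the set \<open>S\<close> of size \<open>q\<close>
  contribute if \<open>b\<close> belongs to the strand of degree \<open>a - e_S\<close>. Index \<open>0\<close> is reserved for the
  augmentations \<open>F \<otimes> k\<close> (with \<open>S = {}\<close>) and \<open>R/I \<otimes> K\<close> (with the dummy index \<open>b = 0\<close>). All entries
  live in one type, as the abstract zigzag argument wants.
\<close>

fun dc_space :: "('n::{finite,linorder}, 'k::field) mpoly set \<Rightarrow> ('n, 'k) free_complex \<Rightarrow> ('n \<Rightarrow> int) \<Rightarrow>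
    nat \<Rightarrow> nat \<Rightarrow> (nat \<Rightarrow> 'n set \<Rightarrow> 'k) set" where
  "dc_space I F a 0 0 = {0}"
| "dc_space I F a 0 (Suc q) = {w. \<forall>b S. w b S \<noteq> 0 \<longrightarrow> b = 0 \<and> card S = q \<and> S \<in> kfaces I a}"
| "dc_space I F a (Suc p) 0 = {w. \<forall>b S. w b S \<noteq> 0 \<longrightarrow> S = {} \<and> b < frank F p \<and> fdeg F p b = a}"
| "dc_space I F a (Suc p) (Suc q) =
    {w. \<forall>b S. w b S \<noteq> 0 \<longrightarrow> b < frank F p \<and> card S = q \<and> fdeg F p b \<le> lower a S}"

fun dc_h :: "('n::{finite,linorder}, 'k::field) mpoly set \<Rightarrow> ('n, 'k) free_complex \<Rightarrow> ('n \<Rightarrow> int) \<Rightarrow>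
    nat \<Rightarrow> nat \<Rightarrow> (nat \<Rightarrow> 'n set \<Rightarrow> 'k) \<Rightarrow> nat \<Rightarrow> 'n set \<Rightarrow> 'k" where
  "dc_h I F a 0 q w = 0"
| "dc_h I F a (Suc 0) 0 w = 0"
| "dc_h I F a (Suc 0) (Suc q) w = (\<lambda>c S. if c = 0 \<and> S \<in> kfaces I a then saug F (\<lambda>b. w b S) else 0)"
| "dc_h I F a (Suc (Suc p)) 0 w = (\<lambda>c S. if S = {} then tensor_diff F p (\<lambda>b. w b {}) c else 0)"
| "dc_h I F a (Suc (Suc p)) (Suc q) w = (\<lambda>c S. sdiff F p (\<lambda>b. w b S) c)"

fun dc_v :: "('n::{finite,linorder}, 'k::field) mpoly set \<Rightarrow> ('n, 'k) free_complex \<Rightarrow> ('n \<Rightarrow> int) \<Rightarrow>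
    nat \<Rightarrow> nat \<Rightarrow> (nat \<Rightarrow> 'n set \<Rightarrow> 'k) \<Rightarrow> nat \<Rightarrow> 'n set \<Rightarrow> 'k" where
  "dc_v I F a p 0 w = 0"
| "dc_v I F a 0 (Suc 0) w = 0"
| "dc_v I F a (Suc p) (Suc 0) w = (\<lambda>b S. if S = {} \<and> fdeg F p b = a then w b {} else 0)"
| "dc_v I F a 0 (Suc (Suc q)) w = (\<lambda>b T. if b = 0 then kdiff I a (w b) T else 0)"
| "dc_v I F a (Suc p) (Suc (Suc q)) w = (\<lambda>b T. drop_sum UNIV (w b) T)"

definition dc_scale :: "'k::field \<Rightarrow> (nat \<Rightarrow> 'n set \<Rightarrow> 'k) \<Rightarrow> nat \<Rightarrow> 'n set \<Rightarrow> 'k"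
  where "dc_scale c w = (\<lambda>b S. c * w b S)"

lemma saug_add: "saug F (\<lambda>b. x b + y b) = saug F x + saug F y"
  by (simp add: saug_def distrib_right sum.distrib)

lemma saug_scale: "saug F (\<lambda>b. c * x b) = c * saug F x"
  by (simp add: saug_def sum_distrib_left mult.assoc)

lemma sdiff_add: "sdiff F p (\<lambda>b. x b + y b) c = sdiff F p x c + sdiff F p y c"
  by (simp add: sdiff_def distrib_right sum.distrib)

lemma sdiff_scale: "sdiff F p (\<lambda>b. s * x b) c = s * sdiff F p x c"
  by (simp add: sdiff_def sum_distrib_left mult.assoc)

lemma tensor_diff_add: "tensor_diff F p (\<lambda>b. x b + y b) c = tensor_diff F p x c + tensor_diff F p y c"
  by (simp add: tensor_diff_def distrib_right sum.distrib)

lemma tensor_diff_scale: "tensor_diff F p (\<lambda>b. s * x b) c = s * tensor_diff F p x c"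
  by (simp add: tensor_diff_def sum_distrib_left mult.assoc)

lemma kdiff_add: "kdiff I a (\<lambda>S. y S + z S) T = kdiff I a y T + kdiff I a z T"
  by (simp add: kdiff_def drop_sum_add)

lemma kdiff_scale: "kdiff I a (\<lambda>S. c * z S) T = c * kdiff I a z T"
  by (simp add: kdiff_def drop_sum_scale)

lemma sdiff_drop_sum:
  fixes F :: "('n::{finite,linorder}, 'k::field) free_complex"
  shows "sdiff F p (\<lambda>b. drop_sum UNIV (w b) T) c = drop_sum UNIV (\<lambda>S. sdiff F p (\<lambda>b. w b S) c) T"
proof (cases "c < frank F p")
  case True
  have "(\<Sum>b<frank F (Suc p). (\<Sum>j\<in>UNIV - T. sg j T * w b (insert j T)) * scal F p b c) =
      (\<Sum>b<frank F (Suc p). \<Sum>j\<in>UNIV - T. sg j T * (w b (insert j T) * scal F p b c))"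
    by (simp add: sum_distrib_right mult.assoc)
  also have "\<dots> = (\<Sum>j\<in>UNIV - T. \<Sum>b<frank F (Suc p). sg j T * (w b (insert j T) * scal F p b c))"
    by (rule sum.swap)
  finally show ?thesis using True by (simp add: sdiff_def drop_sum_def sum_distrib_left)
qed (simp add: sdiff_def drop_sum_def)

lemma saug_drop_sum:
  fixes F :: "('n::{finite,linorder}, 'k::field) free_complex"
  shows "saug F (\<lambda>b. drop_sum UNIV (w b) T) = drop_sum UNIV (\<lambda>S. saug F (\<lambda>b. w b S)) T"
proof -
  have "(\<Sum>b<frank F 0. (\<Sum>j\<in>UNIV - T. sg j T * w b (insert j T)) * scal_aug F b) =
      (\<Sum>b<frank F 0. \<Sum>j\<in>UNIV - T. sg j T * (w b (insert j T) * scal_aug F b))"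
    by (simp add: sum_distrib_right mult.assoc)
  also have "\<dots> = (\<Sum>j\<in>UNIV - T. \<Sum>b<frank F 0. sg j T * (w b (insert j T) * scal_aug F b))"
    by (rule sum.swap)
  finally show ?thesis by (simp add: saug_def drop_sum_def sum_distrib_left)
qed

text \<open>
  Reduction modulo the variables kills the elements \<open>x^(a - deg b) b\<close> with \<open>deg b \<noteq> a\<close>, and a
  homogeneous matrix entry has a constant term only between basis vectors of equal degree.
\<close>

lemma tensor_diff_top_part:
  fixes F :: "('n::{finite,linorder}, 'k::field) free_complex"
  assumes h: "homog_complex F" and w: "w \<in> strand F (Suc p) a"
  shows "tensor_diff F p (\<lambda>b. if fdeg F (Suc p) b = a then w b else 0) c =
    (if fdeg F p c = a then sdiff F p w c else 0)"
proof (cases "c < frank F p")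
  case True
  have "(if fdeg F (Suc p) b = a then w b else 0) * lookup (fdiff F p b c) 0 =
      (if fdeg F p c = a then w b * scal F p b c else 0)" if b: "b < frank F (Suc p)" for b
  proof (cases "w b = 0 \<or> scal F p b c = 0")
    case True': True
    then show ?thesis by (subst homog_complex_diff(1)[OF h b True]) auto
  next
    case False
    then have le: "fdeg F p c \<le> fdeg F (Suc p) b" "fdeg F (Suc p) b \<le> a"
      using homog_complex_diff(2)[OF h b True] w unfolding strand_def by auto
    have zero: "expo (fdeg F (Suc p) b - fdeg F p c) = 0 \<longleftrightarrow> fdeg F (Suc p) b = fdeg F p c"
    proof -
      have "0 = expo (0 :: 'n \<Rightarrow> int)" by (rule poly_mapping_eqI) simp
      moreover have "0 \<le> fdeg F (Suc p) b - fdeg F p c" using le(1) by (simp add: le_fun_def)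
      ultimately show ?thesis using expo_eq_iff[of "fdeg F (Suc p) b - fdeg F p c" 0] by simp
    qed
    have "fdeg F p c = a \<Longrightarrow> fdeg F (Suc p) b = a" using le by (simp add: antisym)
    then show ?thesis
      by (subst homog_complex_diff(1)[OF h b True]) (auto simp: lookup_single when_def zero)
  qed
  then show ?thesis using True by (simp add: tensor_diff_def sdiff_def)
qed (simp add: tensor_diff_def sdiff_def)

lemma dc_space_support:
  assumes "\<And>b S. z b S \<noteq> 0 \<Longrightarrow> x b S \<noteq> 0 \<or> y b S \<noteq> 0"
    and "x \<in> dc_space I F a p q" "y \<in> dc_space I F a p q"
  shows "z \<in> dc_space I F a p q"
proof (cases p)
  case 0
  show ?thesis
  proof (cases q)
    case 0
    then have "x = 0" "y = 0" using assms(2,3) \<open>p = 0\<close> by auto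
    then have "z b S = 0" for b S using assms(1)[of b S] by auto
    then have "z = 0" by (intro ext) simp
    then show ?thesis unfolding 0 \<open>p = 0\<close> dc_space.simps by blast
  next
    case (Suc q')
    show ?thesis using assms unfolding 0 Suc dc_space.simps mem_Collect_eq by blast
  qed
next
  case (Suc p')
  show ?thesis using assms unfolding Suc
    by (cases q) (simp_all only: dc_space.simps mem_Collect_eq, blast+)
qed

lemma dc_space_add: "x \<in> dc_space I F a p q \<Longrightarrow> y \<in> dc_space I F a p q \<Longrightarrow> x + y \<in> dc_space I F a p q"
  by (rule dc_space_support[of "x + y" x y]) auto

lemma dc_space_diff: "x \<in> dc_space I F a p q \<Longrightarrow> y \<in> dc_space I F a p q \<Longrightarrow> x - y \<in> dc_space I F a p q"
  by (rule dc_space_support[of "x - y" x y]) auto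

lemma dc_space_scale: "x \<in> dc_space I F a p q \<Longrightarrow> dc_scale c x \<in> dc_space I F a p q"
  by (cases p; cases q) (auto simp: dc_scale_def fun_eq_iff)

lemma dc_h_add: "dc_h I F a p q (x + y) = dc_h I F a p q x + dc_h I F a p q y"
  by (induction I F a p q x rule: dc_h.induct)
    (auto simp: fun_eq_iff saug_add sdiff_add tensor_diff_add)

lemma dc_h_scale: "dc_h I F a p q (dc_scale c x) = dc_scale c (dc_h I F a p q x)"
  by (induction I F a p q x rule: dc_h.induct)
    (auto simp: dc_scale_def fun_eq_iff saug_scale sdiff_scale tensor_diff_scale)

lemma dc_v_add: "dc_v I F a p q (x + y) = dc_v I F a p q x + dc_v I F a p q y"
  by (induction I F a p q x rule: dc_v.induct)
    (auto simp: fun_eq_iff drop_sum_add kdiff_add)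

lemma dc_v_scale: "dc_v I F a p q (dc_scale c x) = dc_scale c (dc_v I F a p q x)"
  by (induction I F a p q x rule: dc_v.induct)
    (auto simp: dc_scale_def fun_eq_iff drop_sum_scale kdiff_scale)

lemma dc_scale_0: "dc_scale c 0 = 0"
  by (intro ext) (simp add: dc_scale_def)

text \<open>
  For a fixed set \<open>S\<close> the row is a strand of the resolution. For a fixed basis vector \<open>b\<close> the column
  is the chain complex of the full simplex on the set of positions where \<open>a\<close> exceeds the degree of
  \<open>b\<close>, which is contractible unless that set is empty, and then the degree is \<open>a\<close>.
\<close>

lemma double_complex_koszul:
  fixes I :: "('n::{finite,linorder}, 'k::field) mpoly set"
  assumes I: "ideal I" and h: "homog_complex F" and ex: "exact_strands I F"
  shows "double_complex dc_scale (dc_space I F a) (dc_h I F a) (dc_v I F a)"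
proof -
  let ?A = "dc_space I F a" and ?h = "dc_h I F a" and ?v = "dc_v I F a"
  have surj: "d \<in> standard I \<Longrightarrow> \<exists>w\<in>strand F 0 d. saug F w = 1" for d
    using ex unfolding exact_strands_def by blast
  have ex0: "{w \<in> strand F 0 d. d \<in> standard I \<longrightarrow> saug F w = 0} = sdiff F 0 ` strand F (Suc 0) d" for d
    using ex unfolding exact_strands_def One_nat_def by blast
  have exS: "{w \<in> strand F (Suc p) d. sdiff F p w = 0} = sdiff F (Suc p) ` strand F (Suc (Suc p)) d" for p d
    using ex unfolding exact_strands_def by blast
  have slice: "(\<lambda>b. x b S) \<in> strand F p (lower a S)" if "x \<in> ?A (Suc p) (Suc q)" for x p q S
    using that by (auto simp: strand_def)
  have dv_mem: "?v p (Suc q) x \<in> ?A p q" if x: "x \<in> ?A p (Suc q)" for p q x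
  proof (cases p; cases q)
    fix q' assume pq: "p = 0" "q = Suc q'"
    then have "x 0 \<in> kchains I a (Suc q')" using x by (auto simp: kchains_def)
    then have "kdiff I a (x 0) \<in> kchains I a q'" by (rule kdiff_chain)
    then show ?thesis using pq by (auto simp: kchains_def)
  next
    fix p' q' assume pq: "p = Suc p'" "q = Suc q'"
    have "b < frank F p' \<and> card T = q' \<and> fdeg F p' b \<le> lower a T" if "drop_sum UNIV (x b) T \<noteq> 0" for b T
    proof -
      from that obtain j where j: "j \<in> UNIV - T" "x b (insert j T) \<noteq> 0" by (rule drop_sum_nonzero)
      then have "b < frank F p'" "card (insert j T) = Suc q'" "fdeg F p' b \<le> lower a (insert j T)"
        using x pq by auto
      moreover have "lower a (insert j T) \<le> lower a T" by (rule lower_antimono) auto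
      ultimately show ?thesis using j(1) by (auto intro: order_trans)
    qed
    then show ?thesis using pq by simp
  qed (use x in \<open>auto split: if_splits\<close>)
  have comm: "?h (Suc p) q (?v (Suc p) (Suc q) x) = ?v p (Suc q) (?h (Suc p) (Suc q) x)"
    if x: "x \<in> ?A (Suc p) (Suc q)" for p q x
  proof (cases p; cases q)
    fix q' assume pq: "p = 0" "q = Suc q'"
    have "saug F (\<lambda>b. drop_sum UNIV (x b) T) =
        drop_sum UNIV (\<lambda>S. if S \<in> kfaces I a then saug F (\<lambda>b. x b S) else 0) T" if T: "T \<in> kfaces I a" for T
      unfolding saug_drop_sum
    proof (rule drop_sum_cong)
      fix j assume "j \<in> UNIV - T"
      show "saug F (\<lambda>b. x b (insert j T)) = (if insert j T \<in> kfaces I a then saug F (\<lambda>b. x b (insert j T)) else 0)"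
      proof (cases "saug F (\<lambda>b. x b (insert j T)) = 0")
        case False
        then obtain b where b: "b < frank F 0" "x b (insert j T) * scal_aug F b \<noteq> 0"
          unfolding saug_def by (auto elim!: sum.not_neutral_contains_not_neutral)
        then have "0 \<le> fdeg F 0 b" "fdeg F 0 b \<le> lower a (insert j T)"
          using homog_complex_aug(2)[OF h b(1)] x pq by auto
        then have "0 \<le> lower a (insert j T)" by (rule order_trans)
        then have "insert j T \<in> kfaces I a" using kfaces_between[OF I T] by auto
        then show ?thesis by simp
      qed simp
    qed
    then show ?thesis using pq by (auto simp: fun_eq_iff kdiff_def)
  next
    fix p' assume pq: "p = Suc p'" "q = 0"
    have "(\<lambda>b. x b {}) \<in> strand F (Suc p') a" using slice[of x "Suc p'" q "{}"] x pq by simp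
    from tensor_diff_top_part[OF h this] show ?thesis using pq by (auto simp: fun_eq_iff)
  next
    fix p' q' assume pq: "p = Suc p'" "q = Suc q'"
    then show ?thesis by (simp add: sdiff_drop_sum fun_eq_iff)
  qed simp
  have h_mem: "?h (Suc p) (Suc q) x \<in> ?A p (Suc q)" if x: "x \<in> ?A (Suc p) (Suc q)" for p q x
  proof (cases p)
    case 0
    have "card S = q" if nz: "saug F (\<lambda>b. x b S) \<noteq> 0" for S
    proof -
      obtain b where "x b S * scal_aug F b \<noteq> 0"
        using nz unfolding saug_def by (rule sum.not_neutral_contains_not_neutral)
      then have "x b S \<noteq> 0" by auto
      then show ?thesis using x by auto
    qed
    then show ?thesis using 0 by (auto split: if_splits)
  next
    case (Suc p')
    have "c < frank F p' \<and> card S = q \<and> fdeg F p' c \<le> lower a S" if nz: "sdiff F p' (\<lambda>b. x b S) c \<noteq> 0" for c S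
    proof -
      have "sdiff F p' (\<lambda>b. x b S) \<in> strand F p' (lower a S)"
        using sdiff_strand[OF h slice] x Suc by blast
      moreover obtain b where "x b S \<noteq> 0"
        using nz unfolding sdiff_def by (auto elim!: sum.not_neutral_contains_not_neutral split: if_splits)
      ultimately show ?thesis using x nz Suc unfolding strand_def by auto
    qed
    then show ?thesis using Suc by simp
  qed
  have col_exact: "\<exists>w\<in>?A (Suc p) (Suc q). ?v (Suc p) (Suc q) w = x"
    if x: "x \<in> ?A (Suc p) q" and vx: "?v (Suc p) q x = 0" for p q x
  proof (cases q)
    case 0
    have "S = {} \<and> b < frank F p \<and> fdeg F p b = a" if "x b S \<noteq> 0" for b S using x 0 that by simp
    then have "x \<in> ?A (Suc p) (Suc 0)" by fastforce
    moreover have "?v (Suc p) (Suc 0) x = x" using x 0 by (auto simp: fun_eq_iff)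
    ultimately show ?thesis using 0 by blast
  next
    case (Suc q')
    \<comment> \<open>An apex for the column of \<open>b\<close>; it exists because in the kernel no \<open>b\<close> of full degree \<open>a\<close> is left.\<close>
    define v where "v b = (SOME j. fdeg F p b j < a j)" for b
    have v: "fdeg F p b (v b) < a (v b)" if "x b S \<noteq> 0" for b S
    proof -
      have le: "fdeg F p b \<le> a"
        using x Suc that lower_antimono[of "{}" S a] by (auto intro: order_trans)
      have "fdeg F p b \<noteq> a"
      proof
        assume eq: "fdeg F p b = a"
        have leS: "a \<le> lower a S" using x Suc that eq by auto
        have "j \<notin> S" for j using le_funD[OF leS, of j] by (auto simp: lower_def)
        then have "S = {}" by blast
        have "card S = q'" using x Suc that by auto
        then have "q' = 0" using \<open>S = {}\<close> by simp
        have "?v (Suc p) q x b {} = 0" using vx by simp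
        then show False using \<open>S = {}\<close> \<open>q' = 0\<close> Suc that eq by simp
      qed
      then obtain j where "fdeg F p b j < a j" using le by (metis antisym_conv2 le_funD ext)
      then show ?thesis unfolding v_def by (rule someI)
    qed
    define w where "w b = cone_map (v b) (x b)" for b
    have "w \<in> ?A (Suc p) (Suc q)"
    proof -
      have "b < frank F p \<and> card S = q \<and> fdeg F p b \<le> lower a S" if "w b S \<noteq> 0" for b S
      proof -
        have vS: "v b \<in> S" and nz: "x b (S - {v b}) \<noteq> 0"
          using that by (auto simp: w_def cone_map_def split: if_splits)
        have *: "b < frank F p" "card (S - {v b}) = q'" "fdeg F p b \<le> lower a (S - {v b})"
          using x nz Suc by auto
        have "card S = q" using card_Suc_Diff1[OF finite vS] *(2) Suc by simp
        moreover have "fdeg F p b j \<le> lower a S j" for j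
          using le_funD[OF *(3), of j] v[OF nz] by (auto simp: lower_def split: if_splits)
        ultimately show ?thesis using *(1) by (simp add: le_fun_def)
      qed
      then show ?thesis by simp
    qed
    moreover have "drop_sum UNIV (w b) T = x b T" for b T
    proof -
      have "drop_sum UNIV (x b) U = 0" for U
      proof (cases q')
        case 0
        have "x b (insert j U) = 0" for j
        proof (rule ccontr)
          assume "x b (insert j U) \<noteq> 0"
          then have "card (insert j U) = 0" using x Suc 0 by auto
          then show False by simp
        qed
        then show ?thesis by (simp add: drop_sum_def)
      next
        case (Suc q'')
        then show ?thesis using vx \<open>q = Suc q'\<close> by (auto simp: fun_eq_iff)
      qed
      then have "cone_map (v b) (drop_sum UNIV (x b)) T = 0" by (simp add: cone_map_def)
      then show ?thesis using cone_homotopy[of UNIV T "v b" "x b"] by (simp add: w_def)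
    qed
    ultimately show ?thesis using Suc by (intro bexI[of _ w]) (auto simp: fun_eq_iff)
  qed
  have row_exact: "\<exists>w\<in>?A (Suc p) (Suc q). ?h (Suc p) (Suc q) w = x"
    if x: "x \<in> ?A p (Suc q)" and hx: "?h p (Suc q) x = 0" for p q x
  proof (cases p)
    case 0
    have "\<forall>S. \<exists>u. S \<in> kfaces I a \<longrightarrow> u \<in> strand F 0 (lower a S) \<and> saug F u = 1"
      using surj unfolding kfaces_def by blast
    from choice[OF this] obtain u where
      u: "\<And>S. S \<in> kfaces I a \<Longrightarrow> u S \<in> strand F 0 (lower a S)" "\<And>S. S \<in> kfaces I a \<Longrightarrow> saug F (u S) = 1"
      by blast
    define w where "w b S = x 0 S * u S b" for b S
    have "w \<in> ?A (Suc p) (Suc q)"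
      using u(1) x 0 by (auto simp: w_def strand_def)
    moreover have "saug F (\<lambda>b. w b S) = x 0 S" if "S \<in> kfaces I a" for S
      using u(2)[OF that] by (simp add: w_def saug_scale)
    then have "?h (Suc p) (Suc q) w = x" using 0 x by (auto simp: fun_eq_iff)
    ultimately show ?thesis by blast
  next
    case (Suc p')
    have "\<exists>u. u \<in> strand F p (lower a S) \<and> sdiff F p' u = (\<lambda>b. x b S) \<and> (card S \<noteq> q \<longrightarrow> u = 0)" for S
    proof (cases "card S = q")
      case True
      have sl: "(\<lambda>b. x b S) \<in> strand F p' (lower a S)" using slice x Suc by blast
      have "(\<lambda>b. x b S) \<in> sdiff F p' ` strand F (Suc p') (lower a S)"
      proof (cases p')
        case 0
        have "?h p (Suc q) x 0 S = 0" using hx by simp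
        then have "saug F (\<lambda>b. x b S) = 0" if "lower a S \<in> standard I"
          using Suc 0 that by (simp add: kfaces_def)
        then show ?thesis using sl unfolding 0 ex0[symmetric] by simp
      next
        case (Suc p'')
        have "sdiff F p'' (\<lambda>b. x b S) = 0"
          using hx \<open>p = Suc p'\<close> Suc by (auto simp: fun_eq_iff)
        then show ?thesis using sl unfolding Suc exS[symmetric] by simp
      qed
      then show ?thesis using True Suc by auto
    next
      case False
      then have "x b S = 0" for b using x Suc by auto
      then have "sdiff F p' 0 = (\<lambda>b. x b S)" by (auto simp: sdiff_def)
      moreover have "0 \<in> strand F p (lower a S)" by (simp add: strand_def)
      ultimately show ?thesis by blast
    qed
    then have "\<forall>S. \<exists>u. u \<in> strand F p (lower a S) \<and> sdiff F p' u = (\<lambda>b. x b S) \<and> (card S \<noteq> q \<longrightarrow> u = 0)"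
      by blast
    from choice[OF this] obtain u where
      u: "\<And>S. u S \<in> strand F p (lower a S)" "\<And>S. sdiff F p' (u S) = (\<lambda>b. x b S)" "\<And>S. card S \<noteq> q \<Longrightarrow> u S = 0"
      by blast
    define w where "w b S = u S b" for b S
    have "w \<in> ?A (Suc p) (Suc q)"
      using u(1,3) by (fastforce simp: w_def strand_def)
    moreover have "?h (Suc p) (Suc q) w = x" using u(2) Suc by (simp add: w_def)
    ultimately show ?thesis by blast
  qed
  have v0: "?v p q 0 = 0" for p q
    using dc_v_add[of I F a p q 0 0] by simp
  have h_mem0: "?h (Suc p) 0 x \<in> ?A p 0" if x: "x \<in> ?A (Suc p) 0" for p x
  proof -
    obtain w where w: "w \<in> ?A (Suc p) (Suc 0)" "?v (Suc p) (Suc 0) w = x"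
      using col_exact[OF x dc_v.simps(1)] by blast
    then have "?h (Suc p) 0 x = ?v p (Suc 0) (?h (Suc p) (Suc 0) w)" using comm[OF w(1)] by simp
    then show ?thesis using dv_mem[OF h_mem[OF w(1)]] by simp
  qed
  have h_h: "?h p (Suc q) (?h (Suc p) (Suc q) x) = 0" if x: "x \<in> ?A (Suc p) (Suc q)" for p q x
  proof (cases p)
    case (Suc p')
    show ?thesis
    proof (cases p')
      case 0
      have "saug F (\<lambda>b. sdiff F 0 (\<lambda>b. x b S) b) = 0" if "S \<in> kfaces I a" for S
      proof -
        have "sdiff F 0 (\<lambda>b. x b S) \<in> sdiff F 0 ` strand F (Suc 0) (lower a S)"
          using slice x Suc 0 by blast
        then show ?thesis using that unfolding ex0[symmetric] kfaces_def by simp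
      qed
      then show ?thesis using Suc 0 by (auto simp: fun_eq_iff)
    next
      case (Suc p'')
      have "sdiff F p'' (sdiff F (Suc p'') (\<lambda>b. x b S)) = 0" for S
      proof -
        have "sdiff F (Suc p'') (\<lambda>b. x b S) \<in> sdiff F (Suc p'') ` strand F (Suc (Suc p'')) (lower a S)"
          using slice x \<open>p = Suc p'\<close> Suc by blast
        then show ?thesis unfolding exS[symmetric] by simp
      qed
      then show ?thesis using \<open>p = Suc p'\<close> Suc by (simp add: fun_eq_iff)
    qed
  qed simp
  have h_h0: "?h p 0 (?h (Suc p) 0 x) = 0" if x: "x \<in> ?A (Suc p) 0" for p x
  proof (cases p)
    case (Suc p')
    obtain w where w: "w \<in> ?A (Suc p) (Suc 0)" "?v (Suc p) (Suc 0) w = x"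
      using col_exact[OF x dc_v.simps(1)] by blast
    have "?h (Suc p) 0 x = ?v p (Suc 0) (?h (Suc p) (Suc 0) w)" using comm[OF w(1)] w(2) by simp
    then have "?h p 0 (?h (Suc p) 0 x) = ?v p' (Suc 0) (?h p (Suc 0) (?h (Suc p) (Suc 0) w))"
      using comm[of "?h (Suc p) (Suc 0) w" p' 0] h_mem[OF w(1)] Suc by simp
    then show ?thesis using h_h[OF w(1)] v0 by simp
  qed simp
  have v_v: "?v p q (?v p (Suc q) x) = 0" if x: "x \<in> ?A p (Suc q)" for p q x
  proof (cases q)
    case (Suc q')
    show ?thesis
    proof (cases p)
      case 0
      show ?thesis
      proof (cases q')
        case (Suc q'')
        have "x 0 \<in> kchains I a q" using x 0 by (auto simp: kchains_def)
        then show ?thesis using kdiff_kdiff[OF I] 0 Suc \<open>q = Suc q'\<close> by (auto simp: fun_eq_iff)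
      qed (use 0 Suc in simp)
    next
      case (Suc p')
      show ?thesis
      proof (cases q')
        case 0
        have "x b (insert j {}) = 0" if b: "fdeg F p' b = a" for b j
        proof (rule ccontr)
          assume "x b (insert j {}) \<noteq> 0"
          then have "a \<le> lower a {j}" using x Suc b by auto
          then have "a j \<le> lower a {j} j" by (rule le_funD)
          then show False by (simp add: lower_def)
        qed
        then show ?thesis using Suc 0 \<open>q = Suc q'\<close> by (auto simp: fun_eq_iff drop_sum_def)
      next
        case (Suc q'')
        then show ?thesis using \<open>p = Suc p'\<close> \<open>q = Suc q'\<close>
          by (auto simp: fun_eq_iff drop_sum_drop_sum)
      qed
    qed
  qed simp
  show ?thesis
  proof
    fix x y :: "nat \<Rightarrow> 'n set \<Rightarrow> 'k" and p q c
    show "?h (Suc p) q x \<in> ?A p q" if "x \<in> ?A (Suc p) q"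
      using that h_mem h_mem0 by (cases q) auto
    show "?h p q (?h (Suc p) q x) = 0" if "x \<in> ?A (Suc p) q"
      using that h_h h_h0 by (cases q) auto
  qed (fact dc_space_add dc_space_diff dc_space_scale dc_h_add dc_v_add dc_h_scale dc_v_scale
      dc_scale_0 dv_mem dc_h.simps(1) dc_v.simps(1) v_v comm row_exact col_exact)+
qed

definition tor_emb :: "(nat \<Rightarrow> 'k::zero) \<Rightarrow> nat \<Rightarrow> 'n set \<Rightarrow> 'k"
  where "tor_emb v = (\<lambda>b S. if S = {} then v b else 0)"

definition koszul_emb :: "('n set \<Rightarrow> 'k::zero) \<Rightarrow> nat \<Rightarrow> 'n set \<Rightarrow> 'k"
  where "koszul_emb z = (\<lambda>b S. if b = 0 then z S else 0)"

lemma hom_rel_transport: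
  assumes R: "hom_rel s s (f ` Z) (f ` B) (g ` Z') (g ` B') R"
    and f: "inj f" "\<And>x y. f (x + y) = f x + f y" "\<And>c x. f (s1 c x) = s c (f x)"
    and g: "inj g" "\<And>x y. g (x + y) = g x + g y" "\<And>c x. g (s2 c x) = s c (g x)"
  shows "hom_rel s1 s2 Z B Z' B' {(x, y). (f x, g y) \<in> R}"
  unfolding hom_rel_def
proof (intro conjI)
  note r = hom_relD[OF R]
  have mem: "f x \<in> f ` Z \<longleftrightarrow> x \<in> Z" "f x \<in> f ` B \<longleftrightarrow> x \<in> B" "g y \<in> g ` Z' \<longleftrightarrow> y \<in> Z'"
    "g y \<in> g ` B' \<longleftrightarrow> y \<in> B'" for x y
    by (simp_all add: inj_image_mem_iff f(1) g(1))
  let ?R = "{(x, y). (f x, g y) \<in> R}"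
  show "?R \<subseteq> Z \<times> Z'" using r(1,2) mem(1,3) by blast
  show "\<forall>z\<in>Z. \<exists>z'. (z, z') \<in> ?R" using r(2,3) by blast
  show "\<forall>z'\<in>Z'. \<exists>z. (z, z') \<in> ?R" using r(1,4) by blast
  show "\<forall>(z, z')\<in>?R. z \<in> B \<longleftrightarrow> z' \<in> B'" using r(5) mem(2,4) by blast
  show "\<forall>(x, x')\<in>?R. \<forall>(y, y')\<in>?R. (x + y, x' + y') \<in> ?R"
    using r(6) by (auto simp: f(2) g(2))
  show "\<forall>c. \<forall>(x, x')\<in>?R. (s1 c x, s2 c x') \<in> ?R" using r(7) by (auto simp: f(3) g(3))
qed

text \<open>
  Balancing of \<open>Tor\<close>: row \<open>0\<close> of the double complex computes the homology of \<open>F \<otimes> k\<close> and column \<open>0\<close>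
  that of the Koszul complex of \<open>R/I\<close>. In particular the choice of the resolution is immaterial.
\<close>

theorem tensor_koszul_hom_rel:
  fixes I :: "('n::{finite,linorder}, 'k::field) mpoly set"
  assumes I: "ideal I" and h: "homog_complex F" and ex: "exact_strands I F"
  shows "\<exists>R. hom_rel (\<lambda>c v b. c * v b) (\<lambda>c z S. c * z S)
     (tensor_cycles F i a) (tensor_boundaries F i a) (kcycles I a i) (kboundaries I a i) R"
    and "tensor_boundaries F i a \<subseteq> tensor_cycles F i a"
proof -
  interpret dc: double_complex dc_scale "dc_space I F a" "dc_h I F a" "dc_v I F a"
    by (rule double_complex_koszul[OF assms])
  let ?f = "tor_emb :: (nat \<Rightarrow> 'k) \<Rightarrow> nat \<Rightarrow> 'n set \<Rightarrow> 'k"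
  let ?g = "koszul_emb :: ('n set \<Rightarrow> 'k) \<Rightarrow> nat \<Rightarrow> 'n set \<Rightarrow> 'k"
  have A1: "dc_space I F a (Suc p) 0 = ?f ` tensor_comp F p a" for p
  proof (intro set_eqI iffI)
    fix w assume w: "w \<in> dc_space I F a (Suc p) 0"
    then have "w = ?f (\<lambda>b. w b {})" by (auto simp: tor_emb_def fun_eq_iff)
    moreover have "(\<lambda>b. w b {}) \<in> tensor_comp F p a" using w by (auto simp: tensor_comp_def)
    ultimately show "w \<in> ?f ` tensor_comp F p a" by blast
  qed (auto simp: tor_emb_def tensor_comp_def split: if_splits)
  have A2: "dc_space I F a 0 (Suc q) = ?g ` kchains I a q" for q
  proof (intro set_eqI iffI)
    fix w assume w: "w \<in> dc_space I F a 0 (Suc q)"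
    then have "w = ?g (w 0)" by (auto simp: koszul_emb_def fun_eq_iff)
    moreover have "w 0 \<in> kchains I a q" using w by (auto simp: kchains_def)
    ultimately show "w \<in> ?g ` kchains I a q" by blast
  qed (auto simp: koszul_emb_def kchains_def split: if_splits)
  have H: "dc_h I F a (Suc (Suc p)) 0 (?f v) = ?f (tensor_diff F p v)" for p v
    by (auto simp: tor_emb_def fun_eq_iff)
  have V: "dc_v I F a 0 (Suc (Suc q)) (?g z) = ?g (kdiff I a z)" for q z
    by (auto simp: koszul_emb_def fun_eq_iff)
  have f0: "?f v = 0 \<longleftrightarrow> v = 0" for v by (auto simp: tor_emb_def fun_eq_iff)
  have g0: "?g z = 0 \<longleftrightarrow> z = 0" for z by (auto simp: koszul_emb_def fun_eq_iff)
  have Z: "{x \<in> dc_space I F a (Suc i) 0. dc_h I F a (Suc i) 0 x = 0} = ?f ` tensor_cycles F i a"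
    unfolding A1 tensor_cycles_def by (cases i) (auto simp: H f0 simp del: dc_h.simps(4))
  have B: "dc_h I F a (Suc (Suc i)) 0 ` dc_space I F a (Suc (Suc i)) 0 = ?f ` tensor_boundaries F i a"
    unfolding A1 tensor_boundaries_def image_image H ..
  have Z': "{y \<in> dc_space I F a 0 (Suc i). dc_v I F a 0 (Suc i) y = 0} = ?g ` kcycles I a i"
    unfolding A2 kcycles_def by (cases i) (auto simp: V g0 kdiff_0_chain simp del: dc_v.simps(4))
  have B': "dc_v I F a 0 (Suc (Suc i)) ` dc_space I F a 0 (Suc (Suc i)) = ?g ` kboundaries I a i"
    unfolding A2 kboundaries_def image_image V ..
  obtain R where R: "hom_rel dc_scale dc_scale (?f ` tensor_cycles F i a) (?f ` tensor_boundaries F i a)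
     (?g ` kcycles I a i) (?g ` kboundaries I a i) R"
    using dc.row_column_hom_rel[of i] unfolding Z B Z' B' by blast
  have f_inj: "inj ?f" by (auto simp: inj_def tor_emb_def fun_eq_iff)
  have g_inj: "inj ?g" by (auto simp: inj_def koszul_emb_def fun_eq_iff)
  have f_add: "?f (x + y) = ?f x + ?f y" for x y by (auto simp: tor_emb_def fun_eq_iff)
  have g_add: "?g (x + y) = ?g x + ?g y" for x y by (auto simp: koszul_emb_def fun_eq_iff)
  have f_sc: "?f (\<lambda>b. c * x b) = dc_scale c (?f x)" for c x by (auto simp: tor_emb_def dc_scale_def fun_eq_iff)
  have g_sc: "?g (\<lambda>S. c * x S) = dc_scale c (?g x)" for c x by (auto simp: koszul_emb_def dc_scale_def fun_eq_iff)
  show "\<exists>R. hom_rel (\<lambda>c v b. c * v b) (\<lambda>c z S. c * z S)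
     (tensor_cycles F i a) (tensor_boundaries F i a) (kcycles I a i) (kboundaries I a i) R"
    using hom_rel_transport[where f = ?f and g = ?g and ?s1.0 = "\<lambda>c v b. c * v b" and ?s2.0 = "\<lambda>c z S. c * z S", OF R f_inj f_add f_sc g_inj g_add g_sc] by (rule exI)
  have "?f ` tensor_boundaries F i a \<subseteq> ?f ` tensor_cycles F i a"
    unfolding Z[symmetric] B[symmetric] using dc.dh_mem dc.dh_dh by blast
  then show "tensor_boundaries F i a \<subseteq> tensor_cycles F i a"
    using inj_image_subset_iff[OF f_inj] by blast
qed

section \<open>Dimension of Tor from Koszul homology\<close>

text \<open>
  A family that represents a basis of \<open>Z/B\<close>, together with a basis of \<open>B\<close>, is a basis of \<open>Z\<close>.
\<close>

lemma (in vector_space) dim_quotient_basis: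
  assumes Z: "subspace Z" and B: "subspace B" "B \<subseteq> Z" and fd: "finite U" "Z \<subseteq> span U"
    and J: "finite J" "\<And>j. j \<in> J \<Longrightarrow> z j \<in> Z"
    and indep: "\<And>c. (\<Sum>j\<in>J. c j *s z j) \<in> B \<Longrightarrow> \<forall>j\<in>J. c j = 0"
    and spans: "\<And>x. x \<in> Z \<Longrightarrow> \<exists>c. x - (\<Sum>j\<in>J. c j *s z j) \<in> B"
  shows "dim Z - dim B = card J"
proof -
  obtain E where E: "E \<subseteq> B" "independent E" "B \<subseteq> span E"
    using maximal_independent_subset by blast
  have spE: "span E = B" using E(1,3) B(1) span_minimal by blast
  have fE: "finite E" using independent_span_bound[OF fd(1) E(2)] E(1) B(2) fd(2) by blast
  have *: "independent (E \<union> z ` K) \<and> card (E \<union> z ` K) = card E + card K" if "K \<subseteq> J" for K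
    using finite_subset[OF that J(1)] that
  proof (induction K)
    case empty
    then show ?case using E(2) by simp
  next
    case (insert k K)
    let ?D = "{x. \<exists>b\<in>B. \<exists>c. x = b + (\<Sum>j\<in>K. c j *s z j)}"
    have subD: "subspace ?D"
    proof (rule subspaceI)
      show "0 \<in> ?D"
        using subspace_0[OF B(1)] by (auto intro!: bexI[of _ 0] exI[of _ "\<lambda>_. 0"])
    next
      fix x y assume "x \<in> ?D" "y \<in> ?D"
      then obtain b c b' c' where "b \<in> B" "x = b + (\<Sum>j\<in>K. c j *s z j)"
        "b' \<in> B" "y = b' + (\<Sum>j\<in>K. c' j *s z j)" by blast
      then have "b + b' \<in> B \<and> x + y = (b + b') + (\<Sum>j\<in>K. (c j + c' j) *s z j)"
        using subspace_add[OF B(1)] by (simp add: scale_left_distrib sum.distrib algebra_simps)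
      then show "x + y \<in> ?D"
        by (auto intro!: bexI[of _ "b + b'"] exI[of _ "\<lambda>j. c j + c' j"])
    next
      fix s x assume "x \<in> ?D"
      then obtain b c where "b \<in> B" "x = b + (\<Sum>j\<in>K. c j *s z j)" by blast
      then have "s *s b \<in> B \<and> s *s x = s *s b + (\<Sum>j\<in>K. (s * c j) *s z j)"
        using subspace_scale[OF B(1)] by (simp add: scale_right_distrib scale_sum_right)
      then show "s *s x \<in> ?D"
        by (auto intro!: bexI[of _ "s *s b"] exI[of _ "\<lambda>j. s * c j"])
    qed
    have "E \<union> z ` K \<subseteq> ?D"
    proof (intro Un_least subsetI)
      fix x assume "x \<in> E"
      then show "x \<in> ?D" using E(1) by (auto intro!: bexI[of _ x] exI[of _ "\<lambda>_. 0"])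
    next
      fix x assume "x \<in> z ` K"
      then obtain k' where k': "k' \<in> K" "x = z k'" by blast
      have "(\<Sum>j\<in>K. (if j = k' then 1 else 0) *s z j) = (\<Sum>j\<in>K. if j = k' then z j else 0)"
        by (intro sum.cong) auto
      then have "(\<Sum>j\<in>K. (if j = k' then 1 else 0) *s z j) = x"
        using k' insert.hyps(1) by simp
      then show "x \<in> ?D" using subspace_0[OF B(1)]
        by (auto intro!: bexI[of _ 0] exI[of _ "\<lambda>j. if j = k' then 1 else 0"])
    qed
    then have sub: "span (E \<union> z ` K) \<subseteq> ?D" by (rule span_minimal[OF _ subD])
    have nin: "z k \<notin> span (E \<union> z ` K)"
    proof
      assume "z k \<in> span (E \<union> z ` K)"
      then obtain b c where bc: "b \<in> B" "z k = b + (\<Sum>j\<in>K. c j *s z j)" using sub by blast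
      \<comment> \<open>The coefficients of a nontrivial combination that would lie in \<open>B\<close>.\<close>
      let ?c = "\<lambda>j. if j = k then 1 else if j \<in> K then - c j else 0"
      have "(\<Sum>j\<in>J. ?c j *s z j) = (\<Sum>j\<in>insert k K. ?c j *s z j)"
        using insert.prems J(1) by (intro sum.mono_neutral_right) auto
      also have "\<dots> = z k + (\<Sum>j\<in>K. ?c j *s z j)" using insert.hyps by simp
      also have "(\<Sum>j\<in>K. ?c j *s z j) = (\<Sum>j\<in>K. - (c j *s z j))"
        using insert.hyps(2) by (intro sum.cong) auto
      also have "z k + (\<Sum>j\<in>K. - (c j *s z j)) = b" using bc(2) by (simp add: sum_negf)
      finally have "\<forall>j\<in>J. ?c j = 0" using indep[of ?c] bc(1) by simp
      then show False using insert.prems by auto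
    qed
    have IH: "independent (E \<union> z ` K)" "card (E \<union> z ` K) = card E + card K"
      using insert.IH insert.prems by auto
    have notin: "z k \<notin> E \<union> z ` K" using nin by (rule contrapos_nn) (rule span_base)
    have "independent (insert (z k) (E \<union> z ` K))"
      using nin IH(1) notin by (simp only: independent_insert if_False simp_thms)
    moreover have "card (insert (z k) (E \<union> z ` K)) = Suc (card E + card K)"
      using notin IH(2) fE insert.hyps(1) by simp
    ultimately show ?case using insert.hyps by simp
  qed
  have "dim B = card E" using dim_unique[OF E(1,3,2)] by simp
  moreover have "dim Z = card E + card J"
  proof (rule dim_unique)
    show "E \<union> z ` J \<subseteq> Z" using E(1) B(2) J(2) by blast
    show "independent (E \<union> z ` J)" "card (E \<union> z ` J) = card E + card J" using * by auto
    show "Z \<subseteq> span (E \<union> z ` J)"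
    proof
      fix x assume "x \<in> Z"
      then obtain c where "x - (\<Sum>j\<in>J. c j *s z j) \<in> B" using spans by blast
      then have "x - (\<Sum>j\<in>J. c j *s z j) \<in> span (E \<union> z ` J)"
        using spE span_mono[of E "E \<union> z ` J"] by blast
      moreover have "(\<Sum>j\<in>J. c j *s z j) \<in> span (E \<union> z ` J)"
        by (intro span_sum span_scale span_base) auto
      ultimately show "x \<in> span (E \<union> z ` J)" using span_add by fastforce
    qed
  qed
  ultimately show ?thesis by simp
qed

interpretation fun_space: vector_space "\<lambda>(c::'k::field) (v::nat \<Rightarrow> 'k) b. c * v b"
  by unfold_locales (auto simp: fun_eq_iff algebra_simps)

lemma sum_fun_apply: "(\<Sum>j\<in>J. f j) x = (\<Sum>j\<in>J. f j x)"
  by (induction J rule: infinite_finite_induct) auto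

lemma tensor_comp_subspace:
  fixes F :: "('n, 'k::field) free_complex"
  shows "fun_space.subspace (tensor_comp F i a)"
proof (rule fun_space.subspaceI)
  show "0 \<in> tensor_comp F i a" by (simp add: tensor_comp_def)
  fix x y and c :: 'k assume xy: "x \<in> tensor_comp F i a"
  then show "(\<lambda>b. c * x b) \<in> tensor_comp F i a" by (simp add: tensor_comp_def)
  assume "y \<in> tensor_comp F i a"
  then show "x + y \<in> tensor_comp F i a" using xy unfolding tensor_comp_def
    by (auto simp: plus_fun_apply) (metis add_0)+
qed

lemma tensor_diff_linear:
  fixes F :: "('n, 'k::field) free_complex"
  shows "module_hom (\<lambda>(c::'k) v b. c * v b) (\<lambda>(c::'k) v b. c * v b) (tensor_diff F i)"
  by unfold_locales
    (auto simp: fun_eq_iff algebra_simps tensor_diff_def sum.distrib sum_distrib_left)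

lemma tensor_cycles_subspace:
  fixes F :: "('n, 'k::field) free_complex"
  shows "fun_space.subspace (tensor_cycles F i a)"
proof (cases i)
  case 0
  then show ?thesis using tensor_comp_subspace[of F i a] by (simp add: tensor_cycles_def)
next
  case (Suc i')
  then have "tensor_cycles F i a = tensor_comp F i a \<inter> {v. tensor_diff F i' v = 0}"
    by (auto simp: tensor_cycles_def)
  then show ?thesis
    using fun_space.subspace_inter[OF tensor_comp_subspace module_hom.subspace_kernel[OF tensor_diff_linear]]
    by simp
qed

lemma tensor_boundaries_subspace:
  fixes F :: "('n, 'k::field) free_complex"
  shows "fun_space.subspace (tensor_boundaries F i a)"
  unfolding tensor_boundaries_def
  by (rule module_hom.subspace_image[OF tensor_diff_linear tensor_comp_subspace])

lemma tensor_comp_finite_dim: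
  fixes F :: "('n, 'k::field) free_complex"
  shows "\<exists>U. finite U \<and> tensor_comp F i a \<subseteq> fun_space.span U"
proof (intro exI conjI)
  let ?e = "\<lambda>b c. if c = b then (1::'k) else 0"
  show "finite (?e ` {..<frank F i})" by simp
  show "tensor_comp F i a \<subseteq> fun_space.span (?e ` {..<frank F i})"
  proof
    fix v assume v: "v \<in> tensor_comp F i a"
    have "v = (\<Sum>b<frank F i. (\<lambda>c. v b * ?e b c))"
    proof
      fix c
      have "(\<Sum>b<frank F i. v b * ?e b c) = (\<Sum>b<frank F i. if b = c then v b else 0)"
        by (intro sum.cong) auto
      also have "\<dots> = v c" using v by (auto simp: tensor_comp_def)
      finally show "v c = (\<Sum>b<frank F i. (\<lambda>c. v b * ?e b c)) c" by (simp add: sum_fun_apply)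
    qed
    also have "\<dots> \<in> fun_space.span (?e ` {..<frank F i})"
      by (intro fun_space.span_sum fun_space.span_scale fun_space.span_base) auto
    finally show "v \<in> fun_space.span (?e ` {..<frank F i})" .
  qed
qed

lemma hom_rel_lincomb:
  fixes R :: "((nat \<Rightarrow> 'k::field) \<times> ('s \<Rightarrow> 'k)) set"
  assumes R: "hom_rel (\<lambda>c v b. c * v b) (\<lambda>c z S. c * z S) Z B Z' B' R"
    and "finite J" and "\<And>j. j \<in> J \<Longrightarrow> (v j, k j) \<in> R" and "Z \<noteq> {}"
  shows "((\<Sum>j\<in>J. (\<lambda>b. c j * v j b)), (\<Sum>j\<in>J. (\<lambda>S. c j * k j S))) \<in> R"
  using assms(2,3)
proof (induction J)
  case empty
  obtain z z' where "(z, z') \<in> R" using assms(4) hom_relD(3)[OF R] by blast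
  from hom_relD(7)[OF R this, of 0] have "((\<lambda>b. 0 * z b), (\<lambda>S. 0 * z' S)) \<in> R" .
  then show ?case by (simp add: zero_fun_def)
next
  case (insert i J)
  have "((\<lambda>b. c i * v i b), (\<lambda>S. c i * k i S)) \<in> R"
    using hom_relD(7)[OF R insert.prems[of i]] by simp
  moreover have "((\<Sum>j\<in>J. (\<lambda>b. c j * v j b)), (\<Sum>j\<in>J. (\<lambda>S. c j * k j S))) \<in> R"
    using insert by simp
  ultimately have "((\<lambda>b. c i * v i b) + (\<Sum>j\<in>J. (\<lambda>b. c j * v j b)),
      (\<lambda>S. c i * k i S) + (\<Sum>j\<in>J. (\<lambda>S. c j * k j S))) \<in> R"
    by (rule hom_relD(6)[OF R])
  then show ?case using insert.hyps by (simp only: sum.insert not_False_eq_True)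
qed

lemma tor_zero_if_koszul_exact:
  fixes I :: "('n::{finite,linorder}, 'k::field) mpoly set"
  assumes I: "ideal I" "monomial_ideal I" and ex: "kcycles I a i \<subseteq> kboundaries I a i"
  shows "tor_zero I i a"
proof -
  let ?F = "chosen_resolution I"
  note t = tensor_koszul_hom_rel[OF I(1) chosen_resolution[OF I], of i a]
  obtain R where R: "hom_rel (\<lambda>c v b. c * v b) (\<lambda>c z S. c * z S)
     (tensor_cycles ?F i a) (tensor_boundaries ?F i a) (kcycles I a i) (kboundaries I a i) R"
    using t(1) by blast
  have "tensor_cycles ?F i a \<subseteq> tensor_boundaries ?F i a"
  proof
    fix z assume "z \<in> tensor_cycles ?F i a"
    then obtain z' where z': "(z, z') \<in> R" using hom_relD(3)[OF R] by blast
    then have "z' \<in> kboundaries I a i" using hom_relD(2)[OF R] ex by blast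
    then show "z \<in> tensor_boundaries ?F i a" using hom_relD(5)[OF R z'] by blast
  qed
  then show ?thesis using t(2) by (simp add: tor_zero_def tor_cycles_def tor_boundaries_def antisym)
qed

text \<open>
  Elements corresponding to a basis of Koszul homology represent a basis of \<open>Tor\<close>: a linear
  combination is a boundary on one side exactly if it is one on the other.
\<close>

lemma tor_dim_eq_koszul:
  fixes I :: "('n::{finite,linorder}, 'k::field) mpoly set"
  assumes I: "ideal I" "monomial_ideal I" and J: "finite J" "\<And>j. j \<in> J \<Longrightarrow> k j \<in> kcycles I a i"
    and indep: "\<And>c. (\<Sum>j\<in>J. (\<lambda>S. c j * k j S)) \<in> kboundaries I a i \<Longrightarrow> \<forall>j\<in>J. c j = 0"
    and spans: "\<And>z. z \<in> kcycles I a i \<Longrightarrow> \<exists>c. z - (\<Sum>j\<in>J. (\<lambda>S. c j * k j S)) \<in> kboundaries I a i"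
  shows "tor_dim I i a = card J"
proof -
  let ?F = "chosen_resolution I"
  let ?Z = "tensor_cycles ?F i a" and ?B = "tensor_boundaries ?F i a"
  note t = tensor_koszul_hom_rel[OF I(1) chosen_resolution[OF I], of i a]
  obtain R where R: "hom_rel (\<lambda>c v b. c * v b) (\<lambda>c z S. c * z S) ?Z ?B (kcycles I a i) (kboundaries I a i) R"
    using t(1) by blast
  have ne: "?Z \<noteq> {}" using fun_space.subspace_0[OF tensor_cycles_subspace] by blast
  have "\<forall>j. \<exists>v. j \<in> J \<longrightarrow> (v, k j) \<in> R" using J(2) hom_relD(4)[OF R] by blast
  from choice[OF this] obtain v where v: "\<And>j. j \<in> J \<Longrightarrow> (v j, k j) \<in> R" by blast
  have lin: "((\<Sum>j\<in>J. (\<lambda>b. c j * v j b)), (\<Sum>j\<in>J. (\<lambda>S. c j * k j S))) \<in> R" for c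
    by (rule hom_rel_lincomb[OF R J(1) v ne])
  have iffB: "(x, y) \<in> R \<Longrightarrow> x \<in> ?B \<longleftrightarrow> y \<in> kboundaries I a i" for x y
    by (rule hom_relD(5)[OF R])
  obtain U where U: "finite U" "tensor_comp ?F i a \<subseteq> fun_space.span U"
    using tensor_comp_finite_dim by blast
  have "vdim ?Z - vdim ?B = card J"
  proof (rule fun_space.dim_quotient_basis[where U = U and z = v])
    show "?Z \<subseteq> fun_space.span U" using U(2) by (auto simp: tensor_cycles_def)
    show "v j \<in> ?Z" if "j \<in> J" for j using hom_relD(1)[OF R v[OF that]] .
    show "\<forall>j\<in>J. c j = 0" if "(\<Sum>j\<in>J. (\<lambda>b. c j * v j b)) \<in> ?B" for c
      using indep iffB[OF lin] that by blast
    show "\<exists>c. x - (\<Sum>j\<in>J. (\<lambda>b. c j * v j b)) \<in> ?B" if x: "x \<in> ?Z" for x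
    proof -
      obtain y where y: "(x, y) \<in> R" using hom_relD(3)[OF R x] by blast
      then have "y \<in> kcycles I a i" by (rule hom_relD(2)[OF R])
      then obtain c where c: "y - (\<Sum>j\<in>J. (\<lambda>S. c j * k j S)) \<in> kboundaries I a i"
        using spans by blast
      have "((\<lambda>b. - 1 * (\<Sum>j\<in>J. (\<lambda>b. c j * v j b)) b), (\<lambda>S. - 1 * (\<Sum>j\<in>J. (\<lambda>S. c j * k j S)) S)) \<in> R"
        by (rule hom_relD(7)[OF R lin])
      then have "(x + (\<lambda>b. - 1 * (\<Sum>j\<in>J. (\<lambda>b. c j * v j b)) b),
          y + (\<lambda>S. - 1 * (\<Sum>j\<in>J. (\<lambda>S. c j * k j S)) S)) \<in> R"
        by (rule hom_relD(6)[OF R y])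
      moreover have "x + (\<lambda>b. - 1 * (\<Sum>j\<in>J. (\<lambda>b. c j * v j b)) b) = x - (\<Sum>j\<in>J. (\<lambda>b. c j * v j b))"
        by (rule ext) simp
      moreover have "y + (\<lambda>S. - 1 * (\<Sum>j\<in>J. (\<lambda>S. c j * k j S)) S) = y - (\<Sum>j\<in>J. (\<lambda>S. c j * k j S))"
        by (rule ext) simp
      ultimately have "(x - (\<Sum>j\<in>J. (\<lambda>b. c j * v j b)), y - (\<Sum>j\<in>J. (\<lambda>S. c j * k j S))) \<in> R"
        by (simp only:)
      from iffB[OF this] c show ?thesis by blast
    qed
  qed (fact J(1) U(1) t(2) tensor_cycles_subspace tensor_boundaries_subspace)+
  then show ?thesis by (simp add: tor_dim_def tor_cycles_def tor_boundaries_def)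
qed

section \<open>Koszul homology of cones and skeleta\<close>

lemma cone_map_chain:
  fixes I :: "('n::{finite,linorder}, 'k::field) mpoly set"
  assumes I: "ideal I" and v: "a v \<ge> 1" and z: "z \<in> kchains I a i"
  shows "cone_map v z \<in> kchains I a (Suc i)"
  unfolding kchains_def
proof clarify
  fix S assume "cone_map v z S \<noteq> 0"
  then have S: "v \<in> S" "z (S - {v}) \<noteq> 0" by (auto simp: cone_map_def split: if_splits)
  then have f: "S - {v} \<in> kfaces I a" "card (S - {v}) = i" using z by (auto simp: kchains_def)
  have "0 \<le> lower a S j" for j
    using le_funD[OF kfaces_nonneg[OF f(1)], of j] v by (cases "j = v") (auto simp: lower_def)
  then have "0 \<le> lower a S" by (simp add: le_fun_def)
  then show "S \<in> kfaces I a \<and> card S = Suc i"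
    using kfaces_between[OF I f(1)] card_Suc_Diff1[OF finite S(1)] f(2) by auto
qed

text \<open>
  Coning a cycle with \<open>v\<close> gives a chain that bounds it, up to a term supported on the sets \<open>S\<close>
  containing \<open>v\<close> and given there, up to sign, by the boundary of the cycle at \<open>S - {v}\<close>. The hypothesis makes
  \<open>S - {v}\<close> a face, and there this boundary vanishes.
\<close>

lemma koszul_exact_cone:
  fixes I :: "('n::{finite,linorder}, 'k::field) mpoly set"
  assumes I: "ideal I" and v: "a v \<ge> 1"
    and cone: "\<And>S. S \<in> kfaces I a \<Longrightarrow> card S = i \<Longrightarrow> v \<in> S \<Longrightarrow> S - {v} \<in> kfaces I a"
  shows "kcycles I a i \<subseteq> kboundaries I a i"
proof
  fix z assume "z \<in> kcycles I a i"
  then have z: "z \<in> kchains I a i" "kdiff I a z = 0" by (auto simp: kcycles_def)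
  have "kdiff I a (cone_map v z) S = z S" for S
  proof (cases "S \<in> kfaces I a")
    case True
    have "cone_map v (drop_sum UNIV z) S = 0"
    proof (rule ccontr)
      assume "cone_map v (drop_sum UNIV z) S \<noteq> 0"
      then have S: "v \<in> S" "drop_sum UNIV z (S - {v}) \<noteq> 0" by (auto simp: cone_map_def split: if_splits)
      from S(2) obtain j where j: "j \<in> UNIV - (S - {v})" "z (insert j (S - {v})) \<noteq> 0"
        by (rule drop_sum_nonzero)
      then have "card (insert j (S - {v})) = i" using z(1) by (auto simp: kchains_def)
      then have "card S = i" using j(1) card_Suc_Diff1[OF finite S(1)] by simp
      then have "S - {v} \<in> kfaces I a" using cone True S(1) by blast
      then have "kdiff I a z (S - {v}) \<noteq> 0" using S(2) by (simp add: kdiff_def)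
      then show False using z(2) by simp
    qed
    then show ?thesis using cone_homotopy[of UNIV S v z] True by (simp add: kdiff_def)
  next
    case False
    then have "z S = 0" using z(1) by (auto simp: kchains_def)
    then show ?thesis using False by (simp add: kdiff_def)
  qed
  then have "z = kdiff I a (cone_map v z)" by (intro ext) simp
  then show "z \<in> kboundaries I a i"
    unfolding kboundaries_def using cone_map_chain[OF I v z(1)] by blast
qed

text \<open>
  Passing to complements turns the Koszul complex near position \<open>n - p\<close> into the cochain complex of
  a simplicial complex whose faces of size at least \<open>p\<close> are the \<open>p\<close>-element subsets of \<open>B\<close>. There
  are no larger faces, so all cochains of size \<open>p\<close> are cocycles. The indicators of the faces that
  avoid a fixed \<open>v \<in> B\<close> represent a basis of the quotient by the coboundaries: coning with \<open>v\<close>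
  removes all other faces, and a coboundary supported on faces avoiding \<open>v\<close> is zero, because its
  own coboundary in the full simplex on \<open>B\<close> vanishes and has at \<open>F \<union> {v}\<close>, up to sign, the
  coefficient of \<open>F\<close>.
\<close>

lemma tor_dim_skeleton:
  fixes I :: "('n::{finite,linorder}, 'k::field) mpoly set"
  assumes I: "ideal I" "monomial_ideal I" and v: "v \<in> B" "a v \<ge> 1" and p: "p \<le> CARD('n)"
    and small: "\<And>S. S \<in> kfaces I a \<Longrightarrow> card S \<le> CARD('n) - p \<Longrightarrow> card (- S) = p \<and> - S \<subseteq> B"
    and face: "\<And>S. - S \<subseteq> B \<Longrightarrow> card (- S) = p \<Longrightarrow> S \<in> kfaces I a"
  shows "tor_dim I (CARD('n) - p) a = (card B - 1) choose p"
proof -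
  let ?i = "CARD('n) - p"
  have card_compl: "card (- S) = CARD('n) - card S" for S :: "'n set"
    by (simp add: Compl_eq_Diff_UNIV card_Diff_subset)
  have card_le: "card S \<le> CARD('n)" for S :: "'n set" by (rule card_mono) auto
  have card_iff: "card (- S) = p \<longleftrightarrow> card S = ?i" for S :: "'n set"
    using p card_le[of S] card_compl[of S] by auto
  have cyc: "kcycles I a ?i = kchains I a ?i"
  proof -
    have "kdiff I a z = 0" if z: "z \<in> kchains I a ?i" for z
    proof
      fix T
      show "kdiff I a z T = 0 T"
      proof (rule ccontr)
        assume "kdiff I a z T \<noteq> 0 T"
        then have T: "T \<in> kfaces I a" "drop_sum UNIV z T \<noteq> 0" by (auto simp: kdiff_def split: if_splits)
        from T(2) obtain j where j: "j \<in> UNIV - T" "z (insert j T) \<noteq> 0" by (rule drop_sum_nonzero)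
        then have "card (insert j T) = ?i" using z by (auto simp: kchains_def)
        then have "Suc (card T) = ?i" using j(1) by simp
        then show False using small[OF T(1)] card_iff[of T] by simp
      qed
    qed
    then show ?thesis by (auto simp: kcycles_def)
  qed
  let ?J = "{S. - S \<subseteq> B \<and> card (- S) = p \<and> v \<in> S}"
  let ?k = "\<lambda>S U. if U = S then (1::'k) else 0"
  have comb: "(\<Sum>S\<in>?J. (\<lambda>U. c S * ?k S U)) U = (if U \<in> ?J then c U else 0)" for c U
  proof -
    have "(\<Sum>S\<in>?J. (\<lambda>U. c S * ?k S U)) U = (\<Sum>S\<in>?J. if S = U then c S else 0)"
      unfolding sum_fun_apply by (intro sum.cong) auto
    also have "\<dots> = (if U \<in> ?J then c U else 0)" by (rule sum.delta) simp
    finally show ?thesis .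
  qed
  have "tor_dim I ?i a = card ?J"
  proof (rule tor_dim_eq_koszul[OF I, where k = ?k])
    show "?k S \<in> kcycles I a ?i" if "S \<in> ?J" for S
      unfolding cyc using face that card_iff[of S] by (auto simp: kchains_def)
  next
    fix c assume "(\<Sum>S\<in>?J. (\<lambda>U. c S * ?k S U)) \<in> kboundaries I a ?i"
    then obtain y where y: "(\<Sum>S\<in>?J. (\<lambda>U. c S * ?k S U)) = kdiff I a y"
      unfolding kboundaries_def by blast
    define x where "x = kdiff I a y"
    have x: "x U = (if U \<in> ?J then c U else 0)" for U
      using comb[of c U] unfolding y x_def by simp
    show "\<forall>S\<in>?J. c S = 0"
    proof
      fix S assume S: "S \<in> ?J"
      \<comment> \<open>The boundary of \<open>x\<close> at \<open>S - {v}\<close> vanishes, and only the coefficient of \<open>S\<close> contributes to it.\<close>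
      let ?T = "S - {v}"
      have "x (insert j ?T) = drop_sum UNIV y (insert j ?T)" if j: "j \<in> UNIV - ?T" for j
      proof -
        have "card (insert j ?T) = card S" using j S card_Suc_Diff1[of S v] by simp
        then have "card (- insert j ?T) = p" using S card_compl[of S] card_compl[of "insert j ?T"] by simp
        moreover have "- insert j ?T \<subseteq> B" using S v(1) by auto
        ultimately have "insert j ?T \<in> kfaces I a" using face by blast
        then show ?thesis by (simp add: x_def kdiff_def)
      qed
      then have "drop_sum UNIV x ?T = drop_sum UNIV (drop_sum UNIV y) ?T" by (rule drop_sum_cong)
      then have 0: "drop_sum UNIV x ?T = 0" by (simp add: drop_sum_drop_sum)
      have "drop_sum UNIV x ?T = (\<Sum>j\<in>UNIV - ?T. if j = v then sg v ?T * x S else 0)"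
        unfolding drop_sum_def
      proof (intro sum.cong refl)
        fix j assume j: "j \<in> UNIV - ?T"
        show "sg j ?T * x (insert j ?T) = (if j = v then sg v ?T * x S else 0)"
        proof (cases "j = v")
          case True
          then show ?thesis using S by (simp add: insert_absorb)
        next
          case False
          then have "insert j ?T \<notin> ?J" by auto
          then have "x (insert j ?T) = 0" by (simp only: x if_False)
          then show ?thesis using False by simp
        qed
      qed
      also have "\<dots> = sg v ?T * x S" by (simp add: sum.delta)
      finally have "sg v ?T * x S = 0" using 0 by simp
      then have "sg v ?T * (sg v ?T * x S) = 0" by simp
      then have "x S = 0" unfolding mult.assoc[symmetric] by (simp del: sg_remove_self)
      then show "c S = 0" using x[of S] S by simp
    qed
  next
    fix z assume "z \<in> kcycles I a ?i"
    then have z: "z \<in> kchains I a ?i" by (simp add: cyc)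
    have y: "cone_map v z \<in> kchains I a (Suc ?i)" by (rule cone_map_chain[OF I(1) v(2) z])
    define c where "c = z - kdiff I a (cone_map v z)"
    have "(z - (\<Sum>S\<in>?J. (\<lambda>U. c S * ?k S U))) U = kdiff I a (cone_map v z) U" for U
    proof (cases "U \<in> ?J")
      case True
      then show ?thesis unfolding fun_diff_def comb c_def by simp
    next
      case False
      have "z U = kdiff I a (cone_map v z) U"
      proof (cases "U \<in> kfaces I a \<and> card U = ?i")
        case True
        then have "v \<notin> U" using False small[of U] by auto
        then show ?thesis using True cone_homotopy[of UNIV U v z] by (simp add: kdiff_def cone_map_def[of v "drop_sum UNIV z"])
      next
        case False
        then have "z U = 0" using z by (auto simp: kchains_def)
        moreover have "kdiff I a (cone_map v z) U = 0"
          using kdiff_chain[OF y] False by (auto simp: kchains_def)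
        ultimately show ?thesis by simp
      qed
      then show ?thesis unfolding fun_diff_def comb if_not_P[OF False] by simp
    qed
    then have "z - (\<Sum>S\<in>?J. (\<lambda>U. c S * ?k S U)) = kdiff I a (cone_map v z)" by (rule ext)
    then show "\<exists>c. z - (\<Sum>S\<in>?J. (\<lambda>U. c S * ?k S U)) \<in> kboundaries I a ?i"
      unfolding kboundaries_def using y by blast
  qed simp
  also have "card ?J = card {F. F \<subseteq> B - {v} \<and> card F = p}"
  proof (rule bij_betw_same_card)
    show "bij_betw uminus ?J {F. F \<subseteq> B - {v} \<and> card F = p}"
      by (rule bij_betw_byWitness[where f' = uminus]) auto
  qed
  also have "\<dots> = (card B - 1) choose p"
    using n_subsets[of "B - {v}" p] v(1) by simp
  finally show ?thesis .
qed

section \<open>Permuting variables\<close>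

lemma lookup_map_key:
  assumes "bij \<sigma>"
  shows "lookup (map_key \<sigma> m) j = lookup m (\<sigma> j)"
  using assms by (simp add: map_key.rep_eq bij_is_inj)

lemma map_key_inv:
  assumes "bij \<sigma>"
  shows "map_key \<sigma> (map_key (inv \<sigma>) m) = m"
    and "map_key (inv \<sigma>) (map_key \<sigma> m) = m"
  using assms
  by (auto intro!: poly_mapping_eqI simp: lookup_map_key bij_imp_bij_inv bij_is_inj bij_is_surj inv_f_f surj_f_inv_f)

lemma mdeg_map_key: "bij \<sigma> \<Longrightarrow> mdeg (map_key \<sigma> m) = mdeg m \<circ> \<sigma>"
  by (auto simp: mdeg_def lookup_map_key)

lemma lookup_permute_vars:
  assumes "bij \<sigma>"
  shows "lookup (permute_vars \<sigma> f) m = lookup f (map_key \<sigma> m)"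
proof -
  have "map_key (inv \<sigma>) m' = m \<longleftrightarrow> m' = map_key \<sigma> m" for m'
    using map_key_inv[OF assms] by metis
  then have "lookup (permute_vars \<sigma> f) m =
      (\<Sum>m'\<in>keys f. if m' = map_key \<sigma> m then lookup f m' else 0)"
    unfolding permute_vars_def lookup_sum by (intro sum.cong refl) (simp add: lookup_single when_def)
  then show ?thesis by (simp add: in_keys_iff)
qed

lemma permute_vars_image_keys:
  assumes "bij \<sigma>"
  shows "permute_vars \<sigma> ` {f. keys f \<subseteq> U} =
    {f. \<forall>m\<in>keys f. map_key \<sigma> m \<in> U}"
proof (intro set_eqI iffI)
  fix f :: "('a, 'b) mpoly"
  assume "f \<in> permute_vars \<sigma> ` {f. keys f \<subseteq> U}"
  then show "f \<in> {f. \<forall>m\<in>keys f. map_key \<sigma> m \<in> U}"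
    by (auto simp: in_keys_iff lookup_permute_vars[OF assms] subset_iff)
next
  fix f :: "('a, 'b) mpoly"
  assume f: "f \<in> {f. \<forall>m\<in>keys f. map_key \<sigma> m \<in> U}"
  let ?g = "permute_vars (inv \<sigma>) f"
  have inv: "bij (inv \<sigma>)" using assms by (rule bij_imp_bij_inv)
  have "f = permute_vars \<sigma> ?g"
    by (rule poly_mapping_eqI) (simp add: lookup_permute_vars[OF assms] lookup_permute_vars[OF inv] map_key_inv[OF assms])
  moreover have "keys ?g \<subseteq> U"
  proof
    fix m assume "m \<in> keys ?g"
    then have "map_key (inv \<sigma>) m \<in> keys f"
      by (simp add: in_keys_iff lookup_permute_vars[OF inv])
    then have "map_key \<sigma> (map_key (inv \<sigma>) m) \<in> U" using f by blast
    then show "m \<in> U" by (simp add: map_key_inv[OF assms])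
  qed
  ultimately show "f \<in> permute_vars \<sigma> ` {f. keys f \<subseteq> U}" by blast
qed

lemma standard_permute:
  fixes I :: "('n::finite, 'k::field) mpoly set"
  assumes inv: "perm_invariant I" and \<sigma>: "bij \<sigma>" and a: "a \<in> standard I"
  shows "a \<circ> \<sigma> \<in> standard I"
proof -
  have "monomial (expo (a \<circ> \<sigma>)) \<notin> I"
  proof
    assume "monomial (expo (a \<circ> \<sigma>)) \<in> I"
    then have "permute_vars \<sigma> (monomial (expo (a \<circ> \<sigma>)) :: ('n, 'k) mpoly) \<in> I"
      using inv \<sigma> unfolding perm_invariant_def by blast
    moreover have "permute_vars \<sigma> (monomial (expo (a \<circ> \<sigma>)) :: ('n, 'k) mpoly) =
        monomial (map_key (inv \<sigma>) (expo (a \<circ> \<sigma>)))"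
      by (simp add: permute_vars_def monomial_def)
    moreover have "map_key (inv \<sigma>) (expo (a \<circ> \<sigma>)) = expo a"
      by (rule poly_mapping_eqI)
        (simp add: lookup_map_key[OF bij_imp_bij_inv[OF \<sigma>]] bij_is_surj[OF \<sigma>] surj_f_inv_f)
    ultimately show False using a by (simp add: standard_def)
  qed
  then show ?thesis using a by (simp add: standard_def le_fun_def)
qed

section \<open>Irreducible components and dual generators\<close>

text \<open>
  The monomial with exponent vector \<open>a\<close> is outside the irreducible ideal given by \<open>\<mu>\<close>.
\<close>

definition fits :: "('n \<Rightarrow> int) \<Rightarrow> ('n \<Rightarrow> enat) \<Rightarrow> bool"
  where "fits a \<mu> \<longleftrightarrow> (\<forall>j. enat (nat (a j)) \<le> \<mu> j)"

text \<open>
  The decomposition \<open>I = \<Inter> Q_\<mu>\<close>, expressed through the monomials outside \<open>I\<close>.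
\<close>

definition covers :: "('n \<Rightarrow> int) set \<Rightarrow> ('n \<Rightarrow> enat) set \<Rightarrow> bool"
  where "covers S L \<longleftrightarrow> (\<forall>a. a \<in> S \<longleftrightarrow> 0 \<le> a \<and> (\<exists>\<mu>\<in>L. \<exists>\<sigma>. bij \<sigma> \<and> fits a (\<mu> \<circ> \<sigma>)))"

lemma fits_mono: "fits a \<mu> \<Longrightarrow> \<mu> \<le> \<nu> \<Longrightarrow> fits a \<nu>"
  unfolding fits_def by (meson le_funD order_trans)

lemma fits_comp: "fits a \<mu> \<Longrightarrow> fits (a \<circ> \<sigma>) (\<mu> \<circ> \<sigma>)"
  by (simp add: fits_def)

lemma comp_inv_bij: "bij \<sigma> \<Longrightarrow> f \<circ> \<sigma> \<circ> inv \<sigma> = f"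
  by (simp add: fun_eq_iff bij_is_surj surj_f_inv_f)

lemma comp_inv_bij': "bij \<sigma> \<Longrightarrow> f \<circ> inv \<sigma> \<circ> \<sigma> = f"
  by (simp add: fun_eq_iff bij_is_inj)

text \<open>
  A monomial avoids the ideal generated by the powers \<open>x_j^(\<mu>_j + 1)\<close> exactly if its exponent
  vector lies in the box below \<open>\<mu>\<close>, and membership in an intersection of monomial ideals is decided
  monomial by monomial.
\<close>

lemma Q_ideal_iff:
  fixes f :: "('n, 'k::field) mpoly"
  shows "f \<in> Q_ideal \<mu> \<longleftrightarrow> (\<forall>m\<in>keys f. \<forall>\<sigma>. bij \<sigma> \<longrightarrow> \<not> fits (mdeg m) (\<mu> \<circ> \<sigma>))"
proof -
  let ?M = "{single j (the_enat (\<mu> j) + 1) | j. \<mu> j \<noteq> \<infinity>}"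
  have upper: "m \<in> upper ?M \<longleftrightarrow> \<not> fits (mdeg m) \<mu>" for m
  proof
    assume "m \<in> upper ?M"
    then obtain j l where j: "\<mu> j \<noteq> \<infinity>" "m = single j (the_enat (\<mu> j) + 1) + l"
      unfolding upper_def by blast
    from j(1) obtain d where "\<mu> j = enat d" by (cases "\<mu> j") auto
    with j(2) have "\<not> enat (nat (mdeg m j)) \<le> \<mu> j" by (simp add: mdeg_def lookup_add)
    then show "\<not> fits (mdeg m) \<mu>" unfolding fits_def by blast
  next
    assume "\<not> fits (mdeg m) \<mu>"
    then obtain j where j: "\<not> enat (nat (mdeg m j)) \<le> \<mu> j" unfolding fits_def by blast
    then obtain d where d: "\<mu> j = enat d" by (cases "\<mu> j") auto
    let ?s = "single j (d + 1)"
    have le: "lookup ?s i \<le> lookup m i" for i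
      using j d by (auto simp: mdeg_def lookup_single when_def)
    have "m = ?s + (m - ?s)"
      by (rule poly_mapping_eqI) (use le in \<open>simp add: lookup_add lookup_minus\<close>)
    then show "m \<in> upper ?M" unfolding upper_def using d by force
  qed
  have gens: "{monomial (single j (the_enat (\<mu> j) + 1)) | j. \<mu> j \<noteq> \<infinity>} = (monomial ` ?M :: ('n, 'k) mpoly set)"
    by blast
  have "f \<in> Q_ideal \<mu> \<longleftrightarrow> (\<forall>\<sigma>. bij \<sigma> \<longrightarrow>
      f \<in> permute_vars \<sigma> ` {f. keys f \<subseteq> upper ?M})"
    unfolding Q_ideal_def gens ideal_gen_monomials by blast
  also have "\<dots> \<longleftrightarrow> (\<forall>\<sigma>. bij \<sigma> \<longrightarrow> (\<forall>m\<in>keys f. \<not> fits (mdeg m \<circ> \<sigma>) \<mu>))"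
  proof -
    have "f \<in> permute_vars \<sigma> ` {f. keys f \<subseteq> upper ?M} \<longleftrightarrow>
        (\<forall>m\<in>keys f. \<not> fits (mdeg m \<circ> \<sigma>) \<mu>)" if "bij \<sigma>" for \<sigma>
      unfolding permute_vars_image_keys[OF that] mem_Collect_eq upper mdeg_map_key[OF that] ..
    then show ?thesis by blast
  qed
  also have "\<dots> \<longleftrightarrow> (\<forall>m\<in>keys f. \<forall>\<sigma>. bij \<sigma> \<longrightarrow> \<not> fits (mdeg m) (\<mu> \<circ> \<sigma>))"
  proof -
    have "fits (mdeg m \<circ> \<sigma>) \<mu> \<longleftrightarrow> fits (mdeg m) (\<mu> \<circ> inv \<sigma>)" if "bij \<sigma>" for \<sigma> m
      using fits_comp[of "mdeg m \<circ> \<sigma>" \<mu> "inv \<sigma>"] fits_comp[of "mdeg m" "\<mu> \<circ> inv \<sigma>" \<sigma>]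
      by (auto simp: comp_inv_bij[OF that] comp_inv_bij'[OF that])
    then show ?thesis by (metis bij_imp_bij_inv inv_inv_eq)
  qed
  finally show ?thesis .
qed

lemma intersection_iff_covers:
  fixes I :: "('n::finite, 'k::field) mpoly set"
  assumes "monomial_ideal I"
  shows "I = (\<Inter>\<mu>\<in>L. Q_ideal \<mu>) \<longleftrightarrow> covers (standard I) L"
proof -
  let ?c = "\<lambda>a. \<exists>\<mu>\<in>L. \<exists>\<sigma>. bij \<sigma> \<and> fits a (\<mu> \<circ> \<sigma>)"
  have Q: "f \<in> (\<Inter>\<mu>\<in>L. Q_ideal \<mu>) \<longleftrightarrow> (\<forall>m\<in>keys f. \<not> ?c (mdeg m))" for f :: "('n, 'k) mpoly"
    unfolding INT_iff Q_ideal_iff by blast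
  show ?thesis
  proof
    assume eq: "I = (\<Inter>\<mu>\<in>L. Q_ideal \<mu>)"
    have "monomial m \<in> I \<longleftrightarrow> \<not> ?c (mdeg m)" for m
      unfolding eq Q by (simp add: monomial_def)
    then have "a \<in> standard I \<longleftrightarrow> 0 \<le> a \<and> ?c a" for a
      unfolding standard_def mem_Collect_eq using mdeg_expo by metis
    then show "covers (standard I) L" unfolding covers_def by blast
  next
    assume c: "covers (standard I) L"
    have "monomial m \<in> I \<longleftrightarrow> \<not> ?c (mdeg m)" for m
    proof -
      have "mdeg m \<in> standard I \<longleftrightarrow> ?c (mdeg m)"
        using c[unfolded covers_def, rule_format, of "mdeg m"] mdeg_nonneg by blast
      then show ?thesis unfolding standard_def mem_Collect_eq expo_mdeg using mdeg_nonneg by blast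
    qed
    then have "f \<in> I \<longleftrightarrow> f \<in> (\<Inter>\<mu>\<in>L. Q_ideal \<mu>)" for f
      unfolding monomial_ideal_keys[OF assms, of f] Q by blast
    then show "I = (\<Inter>\<mu>\<in>L. Q_ideal \<mu>)" by blast
  qed
qed

text \<open>
  If \<open>g j < f j\<close>, monotonicity forces \<open>i < j\<close> whenever \<open>\<tau> i \<le> j\<close>. So \<open>inv \<tau>\<close> maps the initial segment
  up to \<open>j\<close> into the strictly smaller one before \<open>j\<close>, which is impossible.
\<close>

lemma le_of_permuted_le:
  fixes f g :: "'n::{finite,linorder} \<Rightarrow> 'a::linorder"
  assumes f: "antimono f" and g: "antimono g" and \<tau>: "bij \<tau>" and le: "\<And>j. f (\<tau> j) \<le> g j"
  shows "f \<le> g"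
proof (rule le_funI, rule ccontr)
  fix j assume "\<not> f j \<le> g j"
  then have gt: "g j < f j" by simp
  have "i < j" if "\<tau> i \<le> j" for i
  proof (rule ccontr)
    assume "\<not> i < j"
    then have "g i \<le> g j" using antimonoD[OF g] by simp
    also have "g j < f j" by (rule gt)
    also have "f j \<le> f (\<tau> i)" using antimonoD[OF f that] .
    also have "f (\<tau> i) \<le> g i" by (rule le)
    finally show False by simp
  qed
  then have "inv \<tau> ` {..j} \<subseteq> {..<j}"
    using \<tau> by (auto simp: bij_is_surj surj_f_inv_f)
  then have "card (inv \<tau> ` {..j}) \<le> card {..<j}" by (intro card_mono) auto
  moreover have "card (inv \<tau> ` {..j}) = card {..j}"
    using bij_imp_bij_inv[OF \<tau>] by (intro card_image) (auto simp: bij_def inj_on_def)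
  moreover have "card {..<j} < card {..j}" by (intro psubset_card_mono) auto
  ultimately show False by simp
qed

text \<open>
  Send the element of rank \<open>i\<close> to the \<open>i\<close>-th entry of the list of all elements sorted by
  decreasing value of \<open>f\<close>.
\<close>

lemma exists_sorting_perm:
  fixes f :: "'n::{finite,linorder} \<Rightarrow> 'a::linorder"
  shows "\<exists>\<sigma>::'n \<Rightarrow> 'n. bij \<sigma> \<and> antimono (f \<circ> \<sigma>)"
proof -
  define idx where "idx x = card {y::'n. y < x}" for x
  define zs where "zs = sort_key f (sorted_list_of_set (UNIV :: 'n set))"
  let ?ys = "rev zs"
  have zs: "distinct zs" "set zs = UNIV" "sorted (map f zs)"
    by (simp_all add: zs_def)
  then have len: "length zs = CARD('n)" using distinct_card by fastforce
  have idx_mono: "idx x < idx y" if "x < y" for x y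
    unfolding idx_def using that by (intro psubset_card_mono) auto
  have "inj idx" by (rule injI) (metis idx_mono less_irrefl neqE)
  have "idx x < CARD('n)" for x
    unfolding idx_def by (intro psubset_card_mono) auto
  then have "idx ` UNIV = {..<CARD('n)}"
    using card_image[OF \<open>inj idx\<close>] by (intro card_subset_eq) auto
  then have "bij_betw idx UNIV {..<length ?ys}" using \<open>inj idx\<close> len by (simp add: bij_betw_def)
  moreover have "bij_betw ((!) ?ys) {..<length ?ys} UNIV"
    using bij_betw_nth[of ?ys "{..<length ?ys}" UNIV] zs by simp
  ultimately have "bij ((!) ?ys \<circ> idx)" by (rule bij_betw_trans)
  moreover have "antimono (f \<circ> ((!) ?ys \<circ> idx))"
  proof (rule antimonoI)
    fix x y :: 'n assume "x \<le> y"
    then have "idx x \<le> idx y" using idx_mono by (metis le_less)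
    moreover have "idx y < length zs" using \<open>\<And>x. idx x < CARD('n)\<close> len by simp
    ultimately have "f (zs ! (length zs - Suc (idx y))) \<le> f (zs ! (length zs - Suc (idx x)))"
      using sorted_nth_mono[OF zs(3), of "length zs - Suc (idx y)" "length zs - Suc (idx x)"] by simp
    then show "(f \<circ> ((!) ?ys \<circ> idx)) y \<le> (f \<circ> ((!) ?ys \<circ> idx)) x"
      using \<open>idx y < length zs\<close> \<open>idx x \<le> idx y\<close> by (simp add: rev_nth)
  qed
  ultimately show ?thesis by (intro exI conjI)
qed

text \<open>
  Test the covering on one vector: the finite entries of \<open>\<mu>\<close>, with each \<open>\<infinity>\<close> replaced by a number
  larger than all finite entries of the finitely many \<open>\<nu>\<close>. A permutation of some \<open>\<nu>\<close> bounding this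
  vector must be infinite wherever \<open>\<mu>\<close> is.
\<close>

lemma component_below_component:
  fixes \<mu> :: "'n::{finite,linorder} \<Rightarrow> enat"
  assumes L: "finite L" "L \<subseteq> dual_partitions" and \<mu>: "\<mu> \<in> dual_partitions"
    and cov: "\<And>a. 0 \<le> a \<Longrightarrow> fits a \<mu> \<Longrightarrow> \<exists>\<nu>\<in>L. \<exists>\<sigma>. bij \<sigma> \<and> fits a (\<nu> \<circ> \<sigma>)"
  shows "\<exists>\<nu>\<in>L. \<mu> \<le> \<nu>"
proof -
  have "finite (the_enat ` (\<Union>\<nu>\<in>L. range \<nu>))" using L(1) by simp
  then obtain N where N: "\<forall>d\<in>the_enat ` (\<Union>\<nu>\<in>L. range \<nu>). d < N"
    unfolding finite_nat_set_iff_bounded by (elim exE)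
  \<comment> \<open>The test vector: a finite stand-in for \<open>\<mu>\<close>.\<close>
  define a where "a j = (case \<mu> j of enat d \<Rightarrow> int d | \<infinity> \<Rightarrow> int N)" for j
  have "0 \<le> a" by (auto simp: a_def le_fun_def split: enat.split)
  moreover have "fits a \<mu>" by (auto simp: a_def fits_def split: enat.split)
  ultimately obtain \<nu> \<sigma> where \<nu>: "\<nu> \<in> L" "bij \<sigma>" "fits a (\<nu> \<circ> \<sigma>)" using cov by blast
  have "\<mu> j \<le> \<nu> (\<sigma> j)" for j
  proof (cases "\<mu> j")
    case (enat d)
    then show ?thesis using \<nu>(3) unfolding fits_def a_def by (auto dest!: spec[of _ j])
  next
    case infinity
    then have "enat N \<le> \<nu> (\<sigma> j)" using \<nu>(3) unfolding fits_def a_def by (auto dest!: spec[of _ j])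
    moreover have "the_enat (\<nu> (\<sigma> j)) < N" using N \<nu>(1) by blast
    ultimately show ?thesis by (cases "\<nu> (\<sigma> j)") auto
  qed
  then have "\<mu> (inv \<sigma> j) \<le> \<nu> j" for j using \<nu>(2) by (metis bij_is_surj surj_f_inv_f)
  then have "\<mu> \<le> \<nu>"
    using le_of_permuted_le[of \<mu> \<nu> "inv \<sigma>"] bij_imp_bij_inv[OF \<nu>(2)] \<mu> L(2) \<nu>(1)
    unfolding dual_partitions_def by blast
  then show ?thesis using \<nu>(1) by blast
qed

definition irredundant_cover :: "('n::linorder \<Rightarrow> int) set \<Rightarrow> ('n \<Rightarrow> enat) set \<Rightarrow> bool"
  where "irredundant_cover S L \<longleftrightarrow> finite L \<and> L \<subseteq> dual_partitions \<and> covers S L \<and>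
    (\<forall>\<mu>\<in>L. \<not> covers S (L - {\<mu>}))"

lemma covers_component:
  assumes "covers S L" "\<mu> \<in> L" "0 \<le> a" "fits a \<mu>"
  shows "a \<in> S"
  using assms bij_id unfolding covers_def by (metis comp_id)

text \<open>
  A component below another one could be dropped.
\<close>

lemma irredundant_cover_antichain:
  assumes L: "irredundant_cover S L" and \<mu>\<nu>: "\<mu> \<in> L" "\<nu> \<in> L" "\<mu> \<le> \<nu>"
  shows "\<mu> = \<nu>"
proof (rule ccontr)
  assume ne: "\<mu> \<noteq> \<nu>"
  have eq: "(\<exists>\<kappa>\<in>L. \<exists>\<sigma>. bij \<sigma> \<and> fits a (\<kappa> \<circ> \<sigma>)) \<longleftrightarrow> (\<exists>\<kappa>\<in>L - {\<mu>}. \<exists>\<sigma>. bij \<sigma> \<and> fits a (\<kappa> \<circ> \<sigma>))" for a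
  proof
    assume "\<exists>\<kappa>\<in>L. \<exists>\<sigma>. bij \<sigma> \<and> fits a (\<kappa> \<circ> \<sigma>)"
    then obtain \<kappa> \<sigma> where \<kappa>: "\<kappa> \<in> L" "bij \<sigma>" "fits a (\<kappa> \<circ> \<sigma>)" by blast
    have "\<mu> \<circ> \<sigma> \<le> \<nu> \<circ> \<sigma>" using \<mu>\<nu>(3) by (simp add: le_fun_def)
    then have "\<kappa> = \<mu> \<Longrightarrow> fits a (\<nu> \<circ> \<sigma>)" using \<kappa>(3) fits_mono by blast
    then show "\<exists>\<kappa>\<in>L - {\<mu>}. \<exists>\<sigma>. bij \<sigma> \<and> fits a (\<kappa> \<circ> \<sigma>)"
      using \<kappa> \<mu>\<nu>(2) ne by (cases "\<kappa> = \<mu>") auto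
  qed blast
  have "covers S L" using L unfolding irredundant_cover_def by blast
  then have "covers S (L - {\<mu>})" unfolding covers_def eq .
  then show False using L \<mu>\<nu>(1) unfolding irredundant_cover_def by blast
qed

text \<open>
  Each \<open>\<mu> \<in> L\<close> lies below some \<open>\<nu> \<in> L'\<close>, which lies below some element of \<open>L\<close>; as \<open>L\<close> is an
  antichain, the chain collapses.
\<close>

lemma irredundant_cover_subset:
  fixes S :: "('n::{finite,linorder} \<Rightarrow> int) set"
  assumes L: "irredundant_cover S L" and L': "irredundant_cover S L'"
  shows "L \<subseteq> L'"
proof
  have below: "\<exists>\<nu>\<in>B. \<mu> \<le> \<nu>" if "irredundant_cover S A" "irredundant_cover S B" "\<mu> \<in> A" for A B \<mu>
  proof (rule component_below_component)
    show "finite B" "B \<subseteq> dual_partitions" "\<mu> \<in> dual_partitions"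
      using that unfolding irredundant_cover_def by auto
    fix a assume "0 \<le> a" "fits a \<mu>"
    then have "a \<in> S" using covers_component that unfolding irredundant_cover_def by blast
    then show "\<exists>\<nu>\<in>B. \<exists>\<sigma>. bij \<sigma> \<and> fits a (\<nu> \<circ> \<sigma>)"
      using that(2) unfolding irredundant_cover_def covers_def by blast
  qed
  fix \<mu> assume \<mu>: "\<mu> \<in> L"
  obtain \<nu> where \<nu>: "\<nu> \<in> L'" "\<mu> \<le> \<nu>" using below[OF L L' \<mu>] by blast
  obtain \<kappa> where \<kappa>: "\<kappa> \<in> L" "\<nu> \<le> \<kappa>" using below[OF L' L \<nu>(1)] by blast
  have "\<mu> = \<kappa>" using irredundant_cover_antichain[OF L \<mu> \<kappa>(1)] \<nu>(2) \<kappa>(2) by (meson order_trans)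
  then show "\<mu> \<in> L'" using \<nu> \<kappa>(2) by (metis antisym)
qed

text \<open>
  Take the maximal boxes of standard monomials and keep those that are sorted. Maximal boxes exist
  because a box stays inside the standard monomials when its entries of size at least \<open>N\<close> are raised
  to \<open>\<infinity>\<close>, provided that \<open>N\<close> exceeds all exponents of a finite generating set; so only finitely
  many boxes compete. As \<open>I\<close> is not zero, no maximal box is infinite in all directions.
\<close>

lemma irredundant_cover_exists:
  fixes I :: "('n::{finite,linorder}, 'k::field) mpoly set"
  assumes I: "ideal I" "monomial_ideal I" "perm_invariant I" "I \<noteq> {0}"
  shows "\<exists>L. irredundant_cover (standard I) L"
proof -
  obtain r g where g: "\<And>a. a \<in> standard I \<longleftrightarrow> 0 \<le> a \<and> (\<forall>k<(r::nat). \<not> g k \<le> a)"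
    using standard_finitely_determined[OF I(1)] by metis
  have "finite ((\<lambda>(k, j). nat (g k j)) ` ({..<r} \<times> UNIV))" by simp
  then obtain N where bound: "\<forall>d\<in>(\<lambda>(k, j). nat (g k j)) ` ({..<r} \<times> UNIV). d < N"
    unfolding finite_nat_set_iff_bounded by (elim exE)
  have N: "nat (g k j) < N" if "k < r" for k j
  proof -
    have "(\<lambda>(k, j). nat (g k j)) (k, j) \<in> (\<lambda>(k, j). nat (g k j)) ` ({..<r} \<times> UNIV)"
      by (rule imageI) (simp add: that)
    then show ?thesis using bound by auto
  qed
  define W where "W = {c :: 'n \<Rightarrow> enat. \<forall>a. 0 \<le> a \<longrightarrow> fits a c \<longrightarrow> a \<in> standard I}"
  define V where "V = {c \<in> W. \<forall>j. c j = \<infinity> \<or> c j < enat N}"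
  define M where "M = {c \<in> V. \<forall>c'\<in>V. c \<le> c' \<longrightarrow> c = c'}"
  define L where "L = {c \<in> M. antimono c}"
  have "finite V"
  proof (rule finite_subset)
    let ?B = "insert \<infinity> (enat ` {..<N})"
    show "V \<subseteq> {f. \<forall>x. (x \<in> UNIV \<longrightarrow> f x \<in> ?B) \<and> (x \<notin> UNIV \<longrightarrow> f x = 0)}"
    proof
      fix c assume c: "c \<in> V"
      have "c x \<in> ?B" for x using c by (cases "c x") (auto simp: V_def dest!: spec[of _ x])
      then show "c \<in> {f. \<forall>x. (x \<in> UNIV \<longrightarrow> f x \<in> ?B) \<and> (x \<notin> UNIV \<longrightarrow> f x = 0)}" by simp
    qed
    show "finite {f. \<forall>x. (x \<in> (UNIV :: 'n set) \<longrightarrow> f x \<in> ?B) \<and> (x \<notin> UNIV \<longrightarrow> f x = 0)}"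
      by (rule finite_set_of_finite_funs) auto
  qed
  have std_perm: "a \<circ> \<sigma> \<in> standard I \<longleftrightarrow> a \<in> standard I" if "bij \<sigma>" for a \<sigma>
    using standard_permute[OF I(3) that, of a]
      standard_permute[OF I(3) bij_imp_bij_inv[OF that], of "a \<circ> \<sigma>"] comp_inv_bij[OF that] by metis
  have V_perm: "c \<circ> \<sigma> \<in> V" if c: "c \<in> V" and \<sigma>: "bij \<sigma>" for c \<sigma>
  proof -
    have "a \<in> standard I" if a: "0 \<le> a" "fits a (c \<circ> \<sigma>)" for a
    proof -
      have "fits (a \<circ> inv \<sigma>) c" using fits_comp[OF a(2), of "inv \<sigma>"] by (simp add: comp_inv_bij[OF \<sigma>])
      moreover have "0 \<le> a \<circ> inv \<sigma>" using a(1) by (simp add: le_fun_def)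
      ultimately have "a \<circ> inv \<sigma> \<in> standard I" using c unfolding V_def W_def by blast
      then show ?thesis using std_perm[OF bij_imp_bij_inv[OF \<sigma>]] by blast
    qed
    then show ?thesis using c unfolding V_def W_def by auto
  qed
  have M_perm: "c \<circ> \<sigma> \<in> M" if c: "c \<in> M" and \<sigma>: "bij \<sigma>" for c \<sigma>
  proof -
    have "c \<circ> \<sigma> = c'" if c': "c' \<in> V" "c \<circ> \<sigma> \<le> c'" for c'
    proof -
      have "(c \<circ> \<sigma>) (inv \<sigma> j) \<le> c' (inv \<sigma> j)" for j using c'(2) by (rule le_funD)
      then have "c \<le> c' \<circ> inv \<sigma>" using \<sigma> by (simp add: le_fun_def bij_is_surj surj_f_inv_f)
      then have "c = c' \<circ> inv \<sigma>" using c V_perm[OF c'(1) bij_imp_bij_inv[OF \<sigma>]] unfolding M_def by blast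
      then show ?thesis using comp_inv_bij'[OF \<sigma>] by metis
    qed
    then show ?thesis using c V_perm[OF _ \<sigma>] unfolding M_def by blast
  qed
  have V_box: "\<exists>c\<in>V. fits a c" if a: "a \<in> standard I" for a
  proof -
    \<comment> \<open>The largest box around \<open>a\<close> with the same small entries.\<close>
    define c where "c j = (if nat (a j) < N then enat (nat (a j)) else \<infinity>)" for j
    have "a' \<in> standard I" if a': "0 \<le> a'" "fits a' c" for a'
    proof -
      have "\<not> g k \<le> a'" if k: "k < r" for k
      proof
        assume gk: "g k \<le> a'"
        have "g k j \<le> a j" for j
        proof (cases "nat (a j) < N")
          case True
          then have "nat (a' j) \<le> nat (a j)"
            using a'(2) unfolding fits_def c_def by (auto dest!: spec[of _ j])
          then show ?thesis using le_funD[OF gk, of j] le_funD[OF a'(1), of j] a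
            by (auto simp: standard_def le_fun_def dest!: spec[of _ j])
        next
          case False
          then show ?thesis using N[OF k, of j] by linarith
        qed
        then have "g k \<le> a" by (rule le_funI)
        then show False using a g k by blast
      qed
      then show ?thesis using g a'(1) by blast
    qed
    then have "c \<in> V" unfolding V_def W_def by (auto simp: c_def)
    moreover have "fits a c" by (simp add: fits_def c_def)
    ultimately show ?thesis by blast
  qed
  obtain f where f: "f \<in> I" "f \<noteq> 0" using I(4) ideal.subspace_0[OF I(1)] by blast
  then obtain m0 where "m0 \<in> keys f" by fastforce
  then have m0: "monomial m0 \<in> I" using f(1) monomial_ideal_keys[OF I(2)] by blast
  have Ldual: "L \<subseteq> dual_partitions"
  proof
    fix \<mu> assume \<mu>: "\<mu> \<in> L"
    have "\<exists>j. \<mu> j \<noteq> \<infinity>"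
    proof (rule ccontr)
      assume "\<not> (\<exists>j. \<mu> j \<noteq> \<infinity>)"
      then have "fits (mdeg m0) \<mu>" by (simp add: fits_def)
      then have "mdeg m0 \<in> standard I" using \<mu> unfolding L_def M_def V_def W_def by auto
      then show False using m0 by (simp add: standard_def)
    qed
    then show "\<mu> \<in> dual_partitions" using \<mu> by (simp add: dual_partitions_def L_def)
  qed
  have finL: "finite L" using \<open>finite V\<close> unfolding L_def M_def by simp
  have LV: "\<mu> \<in> V" if "\<mu> \<in> L" for \<mu> using that by (simp add: L_def M_def)
  have cov: "covers (standard I) L"
    unfolding covers_def
  proof (intro allI iffI)
    fix a assume a: "a \<in> standard I"
    obtain c where c: "c \<in> V" "fits a c" using V_box[OF a] by blast
    obtain c' where c': "c' \<in> V" "c \<le> c'" "\<forall>b\<in>V. c' \<le> b \<longrightarrow> c' = b"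
      using finite_has_maximal2[OF \<open>finite V\<close> c(1)] by blast
    obtain \<sigma> :: "'n \<Rightarrow> 'n" where \<sigma>: "bij \<sigma>" "antimono (c' \<circ> \<sigma>)" using exists_sorting_perm by blast
    have "c' \<circ> \<sigma> \<in> L" using M_perm[OF _ \<sigma>(1), of c'] c' \<sigma>(2) by (simp add: L_def M_def)
    moreover have "fits a (c' \<circ> \<sigma> \<circ> inv \<sigma>)"
      using fits_mono[OF c(2) c'(2)] by (simp add: comp_inv_bij[OF \<sigma>(1)])
    ultimately show "0 \<le> a \<and> (\<exists>\<mu>\<in>L. \<exists>\<sigma>. bij \<sigma> \<and> fits a (\<mu> \<circ> \<sigma>))"
      using a bij_imp_bij_inv[OF \<sigma>(1)] by (auto simp: standard_def)
  next
    fix a :: "'n \<Rightarrow> int" assume "0 \<le> a \<and> (\<exists>\<mu>\<in>L. \<exists>\<sigma>. bij \<sigma> \<and> fits a (\<mu> \<circ> \<sigma>))"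
    then obtain \<mu> \<sigma> where "0 \<le> a" "\<mu> \<in> L" "bij \<sigma>" "fits a (\<mu> \<circ> \<sigma>)" by blast
    then show "a \<in> standard I" using V_perm[OF LV] unfolding V_def W_def by blast
  qed
  have "\<not> covers (standard I) (L - {\<mu>})" if \<mu>: "\<mu> \<in> L" for \<mu>
  proof
    assume c: "covers (standard I) (L - {\<mu>})"
    have "\<exists>\<nu>\<in>L - {\<mu>}. \<mu> \<le> \<nu>"
    proof (rule component_below_component)
      show "finite (L - {\<mu>})" "L - {\<mu>} \<subseteq> dual_partitions" "\<mu> \<in> dual_partitions"
        using finL Ldual \<mu> by auto
      fix a assume "0 \<le> a" "fits a \<mu>"
      then have "a \<in> standard I" using covers_component[OF cov \<mu>] by blast
      then show "\<exists>\<nu>\<in>L - {\<mu>}. \<exists>\<sigma>. bij \<sigma> \<and> fits a (\<nu> \<circ> \<sigma>)" using c unfolding covers_def by blast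
    qed
    then show False using \<mu> unfolding L_def M_def by blast
  qed
  then show ?thesis using finL Ldual cov unfolding irredundant_cover_def by blast
qed

lemma dual_generators_irredundant_cover:
  fixes I :: "('n::{finite,linorder}, 'k::field) mpoly set"
  assumes I: "ideal I" "monomial_ideal I" "perm_invariant I" "I \<noteq> {0}"
  shows "irredundant_cover (standard I) (dual_generators I)"
proof -
  have "dual_generators I = (THE L. irredundant_cover (standard I) L)"
    unfolding dual_generators_def irredundant_cover_def intersection_iff_covers[OF I(2)] ..
  moreover obtain L where L: "irredundant_cover (standard I) L"
    using irredundant_cover_exists[OF I] by blast
  have "irredundant_cover (standard I) (THE L. irredundant_cover (standard I) L)"
  proof (rule theI[of "irredundant_cover (standard I)", OF L])
    fix L' assume "irredundant_cover (standard I) L'"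
    with L show "L' = L" by (intro antisym irredundant_cover_subset)
  qed
  ultimately show ?thesis by simp
qed

section \<open>Extremal pairs\<close>

lemma dual_tilde_simps:
  "\<mu> j = \<infinity> \<Longrightarrow> dual_tilde \<mu> j = int (top_part \<mu>) + 1"
  "\<mu> j = enat d \<Longrightarrow> dual_tilde \<mu> j = int d + 1"
  by (simp_all add: dual_tilde_def)

lemma top_part_ge:
  fixes \<mu> :: "'n::finite \<Rightarrow> enat"
  assumes "\<mu> j = enat d"
  shows "d \<le> top_part \<mu>"
proof -
  have "finite {d. \<exists>j. \<mu> j = enat d}"
    by (rule finite_subset[of _ "the_enat ` range \<mu>"]) (auto simp: image_iff, metis the_enat.simps)
  then show ?thesis unfolding top_part_def using assms by (intro Max_ge) auto
qed

lemma top_part_attained: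
  fixes \<mu> :: "'n::{finite,linorder} \<Rightarrow> enat"
  assumes "\<mu> \<in> dual_partitions"
  shows "\<exists>j. \<mu> j = enat (top_part \<mu>)"
proof -
  have "finite {d. \<exists>j. \<mu> j = enat d}"
    by (rule finite_subset[of _ "the_enat ` range \<mu>"]) (auto simp: image_iff, metis the_enat.simps)
  moreover have "{d. \<exists>j. \<mu> j = enat d} \<noteq> {}" using assms by (auto simp: dual_partitions_def)
  ultimately have "top_part \<mu> \<in> {d. \<exists>j. \<mu> j = enat d}" unfolding top_part_def by (rule Max_in)
  then show ?thesis by simp
qed

lemma dual_tilde_le_top: "dual_tilde \<mu> j \<le> int (top_part \<mu>) + 1" for \<mu> :: "'n::finite \<Rightarrow> enat"
  by (cases "\<mu> j") (auto simp: dual_tilde_simps dest: top_part_ge)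

lemma dual_tilde_ge_1: "1 \<le> dual_tilde \<mu> j"
  by (cases "\<mu> j") (auto simp: dual_tilde_simps)

lemma antimono_dual_tilde:
  fixes \<mu> :: "'n::{finite,linorder} \<Rightarrow> enat"
  assumes "\<mu> \<in> dual_partitions"
  shows "antimono (dual_tilde \<mu>)"
proof (rule antimonoI)
  fix j k :: 'n assume "j \<le> k"
  then have le: "\<mu> k \<le> \<mu> j" using assms unfolding dual_partitions_def by (auto dest: antimonoD)
  show "dual_tilde \<mu> k \<le> dual_tilde \<mu> j"
  proof (cases "\<mu> j")
    case (enat d)
    with le obtain e where "\<mu> k = enat e" "e \<le> d" by (cases "\<mu> k") auto
    then show ?thesis using enat by (simp add: dual_tilde_simps)
  next
    case infinity
    then show ?thesis using dual_tilde_le_top[of \<mu> k] by (simp add: dual_tilde_simps)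
  qed
qed

lemma dual_len_less:
  fixes \<mu> :: "'n::{finite,linorder} \<Rightarrow> enat"
  assumes "\<mu> \<in> dual_partitions"
  shows "dual_len \<mu> < CARD('n)"
proof -
  obtain j where "\<mu> j \<noteq> \<infinity>" using assms by (auto simp: dual_partitions_def)
  then have "j \<notin> {j. \<mu> j = \<infinity>}" by simp
  then have "{j. \<mu> j = \<infinity>} \<subset> UNIV" by blast
  then show ?thesis unfolding dual_len_def by (intro psubset_card_mono) auto
qed

text \<open>
  The infinite entries form an initial segment, and \<open>\<nu>\<close> has at least as many of them, so \<open>\<nu>\<close> is
  infinite wherever \<open>\<mu>\<close> is. Where both are finite, the tilde adds one to each.
\<close>

lemma le_of_dual_tilde_le:
  fixes \<mu> \<nu> :: "'n::{finite,linorder} \<Rightarrow> enat"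
  assumes \<mu>: "\<mu> \<in> dual_partitions" and \<nu>: "\<nu> \<in> dual_partitions"
    and t: "dual_tilde \<mu> \<le> dual_tilde \<nu>" and len: "dual_len \<mu> \<le> dual_len \<nu>"
  shows "\<mu> \<le> \<nu>"
proof (rule le_funI)
  fix j
  show "\<mu> j \<le> \<nu> j"
  proof (cases "\<nu> j")
    case (enat e)
    show ?thesis
    proof (cases "\<mu> j")
      case (enat d)
      then show ?thesis using le_funD[OF t, of j] \<open>\<nu> j = enat e\<close> by (simp add: dual_tilde_simps)
    next
      case infinity
      have "{..j} \<subseteq> {k. \<mu> k = \<infinity>}"
      proof
        fix k assume "k \<in> {..j}"
        then have "\<mu> j \<le> \<mu> k" using \<mu> unfolding dual_partitions_def by (auto dest: antimonoD)
        then show "k \<in> {k. \<mu> k = \<infinity>}" using infinity by simp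
      qed
      then have "card {..j} \<le> dual_len \<mu>" unfolding dual_len_def by (intro card_mono) auto
      moreover have "{k. \<nu> k = \<infinity>} \<subseteq> {..<j}"
      proof
        fix k assume k: "k \<in> {k. \<nu> k = \<infinity>}"
        show "k \<in> {..<j}"
        proof (rule ccontr)
          assume "k \<notin> {..<j}"
          then have "j \<le> k" by simp
          then have "\<nu> k \<le> \<nu> j" using \<nu> unfolding dual_partitions_def by (auto dest: antimonoD)
          then show False using k enat by simp
        qed
      qed
      then have "dual_len \<nu> \<le> card {..<j}" unfolding dual_len_def by (intro card_mono) auto
      moreover have "card {..<j} < card {..j}" by (intro psubset_card_mono) auto
      ultimately show ?thesis using len by linarith
    qed
  qed simp
qed

lemma coversE:
  assumes "covers S L" "a \<in> S"
  obtains \<mu> \<tau> where "\<mu> \<in> L" "bij \<tau>" "fits a (\<mu> \<circ> \<tau>)"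
  using assms unfolding covers_def by blast

lemma coversI:
  fixes a :: "'n \<Rightarrow> int"
  assumes "covers S L" "0 \<le> a" "\<mu> \<in> L" "bij \<tau>" "fits a (\<mu> \<circ> \<tau>)"
  shows "a \<in> S"
  using assms unfolding covers_def by blast

lemma sum_comp_bij: "bij \<tau> \<Longrightarrow> (\<Sum>j\<in>UNIV. f (\<tau> j)) = (\<Sum>j\<in>UNIV. f j)"
  by (rule sum.reindex_bij_betw)

text \<open>
  Compare entrywise at a position \<open>j\<close>. A finite entry of \<open>\<mu>\<close> gains one in the tilde, which pays for
  the one subtracted from \<open>a\<close> on \<open>S\<close> or leaves a surplus of one outside \<open>S\<close>; an infinite entry
  becomes at least \<open>a_j\<close> by assumption and is counted once in \<open>\<ell>(\<mu>)\<close>. Summation gives the bound on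
  weights, sorting the one on partitions.
\<close>

lemma dual_tilde_dominates:
  fixes \<mu> :: "'n::{finite,linorder} \<Rightarrow> enat" and \<sigma> \<tau> :: "'n \<Rightarrow> 'n"
  assumes \<mu>: "\<mu> \<in> dual_partitions" and \<tau>: "bij \<tau>" and \<sigma>: "bij \<sigma>" and l: "antimono l"
    and fit: "fits (lower (l \<circ> \<sigma>) S) (\<mu> \<circ> \<tau>)" and nn: "0 \<le> lower (l \<circ> \<sigma>) S"
    and top: "\<And>j. l j \<le> int (top_part \<mu>) + 1"
  shows "l (\<sigma> j) \<le> dual_tilde \<mu> (\<tau> j)" and "l \<le> dual_tilde \<mu>"
    and "weight l + int (card (- S)) \<le> weight (dual_tilde \<mu>) + int (dual_len \<mu>)"
proof -
  have pt: "l (\<sigma> j) + (if j \<in> S then 0 else 1) \<le> dual_tilde \<mu> (\<tau> j) + (if \<mu> (\<tau> j) = \<infinity> then 1 else 0)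
      \<and> l (\<sigma> j) \<le> dual_tilde \<mu> (\<tau> j)" for j
  proof (cases "\<mu> (\<tau> j)")
    case (enat e)
    have "enat (nat (lower (l \<circ> \<sigma>) S j)) \<le> (\<mu> \<circ> \<tau>) j" using fit unfolding fits_def by blast
    then have "nat (lower (l \<circ> \<sigma>) S j) \<le> e" using enat by simp
    then have "lower (l \<circ> \<sigma>) S j \<le> int e" by linarith
    then show ?thesis using enat by (auto simp: lower_def dual_tilde_simps split: if_splits)
  next
    case infinity
    then show ?thesis using top[of "\<sigma> j"] by (simp add: dual_tilde_simps)
  qed
  then show "l (\<sigma> j) \<le> dual_tilde \<mu> (\<tau> j)" by blast
  show "l \<le> dual_tilde \<mu>"
  proof (rule le_of_permuted_le[OF l antimono_dual_tilde[OF \<mu>], of "\<sigma> \<circ> inv \<tau>"])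
    show "bij (\<sigma> \<circ> inv \<tau>)" using \<sigma> \<tau> by (intro bij_comp bij_imp_bij_inv)
    show "l ((\<sigma> \<circ> inv \<tau>) j) \<le> dual_tilde \<mu> j" for j
      using pt[of "inv \<tau> j"] \<tau> by (simp add: bij_is_surj surj_f_inv_f)
  qed
  have "(\<Sum>j\<in>UNIV. l (\<sigma> j) + (if j \<in> S then 0 else 1)) \<le>
      (\<Sum>j\<in>UNIV. dual_tilde \<mu> (\<tau> j) + (if \<mu> (\<tau> j) = \<infinity> then 1 else 0))"
    using pt by (intro sum_mono) blast
  moreover have "(\<Sum>j\<in>UNIV. l (\<sigma> j)) = weight l" unfolding weight_def by (rule sum_comp_bij[OF \<sigma>])
  moreover have "(\<Sum>j\<in>UNIV. dual_tilde \<mu> (\<tau> j)) = weight (dual_tilde \<mu>)"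
    unfolding weight_def by (rule sum_comp_bij[OF \<tau>])
  moreover have "(\<Sum>j\<in>UNIV. if j \<in> S then 0 else 1) = int (card (- S))"
  proof -
    have "(\<Sum>j\<in>UNIV. if j \<in> S then 0 else 1) = (\<Sum>j\<in>- S. 1 :: int)"
      by (rule sum.mono_neutral_cong_right) auto
    then show ?thesis by simp
  qed
  moreover have "(\<Sum>j\<in>UNIV. if \<mu> (\<tau> j) = \<infinity> then 1 else 0) = int (dual_len \<mu>)"
    using sum_comp_bij[OF \<tau>, of "\<lambda>j. if \<mu> j = \<infinity> then 1 else (0::int)"]
    by (simp add: sum.If_cases dual_len_def)
  ultimately show "weight l + int (card (- S)) \<le> weight (dual_tilde \<mu>) + int (dual_len \<mu>)"
    by (simp add: sum.distrib)
qed

text \<open>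
  The cone criterion fails at a position \<open>v\<close> where \<open>a\<close> is largest: there are a face \<open>S\<close> with \<open>v \<in> S\<close>
  and a permuted dual generator bounding \<open>a - e_S\<close>, while \<open>S - {v}\<close> is not a face. The entry at
  \<open>v\<close> must then equal \<open>a_v - 1\<close>, so the largest finite part of the dual generator is at least
  \<open>a_v - 1\<close>, which dominates all of \<open>a\<close> minus one. More than \<open>n - i\<close> infinite entries would put one
  of them at some \<open>k \<in> S\<close>. Exchanging it with the entry at \<open>v\<close> would be allowed since
  \<open>a_k \<le> a_v\<close>, and the result would show that \<open>S - {v}\<close> is a face after all.
\<close>

lemma tor_nonzero_dominated:
  fixes I :: "('n::{finite,linorder}, 'k::field) mpoly set"
  assumes I: "ideal I" "monomial_ideal I" and cov: "covers (standard I) L" and L: "L \<subseteq> dual_partitions"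
    and l: "antimono l" and \<sigma>: "bij \<sigma>" and i: "1 \<le> i" and nz: "\<not> tor_zero I i (l \<circ> \<sigma>)"
  shows "\<exists>\<mu>\<in>L. l \<le> dual_tilde \<mu> \<and> dual_len \<mu> + i \<le> CARD('n) \<and>
    weight l + (int CARD('n) - int i) \<le> weight (dual_tilde \<mu>) + int (dual_len \<mu>)"
proof -
  let ?a = "l \<circ> \<sigma>"
  have nex: "\<not> kcycles I ?a i \<subseteq> kboundaries I ?a i"
    using nz tor_zero_if_koszul_exact[OF I] by blast
  have "Max (range ?a) \<in> range ?a" by (intro Max_in) auto
  then obtain v where v: "Max (range ?a) = ?a v" by (rule imageE)
  have vmax: "?a j \<le> ?a v" for j unfolding v[symmetric] by (rule Max_ge) auto
  \<comment> \<open>Otherwise there are no faces of positive size at all.\<close>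
  have v1: "?a v \<ge> 1"
  proof (rule ccontr)
    assume neg: "\<not> ?a v \<ge> 1"
    have "z = 0" if z: "z \<in> kchains I ?a i" for z
    proof (rule ext, rule ccontr)
      fix S assume "z S \<noteq> 0 S"
      then have S: "S \<in> kfaces I ?a" "card S = i" using z by (auto simp: kchains_def)
      then have "S \<noteq> {}" using i by auto
      then obtain j where "j \<in> S" by blast
      then show False using le_funD[OF kfaces_nonneg[OF S(1)], of j] vmax[of j] neg
        by (simp add: lower_def)
    qed
    moreover have "0 = kdiff I ?a 0" by (auto simp: kdiff_def drop_sum_def fun_eq_iff)
    then have "0 \<in> kboundaries I ?a i" unfolding kboundaries_def kchains_def by auto
    ultimately show False using nex unfolding kcycles_def by blast
  qed
  have "\<not> (\<forall>S. S \<in> kfaces I ?a \<longrightarrow> card S = i \<longrightarrow> v \<in> S \<longrightarrow> S - {v} \<in> kfaces I ?a)"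
    using nex koszul_exact_cone[OF I(1), of ?a v i] v1 by blast
  then obtain S where S: "S \<in> kfaces I ?a" "card S = i" "v \<in> S" "S - {v} \<notin> kfaces I ?a" by blast
  have nn: "0 \<le> lower ?a S" by (rule kfaces_nonneg[OF S(1)])
  have nn': "0 \<le> lower ?a (S - {v})"
    using order_trans[OF nn lower_antimono[of "S - {v}" S ?a]] by blast
  from S(1) obtain \<mu> \<tau> where \<mu>: "\<mu> \<in> L" "bij \<tau>" "fits (lower ?a S) (\<mu> \<circ> \<tau>)"
    using coversE[OF cov] unfolding kfaces_def by blast
  have fitj: "enat (nat (lower ?a S j)) \<le> \<mu> (\<tau> j)" for j using \<mu>(3) unfolding fits_def by simp
  have not_face: "\<not> fits (lower ?a (S - {v})) (\<mu> \<circ> \<tau>')" if "bij \<tau>'" for \<tau>'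
    using coversI[OF cov nn' \<mu>(1) that] S(4) unfolding kfaces_def by blast
  have "\<not> enat (nat (?a v)) \<le> \<mu> (\<tau> v)"
  proof
    assume le: "enat (nat (?a v)) \<le> \<mu> (\<tau> v)"
    have "enat (nat (lower ?a (S - {v}) j)) \<le> (\<mu> \<circ> \<tau>) j" for j
      using fitj[of j] le by (cases "j = v") (simp_all add: lower_def)
    then show False using not_face[OF \<mu>(2)] unfolding fits_def by blast
  qed
  moreover have "enat (nat (?a v - 1)) \<le> \<mu> (\<tau> v)" using fitj[of v] S(3) by (simp add: lower_def)
  ultimately obtain d where d: "\<mu> (\<tau> v) = enat d" "int d = ?a v - 1"
    by (cases "\<mu> (\<tau> v)") auto
  have \<mu>d: "\<mu> \<in> dual_partitions" using L \<mu>(1) by blast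
  have "l j \<le> int (top_part \<mu>) + 1" for j
  proof -
    have "l j = ?a (inv \<sigma> j)" using \<sigma> by (simp add: bij_is_surj surj_f_inv_f)
    also have "\<dots> \<le> ?a v" by (rule vmax)
    also have "\<dots> \<le> int (top_part \<mu>) + 1" using d top_part_ge[of \<mu> "\<tau> v" d] by simp
    finally show ?thesis .
  qed
  note dom = dual_tilde_dominates[OF \<mu>d \<mu>(2) \<sigma> l \<mu>(3) nn this]
  have card_compl: "card (- S) = CARD('n) - i" "i \<le> CARD('n)"
    using S(2) card_mono[of UNIV S] by (auto simp: Compl_eq_Diff_UNIV card_Diff_subset)
  have "dual_len \<mu> + i \<le> CARD('n)"
  proof (rule ccontr)
    assume "\<not> dual_len \<mu> + i \<le> CARD('n)"
    moreover have "card {j. \<mu> (\<tau> j) = \<infinity>} = dual_len \<mu>"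
    proof -
      have "\<tau> ` {j. \<mu> (\<tau> j) = \<infinity>} = {j. \<mu> j = \<infinity>}"
        using \<mu>(2) by (auto simp: image_iff) (metis bij_pointE)
      then show ?thesis unfolding dual_len_def
        using card_image[of \<tau> "{j. \<mu> (\<tau> j) = \<infinity>}"] bij_is_inj[OF \<mu>(2)] by (metis inj_on_subset subset_UNIV)
    qed
    moreover have "card {j. \<mu> (\<tau> j) = \<infinity>} \<le> card (- S)" if "{j. \<mu> (\<tau> j) = \<infinity>} \<inter> S = {}"
      using that by (intro card_mono) auto
    ultimately have "{j. \<mu> (\<tau> j) = \<infinity>} \<inter> S \<noteq> {}" using card_compl by fastforce
    then obtain k where k: "\<mu> (\<tau> k) = \<infinity>" "k \<in> S" by blast
    then have kv: "k \<noteq> v" using d by auto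
    \<comment> \<open>Exchange the finite entry at \<open>v\<close> with the infinite entry at \<open>k\<close>.\<close>
    let ?p = "\<lambda>x. if x = v then k else if x = k then v else x"
    have "bij ?p" by (rule bij_betw_byWitness[where f' = ?p]) auto
    then have "bij (\<tau> \<circ> ?p)" using \<mu>(2) by (rule bij_comp)
    moreover have "fits (lower ?a (S - {v})) (\<mu> \<circ> (\<tau> \<circ> ?p))"
      unfolding fits_def
    proof
      fix j
      show "enat (nat (lower ?a (S - {v}) j)) \<le> (\<mu> \<circ> (\<tau> \<circ> ?p)) j"
      proof (cases "j = v")
        case True
        then show ?thesis using k(1) by simp
      next
        case jv: False
        show ?thesis
        proof (cases "j = k")
          case True
          have "nat (?a k - 1) \<le> d" using d(2) vmax[of k] by linarith
          then show ?thesis using True kv k(2) d(1) by (simp add: lower_def)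
        next
          case False
          then show ?thesis using jv fitj[of j] by (simp add: lower_def)
        qed
      qed
    qed
    ultimately show False using not_face by blast
  qed
  moreover have "weight l + (int CARD('n) - int i) \<le> weight (dual_tilde \<mu>) + int (dual_len \<mu>)"
    using dom(3) card_compl by simp
  ultimately show ?thesis using \<mu>(1) dom(2) by blast
qed

lemma exists_bij_fixing_outside:
  assumes "finite B" "A \<subseteq> B" "A' \<subseteq> B" "card A = card A'"
  shows "\<exists>\<tau>. bij \<tau> \<and> \<tau> ` A = A' \<and> \<tau> ` (B - A) = B - A' \<and> (\<forall>j. j \<notin> B \<longrightarrow> \<tau> j = j)"
proof -
  have fin: "finite A" "finite A'" using assms finite_subset by auto
  obtain f where f: "bij_betw f A A'" using finite_same_card_bij[OF fin assms(4)] by blast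
  have "card (B - A) = card (B - A')" using assms fin by (simp add: card_Diff_subset)
  then obtain g where g: "bij_betw g (B - A) (B - A')"
    using finite_same_card_bij[of "B - A" "B - A'"] assms(1) by auto
  define \<tau> where "\<tau> j = (if j \<in> A then f j else if j \<in> B then g j else j)" for j
  have 1: "bij_betw \<tau> A A'" using f by (rule bij_betw_cong[THEN iffD1, rotated]) (simp add: \<tau>_def)
  have 2: "bij_betw \<tau> (B - A) (B - A')" using g by (rule bij_betw_cong[THEN iffD1, rotated]) (simp add: \<tau>_def)
  have 3: "bij_betw \<tau> (- B) (- B)"
    using bij_betw_id[of "- B"] by (rule bij_betw_cong[THEN iffD1, rotated]) (use assms(2) in \<open>auto simp: \<tau>_def\<close>)
  have "bij_betw \<tau> (A \<union> (B - A)) (A' \<union> (B - A'))" by (rule bij_betw_combine[OF 1 2]) auto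
  then have "bij_betw \<tau> (A \<union> (B - A) \<union> - B) (A' \<union> (B - A') \<union> - B)"
    by (rule bij_betw_combine[OF _ 3]) (use assms in auto)
  moreover have "A \<union> (B - A) \<union> - B = UNIV" "A' \<union> (B - A') \<union> - B = UNIV" using assms by auto
  ultimately have "bij \<tau>" by simp
  then show ?thesis using 1 2 assms(2) by (intro exI[of _ \<tau>]) (auto simp: bij_betw_def \<tau>_def)
qed

text \<open>
  A face \<open>S\<close> at \<open>\<rho>~\<close> of size at most \<open>n - \<ell>(\<rho>)\<close> comes from a dual generator \<open>\<mu>\<close>, and the entrywise
  comparison shows that \<open>\<mu>\<close> lies above \<open>\<rho>\<close>; its largest finite part cannot be smaller than that of
  \<open>\<rho>\<close>, since it would then be infinite on the whole top block and bound \<open>\<rho>\<close> componentwise.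
  Maximality gives \<open>\<mu> = \<rho>\<close>, all inequalities become equalities, and the complement of \<open>S\<close> is a set of
  infinite positions of a permutation of \<open>\<rho>\<close> inside the top block. Every subset of the block of the
  right size arises by permuting the block.
\<close>

lemma tor_dim_maximal:
  fixes I :: "('n::{finite,linorder}, 'k::field) mpoly set"
  assumes I: "ideal I" "monomial_ideal I" and irr: "irredundant_cover (standard I) L"
    and \<rho>: "\<rho> \<in> L" and maximal: "\<And>\<mu>. \<mu> \<in> L \<Longrightarrow> dual_le \<rho> \<mu> \<Longrightarrow> \<mu> = \<rho>"
  shows "tor_dim I (CARD('n) - dual_len \<rho>) (dual_tilde \<rho>) =
    ((dual_len \<rho> + top_mult \<rho> - 1) choose dual_len \<rho>)"
proof -
  have cov: "covers (standard I) L" and L: "L \<subseteq> dual_partitions"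
    using irr unfolding irredundant_cover_def by auto
  have \<rho>d: "\<rho> \<in> dual_partitions" using L \<rho> by blast
  let ?a = "dual_tilde \<rho>" and ?p = "dual_len \<rho>"
  define Inf where "Inf = {j. \<rho> j = \<infinity>}"
  define B where "B = {j. dual_tilde \<rho> j = int (top_part \<rho>) + 1}"
  \<comment> \<open>The block where \<open>\<rho>~\<close> is largest: the \<open>p0\<close> infinite and the \<open>p1\<close> largest finite positions.\<close>
  have B: "B = Inf \<union> {j. \<rho> j = enat (top_part \<rho>)}"
  proof -
    have "dual_tilde \<rho> j = int (top_part \<rho>) + 1 \<longleftrightarrow> \<rho> j = \<infinity> \<or> \<rho> j = enat (top_part \<rho>)" for j
      by (cases "\<rho> j") (auto simp: dual_tilde_simps)
    then show ?thesis by (auto simp: B_def Inf_def)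
  qed
  have cardB: "card B = ?p + top_mult \<rho>"
    unfolding B dual_len_def top_mult_def Inf_def by (rule card_Un_disjoint) auto
  obtain v where v: "\<rho> v = enat (top_part \<rho>)" using top_part_attained[OF \<rho>d] by blast
  have nn: "0 \<le> lower ?a S" for S
  proof (rule le_funI)
    show "0 j \<le> lower ?a S j" for j using dual_tilde_ge_1[of \<rho> j] by (simp add: lower_def)
  qed
  have card_compl: "card (- S) = CARD('n) - card S" for S :: "'n set"
    by (simp add: Compl_eq_Diff_UNIV card_Diff_subset)
  have p: "?p \<le> CARD('n)" using dual_len_less[OF \<rho>d] by simp
  have "tor_dim I (CARD('n) - ?p) ?a = (card B - 1) choose ?p"
  proof (rule tor_dim_skeleton[OF I, of v])
    show "v \<in> B" using v B by simp
    show "?a v \<ge> 1" by (rule dual_tilde_ge_1)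
    show "?p \<le> CARD('n)" by (rule p)
  next
    fix S assume S: "S \<in> kfaces I ?a" and small: "card S \<le> CARD('n) - ?p"
    from S obtain \<mu> \<tau> where \<mu>: "\<mu> \<in> L" "bij \<tau>" "fits (lower ?a S) (\<mu> \<circ> \<tau>)"
      using coversE[OF cov] unfolding kfaces_def by blast
    have \<mu>d: "\<mu> \<in> dual_partitions" using L \<mu>(1) by blast
    have fitj: "enat (nat (lower ?a S j)) \<le> \<mu> (\<tau> j)" for j using \<mu>(3) unfolding fits_def by simp
    have top: "top_part \<rho> \<le> top_part \<mu>"
    proof (rule ccontr)
      assume "\<not> top_part \<rho> \<le> top_part \<mu>"
      then have less: "top_part \<mu> < top_part \<rho>" by simp
      have "\<rho> j \<le> \<mu> (\<tau> j)" for j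
      proof (cases "\<rho> j")
        case (enat d)
        have "enat d \<le> enat (nat (lower ?a S j))" using enat by (simp add: lower_def dual_tilde_simps nat_add_distrib)
        also have "\<dots> \<le> \<mu> (\<tau> j)" by (rule fitj)
        finally show ?thesis using enat by simp
      next
        case infinity
        have "\<mu> (\<tau> j) = \<infinity>"
        proof (cases "\<mu> (\<tau> j)")
          case (enat e)
          then have "nat (lower ?a S j) \<le> e" using fitj[of j] by simp
          then have "top_part \<rho> \<le> e" using infinity by (auto simp: lower_def dual_tilde_simps split: if_splits)
          then show ?thesis using top_part_ge[of \<mu> "\<tau> j" e] enat less by simp
        qed simp
        then show ?thesis by simp
      qed
      then have "\<rho> (inv \<tau> j) \<le> \<mu> j" for j using \<mu>(2) by (metis bij_is_surj surj_f_inv_f)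
      then have "\<rho> \<le> \<mu>"
        using le_of_permuted_le[of \<rho> \<mu> "inv \<tau>"] bij_imp_bij_inv[OF \<mu>(2)] \<rho>d \<mu>d
        unfolding dual_partitions_def by blast
      then have "\<rho> = \<mu>" using irredundant_cover_antichain[OF irr \<rho> \<mu>(1)] by blast
      then show False using less by simp
    qed
    have topj: "dual_tilde \<rho> j \<le> int (top_part \<mu>) + 1" for j
      using dual_tilde_le_top[of \<rho> j] top by simp
    have dom: "dual_tilde \<rho> j \<le> dual_tilde \<mu> (\<tau> j)" "dual_tilde \<rho> \<le> dual_tilde \<mu>"
      "weight (dual_tilde \<rho>) + int (card (- S)) \<le> weight (dual_tilde \<mu>) + int (dual_len \<mu>)" for j
      using dual_tilde_dominates[OF \<mu>d \<mu>(2) bij_id antimono_dual_tilde[OF \<rho>d], of S] \<mu>(3) nn topj by auto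
    have p_le: "?p \<le> card (- S)" using small p card_compl[of S] by simp
    then have "dual_le \<rho> \<mu>" using dom(2,3) unfolding dual_le_def by simp
    then have eq: "\<mu> = \<rho>" using maximal \<mu>(1) by blast
    have "card (- S) = ?p" using dom(3) p_le eq by simp
    moreover have "- S \<subseteq> B"
    proof
      fix j assume "j \<in> - S"
      have tilde_eq: "dual_tilde \<rho> j = dual_tilde \<rho> (\<tau> j)"
      proof (rule ccontr)
        assume "dual_tilde \<rho> j \<noteq> dual_tilde \<rho> (\<tau> j)"
        then have "(\<Sum>j\<in>UNIV. dual_tilde \<rho> j) < (\<Sum>j\<in>UNIV. dual_tilde \<rho> (\<tau> j))"
          using dom(1) eq by (intro sum_strict_mono_ex1) (auto simp: less_le)
        then show False using sum_comp_bij[OF \<mu>(2), of "dual_tilde \<rho>"] by simp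
      qed
      have "\<rho> (\<tau> j) = \<infinity>"
      proof (cases "\<rho> (\<tau> j)")
        case (enat e)
        have "enat (nat (?a j)) \<le> enat e" using fitj[of j] \<open>j \<in> - S\<close> eq enat by (simp add: lower_def)
        then show ?thesis using tilde_eq enat by (simp add: dual_tilde_simps)
      qed simp
      then show "j \<in> B" using tilde_eq by (simp add: B_def dual_tilde_simps)
    qed
    ultimately show "card (- S) = ?p \<and> - S \<subseteq> B" by simp
  next
    fix S assume S: "- S \<subseteq> B" "card (- S) = ?p"
    have "Inf \<subseteq> B" using B by blast
    moreover have "card (- S) = card Inf" using S(2) by (simp add: dual_len_def Inf_def)
    ultimately obtain \<tau> where \<tau>: "bij \<tau>" "\<tau> ` (- S) = Inf" "\<tau> ` (B - - S) = B - Inf"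
      "\<And>j. j \<notin> B \<Longrightarrow> \<tau> j = j"
      using exists_bij_fixing_outside[OF _ S(1)] by (metis finite)
    have "fits (lower ?a S) (\<rho> \<circ> \<tau>)"
      unfolding fits_def
    proof
      fix j
      show "enat (nat (lower ?a S j)) \<le> (\<rho> \<circ> \<tau>) j"
      proof (cases "j \<in> S")
        case False
        then have "\<tau> j \<in> Inf" using \<tau>(2) by blast
        then show ?thesis by (simp add: Inf_def)
      next
        case jS: True
        show ?thesis
        proof (cases "j \<in> B")
          case True
          then have "\<tau> j \<in> B - Inf" using \<tau>(3) jS by blast
          then have "\<rho> (\<tau> j) = enat (top_part \<rho>)" using B by blast
          then show ?thesis using True jS by (simp add: lower_def B_def)
        next
          case False
          then obtain d where "\<rho> j = enat d" using B unfolding Inf_def by (cases "\<rho> j") auto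
          then show ?thesis using \<tau>(4)[OF False] jS by (simp add: lower_def dual_tilde_simps)
        qed
      qed
    qed
    then show "S \<in> kfaces I ?a" unfolding kfaces_def using coversI[OF cov nn \<rho> \<tau>(1)] by blast
  qed
  then show ?thesis by (simp add: cardB)
qed

theorem theorem5p1:
  fixes I :: "('n::{finite,linorder}, 'k::field) mpoly set"
  assumes "ideal I" and "monomial_ideal I" and "perm_invariant I" and "I \<noteq> {0}"
  shows "{(i, l). extremal_pair I i l} =
      {(CARD('n) - dual_len \<rho>, dual_tilde \<rho>) | \<rho>. \<rho> \<in> maximal_dual_generators I} \<and>
    (\<forall>\<rho>\<in>maximal_dual_generators I.
       tor_dim I (CARD('n) - dual_len \<rho>) (dual_tilde \<rho>) =
         ((dual_len \<rho> + top_mult \<rho> - 1) choose dual_len \<rho>))"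
proof -
  note I = assms(1,2)
  let ?L = "dual_generators I" and ?n = "CARD('n)"
  have irr: "irredundant_cover (standard I) ?L" by (rule dual_generators_irredundant_cover[OF assms])
  then have cov: "covers (standard I) ?L" and L: "?L \<subseteq> dual_partitions"
    unfolding irredundant_cover_def by auto
  note dominated = tor_nonzero_dominated[OF I cov L]
  have dim: "tor_dim I (?n - dual_len \<rho>) (dual_tilde \<rho>) = ((dual_len \<rho> + top_mult \<rho> - 1) choose dual_len \<rho>)"
    if "\<rho> \<in> maximal_dual_generators I" for \<rho>
    using tor_dim_maximal[OF I irr, of \<rho>] that unfolding maximal_dual_generators_def by blast
  have nonzero: "\<not> tor_orbit_zero I (?n - dual_len \<rho>) (dual_tilde \<rho>)"
    if \<rho>: "\<rho> \<in> maximal_dual_generators I" for \<rho>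
  proof
    assume "tor_orbit_zero I (?n - dual_len \<rho>) (dual_tilde \<rho>)"
    then have "tor_zero I (?n - dual_len \<rho>) (dual_tilde \<rho> \<circ> id)"
      unfolding tor_orbit_zero_def using bij_id by blast
    then have "tor_dim I (?n - dual_len \<rho>) (dual_tilde \<rho>) = 0" by (simp add: tor_dim_def tor_zero_def)
    moreover have "\<exists>j. \<rho> j = enat (top_part \<rho>)"
      using \<rho> L by (intro top_part_attained) (auto simp: maximal_dual_generators_def)
    then have "top_mult \<rho> > 0" unfolding top_mult_def by (simp add: card_gt_0_iff)
    ultimately show False using dim[OF \<rho>] by (simp add: binomial_eq_0_iff)
  qed
  have "extremal_pair I (?n - dual_len \<rho>) (dual_tilde \<rho>)" if \<rho>: "\<rho> \<in> maximal_dual_generators I" for \<rho>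
  proof -
    have \<rho>L: "\<rho> \<in> ?L" and \<rho>d: "\<rho> \<in> dual_partitions" using \<rho> L by (auto simp: maximal_dual_generators_def)
    have len: "dual_len \<rho> < ?n" by (rule dual_len_less[OF \<rho>d])
    have "dual_tilde \<rho> \<in> partitions"
      using antimono_dual_tilde[OF \<rho>d] dual_tilde_ge_1[of \<rho>] by (auto simp: partitions_def intro: order_trans[of 0 1])
    moreover have "tor_orbit_zero I j m"
      if j: "j \<ge> ?n - dual_len \<rho>" and m: "m \<in> partitions" "m \<ge> dual_tilde \<rho>" "m \<noteq> dual_tilde \<rho>"
        "weight m - int j \<ge> weight (dual_tilde \<rho>) - int (?n - dual_len \<rho>)" for j m
    proof (rule ccontr)
      assume "\<not> tor_orbit_zero I j m"
      then obtain \<sigma> where \<sigma>: "bij \<sigma>" "\<not> tor_zero I j (m \<circ> \<sigma>)" unfolding tor_orbit_zero_def by blast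
      have "antimono m" "1 \<le> j" using m(1) j len by (auto simp: partitions_def)
      then obtain \<mu> where \<mu>: "\<mu> \<in> ?L" "m \<le> dual_tilde \<mu>"
        "weight m + (int ?n - int j) \<le> weight (dual_tilde \<mu>) + int (dual_len \<mu>)"
        using dominated[OF _ \<sigma>(1) _ \<sigma>(2)] by blast
      have "dual_le \<rho> \<mu>"
        unfolding dual_le_def using order_trans[OF m(2) \<mu>(2)] \<mu>(3) m(4) len by (simp add: of_nat_diff)
      then have "\<mu> = \<rho>" using \<rho> \<mu>(1) unfolding maximal_dual_generators_def by blast
      then show False using \<mu>(2) m(2,3) by (simp add: antisym)
    qed
    ultimately show ?thesis
      using nonzero[OF \<rho>] len unfolding extremal_pair_def by auto
  qed
  moreover have "\<exists>\<rho>\<in>maximal_dual_generators I. i = ?n - dual_len \<rho> \<and> l = dual_tilde \<rho>"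
    if ext: "extremal_pair I i l" for i l
  proof -
    have i: "1 \<le> i" "i \<le> ?n" and l: "l \<in> partitions" and nz: "\<not> tor_orbit_zero I i l"
      and van: "\<And>j m. j \<ge> i \<Longrightarrow> m \<in> partitions \<Longrightarrow> m \<ge> l \<Longrightarrow> m \<noteq> l \<Longrightarrow>
        weight m - int j \<ge> weight l - int i \<Longrightarrow> tor_orbit_zero I j m"
      using ext unfolding extremal_pair_def by auto
    let ?P = "\<lambda>\<mu>. \<mu> \<in> ?L \<and> l \<le> dual_tilde \<mu> \<and> dual_len \<mu> + i \<le> ?n \<and>
        weight l + (int ?n - int i) \<le> weight (dual_tilde \<mu>) + int (dual_len \<mu>)"
    obtain \<sigma> where \<sigma>: "bij \<sigma>" "\<not> tor_zero I i (l \<circ> \<sigma>)" using nz unfolding tor_orbit_zero_def by blast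
    have "antimono l" using l by (simp add: partitions_def)
    then obtain \<mu> where "?P \<mu>" using dominated[OF _ \<sigma>(1) i(1) \<sigma>(2)] by blast
    \<comment> \<open>The fewest infinite entries among the dual generators dominating \<open>(i, l)\<close>.\<close>
    then obtain \<rho> where \<rho>: "?P \<rho>" and least: "\<And>\<mu>. ?P \<mu> \<Longrightarrow> dual_len \<rho> \<le> dual_len \<mu>"
      using ex_has_least_nat[of ?P \<mu> dual_len] by blast
    have \<rho>d: "\<rho> \<in> dual_partitions" using \<rho> L by blast
    have "\<mu> = \<rho>" if \<mu>: "\<mu> \<in> ?L" "dual_le \<rho> \<mu>" for \<mu>
    proof -
      have t: "dual_tilde \<rho> \<le> dual_tilde \<mu>"
        and w: "int (dual_len \<rho>) - int (dual_len \<mu>) \<le> weight (dual_tilde \<mu>) - weight (dual_tilde \<rho>)"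
        using \<mu>(2) unfolding dual_le_def by auto
      have "dual_len \<rho> \<le> dual_len \<mu>"
      proof (cases "dual_len \<mu> \<le> dual_len \<rho>")
        case True
        have "?P \<mu>" using \<mu>(1) \<rho> order_trans[OF _ t, of l] w True by auto
        then show ?thesis by (rule least)
      qed simp
      then have "\<rho> \<le> \<mu>" using le_of_dual_tilde_le[OF \<rho>d _ t] L \<mu>(1) by blast
      then show ?thesis using irredundant_cover_antichain[OF irr _ \<mu>(1)] \<rho> by blast
    qed
    then have max: "\<rho> \<in> maximal_dual_generators I" using \<rho> unfolding maximal_dual_generators_def by blast
    have part: "dual_tilde \<rho> \<in> partitions"
      using antimono_dual_tilde[OF \<rho>d] dual_tilde_ge_1[of \<rho>] by (auto simp: partitions_def intro: order_trans[of 0 1])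
    have l_eq: "l = dual_tilde \<rho>"
    proof (rule ccontr)
      assume "l \<noteq> dual_tilde \<rho>"
      then have "tor_orbit_zero I (?n - dual_len \<rho>) (dual_tilde \<rho>)"
        using \<rho> part by (intro van) (auto simp: of_nat_diff)
      then show False using nonzero[OF max] by blast
    qed
    then have "int ?n - int i \<le> int (dual_len \<rho>)" "dual_len \<rho> + i \<le> ?n" using \<rho> by auto
    then have "i = ?n - dual_len \<rho>" by linarith
    then show ?thesis using max l_eq by blast
  qed
  ultimately show ?thesis using dim by blast
qed

end
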